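(* Let $R$ be a commutative noetherian local ring and $M$ a finitely generated $R$-module whose Betti numbers are eventually non-decreasing (i.e. there is $N_0$ with $\beta_{i}(M)\leq\beta_{i+1}(M)$ for all $i\geq N_0$). Then for all $n\gg 0$ (i.e. there is an integer $N$ such that for all $n\geq N$) the following hold: (a) $\operatorname{Min}(\Omega_n(M))\subseteq\operatorname{Min}(R)$; (b) $\operatorname{Supp}(\Omega_{n}(M))=\operatorname{Supp}(\Omega_{n+2i}(M))$ for all $i\geq 0$; and (c) if $\operatorname{Supp}(\Omega_{n}(M))\neq\operatorname{Spec}(R)$, then $\beta_{n+2i}(M)=\beta_{n+2i+1}(M)$ for all $i\geq 0$.
   Context: For a commutative noetherian local ring $R$ with maximal ideal $\mathfrak{m}$ and residue field $k=R/\mathfrak{m}$, and a finitely generated $R$-module $M$, the $i$th Betti number is $\beta_i(M)=\dim_k(\operatorname{Tor}^R_i(k,M))$, so $M$ has a minimal free resolution $\cdots\xrightarrow{\delta_3} R^{\beta_2(M)}\xrightarrow{\delta_2}R^{\beta_1(M)}\xrightarrow{\delta_1}R^{\beta_0(M)}\to 0$. The $i$th syzygy module of $M$ is $\Omega_i(M)=\operatorname{Coker}(\delta_{i+1})$ (so $\Omega_0(M)\cong M$). $\operatorname{Supp}(M)=\{\mathfrak{p}\in\operatorname{Spec}(R)\mid M_{\mathfrak{p}}\neq 0\}$, and $\operatorname{Min}(M)$ denotes the set of minimal elements of $\operatorname{Supp}(M)$ under inclusion; in particular $\operatorname{Min}(R)$ is the set of minimal primes of $R$. *)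

theory Defs
  imports
    "HOL-Algebra.QuotRing"
    "HOL-Algebra.Ring_Divisibility"
    "Jordan_Normal_Form.Missing_VectorSpace"
begin

text \<open>
  Linear-algebra notions such as \<^const>\<open>module_hom\<close>, \<^const>\<open>module.span\<close>,
  \<^const>\<open>vectorspace.dim\<close> and the free module \<^const>\<open>ring.func_space\<close> are those of the
  vector space library.  Modules are records over rings, so the fields \<open>mult\<close> and
  \<open>one\<close> of a module carry no information and their values below are arbitrary.
\<close>

section \<open>Noetherian local rings\<close>

locale noetherian_local_ring = cring R + noetherian_ring R for R (structure) +
  assumes unique_maximal: "\<exists>!I. maximalideal I R"

definition max_ideal :: "('a, 'r) ring_scheme \<Rightarrow> 'a set" where
  "max_ideal R = (THE I. maximalideal I R)"

abbreviation residue_field :: "('a, 'r) ring_scheme \<Rightarrow> 'a set ring" where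
  "residue_field R \<equiv> R Quot (max_ideal R)"

section \<open>Modules\<close>

definition finitely_generated :: "('a, 'r) ring_scheme \<Rightarrow> ('a, 'b, 'm) module_scheme \<Rightarrow> bool" where
  "finitely_generated R M \<longleftrightarrow>
     (\<exists>A. finite A \<and> A \<subseteq> carrier M \<and> module.span R M A = carrier M)"

definition ring_module :: "('a, 'r) ring_scheme \<Rightarrow> ('a, 'a) module" where
  "ring_module R =
     \<lparr>carrier = carrier R, mult = mult R, one = one R, zero = zero R, add = add R,
      smult = mult R\<rparr>"

definition quotient_module ::
    "('a, 'b, 'm) module_scheme \<Rightarrow> 'b set \<Rightarrow> ('a, 'b set) module" where
  "quotient_module M N =
     \<lparr>carrier = a_rcosets\<^bsub>M\<^esub> N, mult = (\<lambda>_ _. N), one = N, zero = N, add = set_add M,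
      smult = (\<lambda>a X. \<Union>x\<in>X. N +>\<^bsub>M\<^esub> (a \<odot>\<^bsub>M\<^esub> x))\<rparr>"

abbreviation power_module :: "('a, 'r) ring_scheme \<Rightarrow> nat \<Rightarrow> ('a, nat \<Rightarrow> 'a) module" where
  "power_module R n \<equiv> ring.func_space R {..<n}"

section \<open>Tensor products\<close>

text \<open>\<open>A \<otimes> B\<close> is the free module on \<open>carrier A \<times> carrier B\<close> modulo the
  submodule generated by the bilinearity relations.\<close>

definition free_module_on :: "('a, 'r) ring_scheme \<Rightarrow> 'x set \<Rightarrow> ('a, 'x \<Rightarrow> 'a) module" where
  "free_module_on R X =
     ring.func_space R X
       \<lparr>carrier := {f \<in> carrier (ring.func_space R X). finite {x \<in> X. f x \<noteq> \<zero>\<^bsub>R\<^esub>}}\<rparr>"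

definition free_gen :: "('a, 'r) ring_scheme \<Rightarrow> 'x set \<Rightarrow> 'x \<Rightarrow> 'x \<Rightarrow> 'a" where
  "free_gen R X x = (\<lambda>y\<in>X. if y = x then \<one>\<^bsub>R\<^esub> else \<zero>\<^bsub>R\<^esub>)"

definition tensor_relations ::
    "('a, 'r) ring_scheme \<Rightarrow> ('a, 'b, 'm) module_scheme \<Rightarrow> ('a, 'c, 'n) module_scheme
     \<Rightarrow> ('b \<times> 'c \<Rightarrow> 'a) set" where
  "tensor_relations R A B =
     (let X = carrier A \<times> carrier B; F = free_module_on R X; g = (\<lambda>x y. free_gen R X (x, y)) in
      {g (x \<oplus>\<^bsub>A\<^esub> x') y \<ominus>\<^bsub>F\<^esub> (g x y \<oplus>\<^bsub>F\<^esub> g x' y) | x x' y.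
          x \<in> carrier A \<and> x' \<in> carrier A \<and> y \<in> carrier B}
    \<union> {g x (y \<oplus>\<^bsub>B\<^esub> y') \<ominus>\<^bsub>F\<^esub> (g x y \<oplus>\<^bsub>F\<^esub> g x y') | x y y'.
          x \<in> carrier A \<and> y \<in> carrier B \<and> y' \<in> carrier B}
    \<union> {g (a \<odot>\<^bsub>A\<^esub> x) y \<ominus>\<^bsub>F\<^esub> (a \<odot>\<^bsub>F\<^esub> g x y) | a x y.
          a \<in> carrier R \<and> x \<in> carrier A \<and> y \<in> carrier B}
    \<union> {g x (a \<odot>\<^bsub>B\<^esub> y) \<ominus>\<^bsub>F\<^esub> (a \<odot>\<^bsub>F\<^esub> g x y) | a x y.
          a \<in> carrier R \<and> x \<in> carrier A \<and> y \<in> carrier B})"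

definition tensor_null ::
    "('a, 'r) ring_scheme \<Rightarrow> ('a, 'b, 'm) module_scheme \<Rightarrow> ('a, 'c, 'n) module_scheme
     \<Rightarrow> ('b \<times> 'c \<Rightarrow> 'a) set" where
  "tensor_null R A B =
     module.span R (free_module_on R (carrier A \<times> carrier B)) (tensor_relations R A B)"

definition tensor_module ::
    "('a, 'r) ring_scheme \<Rightarrow> ('a, 'b, 'm) module_scheme \<Rightarrow> ('a, 'c, 'n) module_scheme
     \<Rightarrow> ('a, ('b \<times> 'c \<Rightarrow> 'a) set) module" where
  "tensor_module R A B =
     quotient_module (free_module_on R (carrier A \<times> carrier B)) (tensor_null R A B)"

definition pure_tensor ::
    "('a, 'r) ring_scheme \<Rightarrow> ('a, 'b, 'm) module_scheme \<Rightarrow> ('a, 'c, 'n) module_scheme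
     \<Rightarrow> 'b \<Rightarrow> 'c \<Rightarrow> ('b \<times> 'c \<Rightarrow> 'a) set" where
  "pure_tensor R A B x y =
     tensor_null R A B +>\<^bsub>free_module_on R (carrier A \<times> carrier B)\<^esub>
       free_gen R (carrier A \<times> carrier B) (x, y)"

text \<open>\<open>A \<otimes> f\<close>; homomorphisms are determined only on the carrier, hence the choice
  operator rather than a definite description.\<close>

definition tensor_map ::
    "('a, 'r) ring_scheme \<Rightarrow> ('a, 'b, 'm) module_scheme
     \<Rightarrow> ('a, 'c, 'n) module_scheme \<Rightarrow> ('a, 'd, 'k) module_scheme \<Rightarrow> ('c \<Rightarrow> 'd)
     \<Rightarrow> ('b \<times> 'c \<Rightarrow> 'a) set \<Rightarrow> ('b \<times> 'd \<Rightarrow> 'a) set" where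
  "tensor_map R A B C f =
     (SOME h. h \<in> module_hom R (tensor_module R A B) (tensor_module R A C) \<and>
        (\<forall>x\<in>carrier A. \<forall>y\<in>carrier B. h (pure_tensor R A B x y) = pure_tensor R A C x (f y)))"

section \<open>Free resolutions and Tor\<close>

text \<open>A resolution \<open>\<dots> \<rightarrow> F 2 \<rightarrow> F 1 \<rightarrow> F 0 \<rightarrow> M \<rightarrow> 0\<close> by free modules
  \<open>F i = power_module R (r i)\<close> is a triple \<open>(r, d, e)\<close> of ranks, differentials
  \<open>d i : F i \<rightarrow> F (i - 1)\<close> for \<open>i \<ge> 1\<close> (\<open>d 0\<close> is irrelevant) and an augmentation \<open>e\<close>.
  Every finitely generated module over a noetherian ring has one.\<close>

type_synonym ('a, 'b) resolution =
  "(nat \<Rightarrow> nat) \<times> (nat \<Rightarrow> (nat \<Rightarrow> 'a) \<Rightarrow> nat \<Rightarrow> 'a) \<times> ((nat \<Rightarrow> 'a) \<Rightarrow> 'b)"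

definition free_resolution ::
    "('a, 'r) ring_scheme \<Rightarrow> ('a, 'b, 'm) module_scheme \<Rightarrow> ('a, 'b) resolution \<Rightarrow> bool" where
  "free_resolution R M = (\<lambda>(r, d, e).
     (let F = (\<lambda>i. power_module R (r i)) in
      (\<forall>i. d (Suc i) \<in> module_hom R (F (Suc i)) (F i)) \<and>
      e \<in> module_hom R (F 0) M \<and>
      e ` carrier (F 0) = carrier M \<and>
      a_kernel (F 0) M e = d 1 ` carrier (F 1) \<and>
      (\<forall>i. a_kernel (F (Suc i)) (F i) (d (Suc i)) = d (Suc (Suc i)) ` carrier (F (Suc (Suc i))))))"

text \<open>Minimality: \<open>d (i+1)\<close> maps into \<open>\<mm> F i\<close>, the vectors with all entries in
  the maximal ideal \<open>\<mm>\<close>.\<close>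

definition minimal_free_resolution ::
    "('a, 'r) ring_scheme \<Rightarrow> ('a, 'b, 'm) module_scheme \<Rightarrow> ('a, 'b) resolution \<Rightarrow> bool" where
  "minimal_free_resolution R M = (\<lambda>(r, d, e).
     free_resolution R M (r, d, e) \<and>
     (\<forall>i. \<forall>v\<in>carrier (power_module R (r (Suc i))). \<forall>j<r i. d (Suc i) v j \<in> max_ideal R))"

text \<open>The \<open>i\<close>th homology of \<open>N \<otimes> F\<close> for the non-augmented complex \<open>F\<close>.\<close>

definition tensor_homology ::
    "('a, 'r) ring_scheme \<Rightarrow> ('a, 'c, 'n) module_scheme \<Rightarrow> ('a, 'b) resolution \<Rightarrow> nat
     \<Rightarrow> ('a, ('c \<times> (nat \<Rightarrow> 'a) \<Rightarrow> 'a) set set) module" where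
  "tensor_homology R N = (\<lambda>(r, d, e) i.
     (let F = (\<lambda>j. power_module R (r j));
          T = (\<lambda>j. tensor_module R N (F j));
          D = (\<lambda>j. tensor_map R N (F j) (F (j - 1)) (d j));
          cycles = (if i = 0 then carrier (T 0) else a_kernel (T i) (T (i - 1)) (D i));
          boundaries = D (Suc i) ` carrier (T (Suc i))
      in quotient_module ((T i)\<lparr>carrier := cycles\<rparr>) boundaries))"

definition Tor ::
    "('a, 'r) ring_scheme \<Rightarrow> nat \<Rightarrow> ('a, 'c, 'n) module_scheme \<Rightarrow> ('a, 'b, 'm) module_scheme
     \<Rightarrow> ('a, ('c \<times> (nat \<Rightarrow> 'a) \<Rightarrow> 'a) set set) module" where
  "Tor R i N M = tensor_homology R N (SOME P. free_resolution R M P) i"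

section \<open>Betti numbers and syzygies\<close>

text \<open>An \<open>R\<close>-module annihilated by the ideal \<open>I\<close> is an \<open>R / I\<close>-module, a coset acting
  through any of its representatives.\<close>

definition over_quotient :: "('a, 'b, 'm) module_scheme \<Rightarrow> ('a set, 'b) module" where
  "over_quotient V =
     \<lparr>carrier = carrier V, mult = (\<lambda>_ _. zero V), one = zero V, zero = zero V, add = add V,
      smult = (\<lambda>c x. (SOME a. a \<in> c) \<odot>\<^bsub>V\<^esub> x)\<rparr>"

definition betti :: "('a, 'r) ring_scheme \<Rightarrow> ('a, 'b, 'm) module_scheme \<Rightarrow> nat \<Rightarrow> nat" where
  "betti R M i =
     vectorspace.dim (residue_field R)
       (over_quotient (Tor R i (quotient_module (ring_module R) (max_ideal R)) M))"

text \<open>Minimal free resolutions exist and are unique up to isomorphism; as usual, one is chosen.\<close>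

definition syzygy ::
    "('a, 'r) ring_scheme \<Rightarrow> ('a, 'b, 'm) module_scheme \<Rightarrow> nat
     \<Rightarrow> ('a, (nat \<Rightarrow> 'a) set) module" where
  "syzygy R M n =
     (let (r, d, e) = (SOME P. minimal_free_resolution R M P) in
      quotient_module (power_module R (r n)) (d (Suc n) ` carrier (power_module R (r (Suc n)))))"

section \<open>Localization and support\<close>

definition frac_rel ::
    "('a, 'b, 'm) module_scheme \<Rightarrow> 'a set \<Rightarrow> (('b \<times> 'a) \<times> ('b \<times> 'a)) set" where
  "frac_rel M S =
     {((x, s), (y, t)) | x s y t. x \<in> carrier M \<and> y \<in> carrier M \<and> s \<in> S \<and> t \<in> S \<and>
        (\<exists>u\<in>S. u \<odot>\<^bsub>M\<^esub> (t \<odot>\<^bsub>M\<^esub> x) = u \<odot>\<^bsub>M\<^esub> (s \<odot>\<^bsub>M\<^esub> y))}"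

definition frac :: "('a, 'b, 'm) module_scheme \<Rightarrow> 'a set \<Rightarrow> 'b \<Rightarrow> 'a \<Rightarrow> ('b \<times> 'a) set" where
  "frac M S x s = frac_rel M S `` {(x, s)}"

text \<open>\<open>S\<^sup>-\<^sup>1 M\<close> for a multiplicative set \<open>S\<close>, viewed as an \<open>R\<close>-module.\<close>

definition localization ::
    "('a, 'r) ring_scheme \<Rightarrow> ('a, 'b, 'm) module_scheme \<Rightarrow> 'a set \<Rightarrow> ('a, ('b \<times> 'a) set) module" where
  "localization R M S =
     \<lparr>carrier = (carrier M \<times> S) // frac_rel M S,
      mult = (\<lambda>_ _. frac M S \<zero>\<^bsub>M\<^esub> \<one>\<^bsub>R\<^esub>), one = frac M S \<zero>\<^bsub>M\<^esub> \<one>\<^bsub>R\<^esub>,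
      zero = frac M S \<zero>\<^bsub>M\<^esub> \<one>\<^bsub>R\<^esub>,
      add = (\<lambda>X Y. \<Union>(x, s)\<in>X. \<Union>(y, t)\<in>Y.
               frac M S ((t \<odot>\<^bsub>M\<^esub> x) \<oplus>\<^bsub>M\<^esub> (s \<odot>\<^bsub>M\<^esub> y)) (s \<otimes>\<^bsub>R\<^esub> t)),
      smult = (\<lambda>a X. \<Union>(x, s)\<in>X. frac M S (a \<odot>\<^bsub>M\<^esub> x) s)\<rparr>"

definition Spec :: "('a, 'r) ring_scheme \<Rightarrow> 'a set set" where
  "Spec R = {p. primeideal p R}"

definition Supp :: "('a, 'r) ring_scheme \<Rightarrow> ('a, 'b, 'm) module_scheme \<Rightarrow> 'a set set" where
  "Supp R M =
     {p \<in> Spec R. carrier (localization R M (carrier R - p))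
                    \<noteq> {zero (localization R M (carrier R - p))}}"

definition Min_Supp :: "('a, 'r) ring_scheme \<Rightarrow> ('a, 'b, 'm) module_scheme \<Rightarrow> 'a set set" where
  "Min_Supp R M = {p \<in> Supp R M. \<forall>q\<in>Supp R M. q \<subseteq> p \<longrightarrow> q = p}"

end

theory Submission
  imports Defs
begin

text \<open>
  Let \<open>F\<close> be the minimal free resolution with ranks \<open>b n = \<beta>\<^sub>n(M)\<close>.  Every prime in
  \<open>Supp (\<Omega>\<^sub>n)\<close>, \<open>n \<ge> 1\<close>, contains a prime of the finite set \<open>Ass R\<close> lying in \<open>Supp (\<Omega>\<^sub>n)\<close>,
  because \<open>\<Omega>\<^sub>n\<close> embeds into a free module.  If \<open>p = ann z\<close> is associated and
  \<open>p \<notin> Supp (\<Omega>\<^bsub>n+2\<^esub>)\<close>, then \<open>\<delta>\<^bsub>n+1\<^esub>\<close> is injective modulo \<open>p\<close> (multiply by \<open>z\<close>), hence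
  \<open>b (n+1) \<le> b n\<close>; if also \<open>b n \<le> b (n+1)\<close>, then \<open>\<delta>\<^bsub>n+1\<^esub>\<close> is locally surjective by Nakayama and
  \<open>p \<notin> Supp (\<Omega>\<^sub>n)\<close>.  So \<open>Ass R \<inter> Supp (\<Omega>\<^sub>n)\<close> increases in steps of two and stabilizes, which gives
  (b), and (c) follows from the rank inequality.  For (a), let \<open>p\<close> be minimal in \<open>Supp (\<Omega>\<^sub>n)\<close> but
  not in \<open>Spec R\<close>.  Then \<open>b n = b (n+1)\<close>, so \<open>\<delta>\<^bsub>n+1\<^esub>\<close> is locally an endomorphism with kernel
  \<open>\<Omega>\<^bsub>n+2\<^esub>\<close>, and the length of \<open>\<Omega>\<^bsub>n+2i\<^esub>\<close> at \<open>p\<close> strictly decreases with \<open>i\<close>, which is absurd.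
\<close>

section \<open>Modules and homomorphisms\<close>

text \<open>Forming localizations would change the ring and the type at every prime. Instead all
  modules stay over \<open>R\<close>: a claim about a localization at \<open>S\<close> is an
  inclusion up to \<open>sat\<close>, and the length of a localized quotient is counted by chains
  whose steps are proper up to \<open>sat\<close>. Likewise linear algebra over the fraction field
  of \<open>R / p\<close> becomes elimination with multipliers outside \<open>p\<close>. The step
  width two comes from exactness: the kernel of \<open>d (Suc n)\<close> is a copy of the syzygy
  with index n + 2, so local vanishing of that syzygy is local injectivity of
  \<open>d (Suc n)\<close>. Syzygies of even and of odd index are therefore controlled separately.
  The syzygy of index 0 is \<open>M\<close> itself, which need not embed into a free module; hence
  the restriction to positive indices. A further obstacle is that \<open>betti\<close> refers to an
  arbitrary chosen free resolution and \<open>syzygy\<close> to a chosen minimal one. They are tied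
  together by the least number of generators of the homology of \<open>k \<otimes> F\<close>, a
  number that chain maps transport in both directions and that equals the rank for a minimal
  resolution.\<close>

lemma module_surj_image:
  fixes R :: "('a, 'r) ring_scheme" and Z :: "('a, 'b, 'm) module_scheme"
    and T :: "('a, 'c, 'n) module_scheme"
  assumes "module R Z" and onto: "f ` carrier Z = carrier T"
    and add: "\<And>x y. x \<in> carrier Z \<Longrightarrow> y \<in> carrier Z \<Longrightarrow> f (x \<oplus>\<^bsub>Z\<^esub> y) = f x \<oplus>\<^bsub>T\<^esub> f y"
    and smult: "\<And>a x. a \<in> carrier R \<Longrightarrow> x \<in> carrier Z \<Longrightarrow> f (a \<odot>\<^bsub>Z\<^esub> x) = a \<odot>\<^bsub>T\<^esub> f x"
    and zero: "f \<zero>\<^bsub>Z\<^esub> = \<zero>\<^bsub>T\<^esub>"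
  shows "module R T"
proof -
  interpret Z: module R Z by fact
  \<comment> \<open>Every element of \<open>T\<close> is a value of \<open>f\<close>, so each axiom
    is inherited from \<open>Z\<close>. That \<open>f\<close> respects zero is a hypothesis because
    \<open>T\<close> is so far a bare record, whose zero field could be anything.\<close>
  have im: "\<exists>x\<in>carrier Z. f x = t" if "t \<in> carrier T" for t
    using that onto by (metis imageE)
  have cl: "f x \<in> carrier T" if "x \<in> carrier Z" for x
    using that onto by auto
  show ?thesis
  proof (rule module_criteria)
    show "cring R" by (rule Z.R.is_cring)
    show "\<zero>\<^bsub>T\<^esub> \<in> carrier T" using cl[of "\<zero>\<^bsub>Z\<^esub>"] zero by simp
    show "\<forall>v w. v \<in> carrier T \<and> w \<in> carrier T \<longrightarrow> v \<oplus>\<^bsub>T\<^esub> w \<in> carrier T"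
      by (metis im add cl Z.M.add.m_closed)
    show "\<forall>v\<in>carrier T. \<exists>neg_v\<in>carrier T. v \<oplus>\<^bsub>T\<^esub> neg_v = \<zero>\<^bsub>T\<^esub>"
    proof
      fix v assume "v \<in> carrier T"
      then obtain x where x: "x \<in> carrier Z" "f x = v" using im by blast
      have "f (\<ominus>\<^bsub>Z\<^esub> x) \<in> carrier T" "v \<oplus>\<^bsub>T\<^esub> f (\<ominus>\<^bsub>Z\<^esub> x) = \<zero>\<^bsub>T\<^esub>"
        using x cl add[of x "\<ominus>\<^bsub>Z\<^esub> x"] zero by (auto simp: Z.M.r_neg)
      then show "\<exists>neg_v\<in>carrier T. v \<oplus>\<^bsub>T\<^esub> neg_v = \<zero>\<^bsub>T\<^esub>" by blast
    qed
    show "\<forall>c v. c \<in> carrier R \<and> v \<in> carrier T \<longrightarrow> c \<odot>\<^bsub>T\<^esub> v \<in> carrier T"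
      by (metis im smult cl Z.smult_closed)
    show "\<forall>v w. v \<in> carrier T \<and> w \<in> carrier T \<longrightarrow> v \<oplus>\<^bsub>T\<^esub> w = w \<oplus>\<^bsub>T\<^esub> v"
      by (metis im add Z.M.a_comm)
    show "\<forall>v w x. v \<in> carrier T \<and> w \<in> carrier T \<and> x \<in> carrier T \<longrightarrow>
        v \<oplus>\<^bsub>T\<^esub> w \<oplus>\<^bsub>T\<^esub> x = v \<oplus>\<^bsub>T\<^esub> (w \<oplus>\<^bsub>T\<^esub> x)"
    proof (intro allI impI)
      fix v w x assume "v \<in> carrier T \<and> w \<in> carrier T \<and> x \<in> carrier T"
      then obtain a b c where "a \<in> carrier Z" "b \<in> carrier Z" "c \<in> carrier Z"
        "f a = v" "f b = w" "f c = x" using im by metis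
      then show "v \<oplus>\<^bsub>T\<^esub> w \<oplus>\<^bsub>T\<^esub> x = v \<oplus>\<^bsub>T\<^esub> (w \<oplus>\<^bsub>T\<^esub> x)"
        by (auto simp flip: add simp: Z.M.a_assoc)
    qed
    show "\<forall>v\<in>carrier T. v \<oplus>\<^bsub>T\<^esub> \<zero>\<^bsub>T\<^esub> = v"
      by (metis im add zero Z.M.r_zero Z.M.zero_closed)
    show "\<forall>a b v. a \<in> carrier R \<and> b \<in> carrier R \<and> v \<in> carrier T \<longrightarrow>
        (a \<otimes>\<^bsub>R\<^esub> b) \<odot>\<^bsub>T\<^esub> v = a \<odot>\<^bsub>T\<^esub> (b \<odot>\<^bsub>T\<^esub> v)"
      by (metis im smult Z.smult_assoc1 Z.R.m_closed Z.smult_closed)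
    show "\<forall>v\<in>carrier T. \<one>\<^bsub>R\<^esub> \<odot>\<^bsub>T\<^esub> v = v"
      by (metis im smult Z.smult_one Z.R.one_closed)
    show "\<forall>a b v. a \<in> carrier R \<and> b \<in> carrier R \<and> v \<in> carrier T \<longrightarrow>
        (a \<oplus>\<^bsub>R\<^esub> b) \<odot>\<^bsub>T\<^esub> v = a \<odot>\<^bsub>T\<^esub> v \<oplus>\<^bsub>T\<^esub> b \<odot>\<^bsub>T\<^esub> v"
    proof (intro allI impI)
      fix a b v assume h: "a \<in> carrier R \<and> b \<in> carrier R \<and> v \<in> carrier T"
      then obtain x where "x \<in> carrier Z" "f x = v" using im by metis
      then show "(a \<oplus>\<^bsub>R\<^esub> b) \<odot>\<^bsub>T\<^esub> v = a \<odot>\<^bsub>T\<^esub> v \<oplus>\<^bsub>T\<^esub> b \<odot>\<^bsub>T\<^esub> v"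
        using h by (auto simp flip: add smult simp: Z.smult_l_distr)
    qed
    show "\<forall>a v w. a \<in> carrier R \<and> v \<in> carrier T \<and> w \<in> carrier T \<longrightarrow>
        a \<odot>\<^bsub>T\<^esub> (v \<oplus>\<^bsub>T\<^esub> w) = a \<odot>\<^bsub>T\<^esub> v \<oplus>\<^bsub>T\<^esub> a \<odot>\<^bsub>T\<^esub> w"
    proof (intro allI impI)
      fix a v w assume h: "a \<in> carrier R \<and> v \<in> carrier T \<and> w \<in> carrier T"
      then obtain x y where "x \<in> carrier Z" "f x = v" "y \<in> carrier Z" "f y = w" using im by metis
      then show "a \<odot>\<^bsub>T\<^esub> (v \<oplus>\<^bsub>T\<^esub> w) = a \<odot>\<^bsub>T\<^esub> v \<oplus>\<^bsub>T\<^esub> a \<odot>\<^bsub>T\<^esub> w"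
        using h by (auto simp flip: add smult simp: Z.smult_r_distr)
    qed
  qed
qed

section \<open>Submodules, their sums, and cyclic submodules\<close>

lemma submodule_minus:
  assumes "submodule R N M" "x \<in> N" "y \<in> N"
  shows "x \<ominus>\<^bsub>M\<^esub> y \<in> N"
proof -
  interpret N: submodule R N M by fact
  interpret M: module R M by (rule N.module)
  have "y \<in> carrier M" using N.subset assms(3) by blast
  \<comment> \<open>\<open>submodule\<close> demands closure under sums and multiples; negatives
    come from the scalar -1.\<close>
  then have "x \<ominus>\<^bsub>M\<^esub> y = x \<oplus>\<^bsub>M\<^esub> (\<ominus>\<^bsub>R\<^esub> \<one>\<^bsub>R\<^esub>) \<odot>\<^bsub>M\<^esub> y"
    by (simp add: a_minus_def M.smult_minus_1)
  then show ?thesis using assms N.m_closed N.smult_closed by simp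
qed

lemma submoduleD:
  assumes "submodule R N M"
  shows "module R M" "N \<subseteq> carrier M" "\<zero>\<^bsub>M\<^esub> \<in> N"
    "\<And>x y. x \<in> N \<Longrightarrow> y \<in> N \<Longrightarrow> x \<oplus>\<^bsub>M\<^esub> y \<in> N"
    "\<And>a x. a \<in> carrier R \<Longrightarrow> x \<in> N \<Longrightarrow> a \<odot>\<^bsub>M\<^esub> x \<in> N"
    "\<And>x. x \<in> N \<Longrightarrow> x \<in> carrier M"
  using assms unfolding submodule_def by auto

lemma (in module) submodule_carrier: "submodule R (carrier M) M"
  by (simp add: submodule_def module_axioms)

lemma (in module) submodule_zero: "submodule R {\<zero>\<^bsub>M\<^esub>} M"
  by (simp add: submodule_def module_axioms)

lemma submodule_Int:
  "submodule R N M \<Longrightarrow> submodule R N' M \<Longrightarrow> submodule R (N \<inter> N') M"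
  unfolding submodule_def by auto

definition msum :: "('a, 'b, 'm) module_scheme \<Rightarrow> 'b set \<Rightarrow> 'b set \<Rightarrow> 'b set" where
  "msum M N N' = {x \<oplus>\<^bsub>M\<^esub> y | x y. x \<in> N \<and> y \<in> N'}"

lemma msumI: "x \<in> N \<Longrightarrow> y \<in> N' \<Longrightarrow> x \<oplus>\<^bsub>M\<^esub> y \<in> msum M N N'"
  unfolding msum_def by blast

lemma msumE:
  assumes "z \<in> msum M N N'"
  obtains x y where "x \<in> N" "y \<in> N'" "z = x \<oplus>\<^bsub>M\<^esub> y"
  using assms unfolding msum_def by blast

lemma (in module) add_exchange:
  assumes "a \<in> carrier M" "b \<in> carrier M" "c \<in> carrier M" "d \<in> carrier M"
  shows "(a \<oplus>\<^bsub>M\<^esub> b) \<oplus>\<^bsub>M\<^esub> (c \<oplus>\<^bsub>M\<^esub> d) = (a \<oplus>\<^bsub>M\<^esub> c) \<oplus>\<^bsub>M\<^esub> (b \<oplus>\<^bsub>M\<^esub> d)"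
  using assms by (simp add: M.a_ac)

lemma (in module) minus_add_cancel:
  assumes "a \<in> carrier M" "b \<in> carrier M"
  shows "a \<oplus>\<^bsub>M\<^esub> (b \<ominus>\<^bsub>M\<^esub> a) = b" "(b \<ominus>\<^bsub>M\<^esub> a) \<oplus>\<^bsub>M\<^esub> a = b" "(b \<oplus>\<^bsub>M\<^esub> a) \<ominus>\<^bsub>M\<^esub> a = b"
    "(a \<oplus>\<^bsub>M\<^esub> b) \<ominus>\<^bsub>M\<^esub> a = b"
proof -
  show b: "a \<oplus>\<^bsub>M\<^esub> (b \<ominus>\<^bsub>M\<^esub> a) = b"
    using assms M.r_neg1[of a b] M.a_comm[of a "\<ominus>\<^bsub>M\<^esub> a"]
    by (simp add: a_minus_def M.a_comm[of b] flip: M.a_assoc)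
  then show "(b \<ominus>\<^bsub>M\<^esub> a) \<oplus>\<^bsub>M\<^esub> a = b" using assms by (simp add: M.a_comm)
  show c: "(b \<oplus>\<^bsub>M\<^esub> a) \<ominus>\<^bsub>M\<^esub> a = b" using assms by (simp add: a_minus_def M.a_assoc M.r_neg)
  then show "(a \<oplus>\<^bsub>M\<^esub> b) \<ominus>\<^bsub>M\<^esub> a = b" using assms by (simp add: M.a_comm)
qed

lemma submodule_msum:
  assumes N: "submodule R N M" and N': "submodule R N' M"
  shows "submodule R (msum M N N') M" "N \<subseteq> msum M N N'" "N' \<subseteq> msum M N N'"
proof -
  interpret M: module R M using N by (rule submoduleD)
  note D = submoduleD[OF N] submoduleD[OF N']
  show "submodule R (msum M N N') M"
  proof (rule submodule.intro)
    show "msum M N N' \<subseteq> carrier M" using D by (auto simp: msum_def)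
    show "\<zero>\<^bsub>M\<^esub> \<in> msum M N N'" using msumI[OF D(3,9), of M] M.M.zero_closed by simp
    show "v \<oplus>\<^bsub>M\<^esub> w \<in> msum M N N'" if vw: "v \<in> msum M N N'" "w \<in> msum M N N'" for v w
    proof -
      obtain x y x' y' where "x \<in> N" "y \<in> N'" "v = x \<oplus>\<^bsub>M\<^esub> y" "x' \<in> N" "y' \<in> N'" "w = x' \<oplus>\<^bsub>M\<^esub> y'"
        using vw unfolding msum_def by blast
      moreover from this have "v \<oplus>\<^bsub>M\<^esub> w = (x \<oplus>\<^bsub>M\<^esub> x') \<oplus>\<^bsub>M\<^esub> (y \<oplus>\<^bsub>M\<^esub> y')"
        using D(6,12) by (simp add: M.add_exchange)
      ultimately show ?thesis using D(4,10) by (auto intro: msumI)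
    qed
    show "c \<odot>\<^bsub>M\<^esub> v \<in> msum M N N'" if vw: "c \<in> carrier R" "v \<in> msum M N N'" for c v
    proof -
      obtain x y where "x \<in> N" "y \<in> N'" "v = x \<oplus>\<^bsub>M\<^esub> y" using vw(2) by (rule msumE)
      moreover from this have "c \<odot>\<^bsub>M\<^esub> v = c \<odot>\<^bsub>M\<^esub> x \<oplus>\<^bsub>M\<^esub> c \<odot>\<^bsub>M\<^esub> y"
        using D(6,12) vw by (simp add: M.smult_r_distr)
      ultimately show ?thesis using D(5,11) vw by (auto intro: msumI)
    qed
  qed (rule M.module_axioms)
  show "N \<subseteq> msum M N N'"
  proof
    fix x assume "x \<in> N"
    then show "x \<in> msum M N N'"
      using D(6) msumI[OF _ D(9), of x N M] by fastforce
  qed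
  show "N' \<subseteq> msum M N N'"
  proof
    fix x assume "x \<in> N'"
    then show "x \<in> msum M N N'"
      using D(12) msumI[OF D(3), of x N' M] by fastforce
  qed
qed

lemma msum_least:
  assumes "submodule R L M" "N \<subseteq> L" "N' \<subseteq> L"
  shows "msum M N N' \<subseteq> L"
  using assms submoduleD(4)[OF assms(1)] by (auto simp: msum_def)

lemma msum_mono: "N \<subseteq> L \<Longrightarrow> N' \<subseteq> L' \<Longrightarrow> msum M N N' \<subseteq> msum M L L'"
  unfolding msum_def by blast

definition cyc :: "('a, 'r) ring_scheme \<Rightarrow> ('a, 'b, 'm) module_scheme \<Rightarrow> 'b \<Rightarrow> 'b set" where
  "cyc R M x = (\<lambda>a. a \<odot>\<^bsub>M\<^esub> x) ` carrier R"

lemma (in module) submodule_cyc: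
  assumes "x \<in> carrier M"
  shows "submodule R (cyc R M x) M" "x \<in> cyc R M x"
proof -
  show "submodule R (cyc R M x) M"
  proof (rule submodule.intro)
    show "\<zero>\<^bsub>M\<^esub> \<in> cyc R M x" unfolding cyc_def
      by (rule image_eqI[of _ _ "\<zero>"]) (use assms in auto)
  next
    fix v w assume "v \<in> cyc R M x" "w \<in> cyc R M x"
    then obtain a b where "a \<in> carrier R" "b \<in> carrier R" "v = a \<odot>\<^bsub>M\<^esub> x" "w = b \<odot>\<^bsub>M\<^esub> x"
      by (auto simp: cyc_def)
    then show "v \<oplus>\<^bsub>M\<^esub> w \<in> cyc R M x" unfolding cyc_def
      by (intro image_eqI[of _ _ "a \<oplus> b"]) (use assms in \<open>auto simp: smult_l_distr\<close>)
  next
    fix c v assume "c \<in> carrier R" "v \<in> cyc R M x"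
    then obtain a where "a \<in> carrier R" "v = a \<odot>\<^bsub>M\<^esub> x" by (auto simp: cyc_def)
    then show "c \<odot>\<^bsub>M\<^esub> v \<in> cyc R M x" unfolding cyc_def
      by (intro image_eqI[of _ _ "c \<otimes> a"]) (use assms \<open>c \<in> carrier R\<close> in \<open>auto simp: smult_assoc1\<close>)
  qed (use assms in \<open>auto simp: cyc_def intro: module_axioms\<close>)
  show "x \<in> cyc R M x" unfolding cyc_def
    by (rule image_eqI[of _ _ "\<one>"]) (use assms in auto)
qed

lemma cyc_least: "submodule R N M \<Longrightarrow> x \<in> N \<Longrightarrow> cyc R M x \<subseteq> N"
  using submoduleD(5) by (fastforce simp: cyc_def)

section \<open>Homomorphisms, preimages and images\<close>

lemma module_homD:
  assumes "f \<in> module_hom R M N"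
  shows "\<And>x. x \<in> carrier M \<Longrightarrow> f x \<in> carrier N"
    "\<And>x y. x \<in> carrier M \<Longrightarrow> y \<in> carrier M \<Longrightarrow> f (x \<oplus>\<^bsub>M\<^esub> y) = f x \<oplus>\<^bsub>N\<^esub> f y"
    "\<And>a x. a \<in> carrier R \<Longrightarrow> x \<in> carrier M \<Longrightarrow> f (a \<odot>\<^bsub>M\<^esub> x) = a \<odot>\<^bsub>N\<^esub> f x"
  using assms unfolding module_hom_def by auto

lemma module_homI:
  assumes "\<And>x. x \<in> carrier M \<Longrightarrow> f x \<in> carrier N"
    "\<And>x y. x \<in> carrier M \<Longrightarrow> y \<in> carrier M \<Longrightarrow> f (x \<oplus>\<^bsub>M\<^esub> y) = f x \<oplus>\<^bsub>N\<^esub> f y"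
    "\<And>a x. a \<in> carrier R \<Longrightarrow> x \<in> carrier M \<Longrightarrow> f (a \<odot>\<^bsub>M\<^esub> x) = a \<odot>\<^bsub>N\<^esub> f x"
  shows "f \<in> module_hom R M N"
  using assms unfolding module_hom_def by auto

lemma module_hom_zero_minus:
  assumes "module R M" "module R N" "f \<in> module_hom R M N"
  shows "f \<zero>\<^bsub>M\<^esub> = \<zero>\<^bsub>N\<^esub>"
    "x \<in> carrier M \<Longrightarrow> f (\<ominus>\<^bsub>M\<^esub> x) = \<ominus>\<^bsub>N\<^esub> f x"
    "x \<in> carrier M \<Longrightarrow> y \<in> carrier M \<Longrightarrow> f (x \<ominus>\<^bsub>M\<^esub> y) = f x \<ominus>\<^bsub>N\<^esub> f y"
proof -
  interpret mod_hom R M N f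
    by (intro mod_hom.intro mod_hom_axioms.intro assms)
  show "f \<zero>\<^bsub>M\<^esub> = \<zero>\<^bsub>N\<^esub>"
    "x \<in> carrier M \<Longrightarrow> f (\<ominus>\<^bsub>M\<^esub> x) = \<ominus>\<^bsub>N\<^esub> f x"
    "x \<in> carrier M \<Longrightarrow> y \<in> carrier M \<Longrightarrow> f (x \<ominus>\<^bsub>M\<^esub> y) = f x \<ominus>\<^bsub>N\<^esub> f y"
    by simp_all
qed

lemma module_hom_comp:
  "f \<in> module_hom R M N \<Longrightarrow> g \<in> module_hom R N L \<Longrightarrow> (\<lambda>x. g (f x)) \<in> module_hom R M L"
  by (rule module_homI) (simp_all add: module_homD)

lemma module_hom_plus:
  assumes "module R N" "f \<in> module_hom R M N" "g \<in> module_hom R M N"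
  shows "(\<lambda>x. f x \<oplus>\<^bsub>N\<^esub> g x) \<in> module_hom R M N"
proof -
  interpret N: module R N by fact
  show ?thesis using module_homD[OF assms(2)] module_homD[OF assms(3)]
    by (intro module_homI) (simp_all only: N.add_exchange N.smult_r_distr N.M.a_closed)
qed

lemma module_hom_minus:
  assumes "module R N" "f \<in> module_hom R M N" "g \<in> module_hom R M N"
  shows "(\<lambda>x. f x \<ominus>\<^bsub>N\<^esub> g x) \<in> module_hom R M N"
proof -
  interpret N: module R N by fact
  have "(\<lambda>x. \<ominus>\<^bsub>N\<^esub> g x) \<in> module_hom R M N"
    using module_homD[OF assms(3)]
    by (auto intro!: module_homI simp: N.smult_r_minus N.M.minus_add)
  from module_hom_plus[OF assms(1,2) this] show ?thesis by (simp add: a_minus_def)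
qed

lemma module_hom_id: "(\<lambda>x. x) \<in> module_hom R M M"
  unfolding module_hom_def by auto

lemma submodule_preimage:
  assumes "module R M" "f \<in> module_hom R M N" "submodule R L N"
  shows "submodule R {x \<in> carrier M. f x \<in> L} M"
proof -
  interpret M: module R M by fact
  note D = submoduleD[OF assms(3)] module_homD[OF assms(2)] module_hom_zero_minus[OF assms(1) _ assms(2)]
  show ?thesis by (rule submodule.intro) (use D in \<open>auto intro: M.module_axioms\<close>)
qed

lemma submodule_image:
  assumes "submodule R L M" "module R N" "f \<in> module_hom R M N"
  shows "submodule R (f ` L) N"
proof -
  interpret M: module R M using assms(1) by (rule submoduleD)
  interpret N: module R N by fact
  note D = submoduleD[OF assms(1)] module_homD[OF assms(3)]
    module_hom_zero_minus[OF M.module_axioms assms(2,3)]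
  show ?thesis
  proof (rule submodule.intro)
    show "\<zero>\<^bsub>N\<^esub> \<in> f ` L" using D by (metis imageI)
    show "v \<oplus>\<^bsub>N\<^esub> w \<in> f ` L" if vw: "v \<in> f ` L" "w \<in> f ` L" for v w
    proof -
      obtain x y where "x \<in> L" "y \<in> L" "v = f x" "w = f y" using vw by blast
      then show ?thesis using D by (intro image_eqI[of _ _ "x \<oplus>\<^bsub>M\<^esub> y"]) auto
    qed
    show "c \<odot>\<^bsub>N\<^esub> v \<in> f ` L" if vw: "c \<in> carrier R" "v \<in> f ` L" for c v
    proof -
      obtain x where "x \<in> L" "v = f x" using vw by blast
      then show ?thesis using D vw by (intro image_eqI[of _ _ "c \<odot>\<^bsub>M\<^esub> x"]) auto
    qed
  qed (use D in \<open>auto intro: N.module_axioms\<close>)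
qed

section \<open>Quotient modules\<close>

lemma (in module) coset_eq_iff:
  assumes N: "submodule R N M" and x: "x \<in> carrier M" and y: "y \<in> carrier M"
  shows "N +>\<^bsub>M\<^esub> x = N +>\<^bsub>M\<^esub> y \<longleftrightarrow> x \<ominus>\<^bsub>M\<^esub> y \<in> N"
proof
  note D = submoduleD[OF N]
  assume "N +>\<^bsub>M\<^esub> x = N +>\<^bsub>M\<^esub> y"
  moreover have "x \<in> N +>\<^bsub>M\<^esub> x"
    using D x by (auto simp: a_r_coset_def r_coset_def intro!: bexI[of _ "\<zero>\<^bsub>M\<^esub>"])
  ultimately obtain h where "h \<in> N" "x = h \<oplus>\<^bsub>M\<^esub> y" by (auto simp: a_r_coset_def r_coset_def)
  then show "x \<ominus>\<^bsub>M\<^esub> y \<in> N" using D y minus_add_cancel(3)[of y h] by auto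
next
  note D = submoduleD[OF N]
  assume d: "x \<ominus>\<^bsub>M\<^esub> y \<in> N"
  define k where "k = x \<ominus>\<^bsub>M\<^esub> y"
  have k: "k \<in> N" "k \<in> carrier M" and xk: "x = k \<oplus>\<^bsub>M\<^esub> y"
    using d D x y minus_add_cancel(2)[of y x] by (auto simp: k_def)
  show "N +>\<^bsub>M\<^esub> x = N +>\<^bsub>M\<^esub> y"
  proof (intro equalityI subsetI)
    fix z assume "z \<in> N +>\<^bsub>M\<^esub> x"
    then obtain h where h: "h \<in> N" "z = h \<oplus>\<^bsub>M\<^esub> x" by (auto simp: a_r_coset_def r_coset_def)
    then have "z = (h \<oplus>\<^bsub>M\<^esub> k) \<oplus>\<^bsub>M\<^esub> y" using D k y by (simp add: xk M.a_assoc)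
    then show "z \<in> N +>\<^bsub>M\<^esub> y" using D h k by (auto simp: a_r_coset_def r_coset_def)
  next
    fix z assume "z \<in> N +>\<^bsub>M\<^esub> y"
    then obtain h where h: "h \<in> N" "z = h \<oplus>\<^bsub>M\<^esub> y" by (auto simp: a_r_coset_def r_coset_def)
    have hc: "h \<in> carrier M" using h D by auto
    have "z = (h \<ominus>\<^bsub>M\<^esub> k) \<oplus>\<^bsub>M\<^esub> x"
    proof -
      have "(h \<ominus>\<^bsub>M\<^esub> k) \<oplus>\<^bsub>M\<^esub> x = ((h \<ominus>\<^bsub>M\<^esub> k) \<oplus>\<^bsub>M\<^esub> k) \<oplus>\<^bsub>M\<^esub> y"
        unfolding xk using hc k y by (simp add: M.a_assoc)
      then show ?thesis using h hc k by (simp add: minus_add_cancel)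
    qed
    then show "z \<in> N +>\<^bsub>M\<^esub> x" using submodule_minus[OF N h(1) k(1)]
      by (auto simp: a_r_coset_def r_coset_def)
  qed
qed

lemma (in module) coset_mem_iff:
  assumes N: "submodule R N M" and x: "x \<in> carrier M" and y: "y \<in> carrier M"
  shows "y \<in> N +>\<^bsub>M\<^esub> x \<longleftrightarrow> y \<ominus>\<^bsub>M\<^esub> x \<in> N"
proof
  assume "y \<in> N +>\<^bsub>M\<^esub> x"
  then obtain h where "h \<in> N" "y = h \<oplus>\<^bsub>M\<^esub> x" by (auto simp: a_r_coset_def r_coset_def)
  then show "y \<ominus>\<^bsub>M\<^esub> x \<in> N" using submoduleD[OF N] x minus_add_cancel(3)[of x h] by auto
next
  assume "y \<ominus>\<^bsub>M\<^esub> x \<in> N"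
  then show "y \<in> N +>\<^bsub>M\<^esub> x" using x y minus_add_cancel(2)[of x y]
    by (force simp: a_r_coset_def r_coset_def)
qed

lemma (in module) coset_elem:
  assumes N: "submodule R N M" and x: "x \<in> carrier M" and z: "z \<in> N +>\<^bsub>M\<^esub> x"
  shows "z \<in> carrier M" "N +>\<^bsub>M\<^esub> z = N +>\<^bsub>M\<^esub> x"
proof -
  show c: "z \<in> carrier M"
    using z x submoduleD(2)[OF N] by (auto simp: a_r_coset_def r_coset_def)
  show "N +>\<^bsub>M\<^esub> z = N +>\<^bsub>M\<^esub> x"
    using coset_eq_iff[OF N c x] coset_mem_iff[OF N x c] z by blast
qed

lemma (in module) coset_self:
  assumes N: "submodule R N M" and x: "x \<in> carrier M"
  shows "x \<in> N +>\<^bsub>M\<^esub> x"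
  using coset_mem_iff[OF N x x] submoduleD[OF N] x by (simp add: a_minus_def M.r_neg)

lemma (in module) quotient_module_ops:
  assumes N: "submodule R N M"
  shows "carrier (quotient_module M N) = (\<lambda>x. N +>\<^bsub>M\<^esub> x) ` carrier M"
    "\<And>x y. x \<in> carrier M \<Longrightarrow> y \<in> carrier M \<Longrightarrow>
       (N +>\<^bsub>M\<^esub> x) \<oplus>\<^bsub>quotient_module M N\<^esub> (N +>\<^bsub>M\<^esub> y) = N +>\<^bsub>M\<^esub> (x \<oplus>\<^bsub>M\<^esub> y)"
    "\<And>a x. a \<in> carrier R \<Longrightarrow> x \<in> carrier M \<Longrightarrow>
       a \<odot>\<^bsub>quotient_module M N\<^esub> (N +>\<^bsub>M\<^esub> x) = N +>\<^bsub>M\<^esub> (a \<odot>\<^bsub>M\<^esub> x)"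
    "\<zero>\<^bsub>quotient_module M N\<^esub> = N +>\<^bsub>M\<^esub> \<zero>\<^bsub>M\<^esub>"
proof -
  note D = submoduleD[OF N]
  show "carrier (quotient_module M N) = (\<lambda>x. N +>\<^bsub>M\<^esub> x) ` carrier M"
    by (auto simp: quotient_module_def A_RCOSETS_def')
  show "\<zero>\<^bsub>quotient_module M N\<^esub> = N +>\<^bsub>M\<^esub> \<zero>\<^bsub>M\<^esub>"
    using D by (auto simp: quotient_module_def a_r_coset_def r_coset_def subset_eq)
  fix x y assume x: "x \<in> carrier M" and y: "y \<in> carrier M"
  show "(N +>\<^bsub>M\<^esub> x) \<oplus>\<^bsub>quotient_module M N\<^esub> (N +>\<^bsub>M\<^esub> y) = N +>\<^bsub>M\<^esub> (x \<oplus>\<^bsub>M\<^esub> y)"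
  proof (intro equalityI subsetI)
    fix z assume "z \<in> (N +>\<^bsub>M\<^esub> x) \<oplus>\<^bsub>quotient_module M N\<^esub> (N +>\<^bsub>M\<^esub> y)"
    then obtain h k where hk: "h \<in> N" "k \<in> N" "z = (h \<oplus>\<^bsub>M\<^esub> x) \<oplus>\<^bsub>M\<^esub> (k \<oplus>\<^bsub>M\<^esub> y)"
      by (auto simp: quotient_module_def set_add_def set_mult_def a_r_coset_def r_coset_def)
    then have "z = (h \<oplus>\<^bsub>M\<^esub> k) \<oplus>\<^bsub>M\<^esub> (x \<oplus>\<^bsub>M\<^esub> y)" using add_exchange[of h x k y] D(6) x y by simp
    then show "z \<in> N +>\<^bsub>M\<^esub> (x \<oplus>\<^bsub>M\<^esub> y)" using D hk by (auto simp: a_r_coset_def r_coset_def)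
  next
    fix z assume "z \<in> N +>\<^bsub>M\<^esub> (x \<oplus>\<^bsub>M\<^esub> y)"
    then obtain h where h: "h \<in> N" "z = h \<oplus>\<^bsub>M\<^esub> (x \<oplus>\<^bsub>M\<^esub> y)" by (auto simp: a_r_coset_def r_coset_def)
    then have "z = (h \<oplus>\<^bsub>M\<^esub> x) \<oplus>\<^bsub>M\<^esub> (\<zero>\<^bsub>M\<^esub> \<oplus>\<^bsub>M\<^esub> y)" using D x y by (simp add: M.a_assoc)
    then show "z \<in> (N +>\<^bsub>M\<^esub> x) \<oplus>\<^bsub>quotient_module M N\<^esub> (N +>\<^bsub>M\<^esub> y)"
      using h(1) D(3) unfolding quotient_module_def set_add_def set_mult_def a_r_coset_def r_coset_def
      by auto
  qed
next
  fix a x assume a: "a \<in> carrier R" and x: "x \<in> carrier M"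
  have "N +>\<^bsub>M\<^esub> (a \<odot>\<^bsub>M\<^esub> z) = N +>\<^bsub>M\<^esub> (a \<odot>\<^bsub>M\<^esub> x)" if z: "z \<in> N +>\<^bsub>M\<^esub> x" for z
  proof -
    have zc: "z \<in> carrier M" by (rule coset_elem(1)[OF N x z])
    have d: "z \<ominus>\<^bsub>M\<^esub> x \<in> N" using coset_mem_iff[OF N x zc] z by blast
    have "a \<odot>\<^bsub>M\<^esub> z \<ominus>\<^bsub>M\<^esub> a \<odot>\<^bsub>M\<^esub> x = a \<odot>\<^bsub>M\<^esub> (z \<ominus>\<^bsub>M\<^esub> x)"
      using a x zc by (simp add: a_minus_def smult_r_distr smult_r_minus)
    then have "a \<odot>\<^bsub>M\<^esub> z \<ominus>\<^bsub>M\<^esub> a \<odot>\<^bsub>M\<^esub> x \<in> N" using submoduleD(5)[OF N a d] by (simp only:)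
    then show ?thesis using coset_eq_iff[OF N smult_closed[OF a zc] smult_closed[OF a x]] by blast
  qed
  \<comment> \<open>The scalar action of \<open>quotient_module\<close> is a union over the whole
    coset. All members of this family coincide and the coset is nonempty, so the union is a single
    coset.\<close>
  then have "(\<Union>z\<in>N +>\<^bsub>M\<^esub> x. N +>\<^bsub>M\<^esub> (a \<odot>\<^bsub>M\<^esub> z)) = N +>\<^bsub>M\<^esub> (a \<odot>\<^bsub>M\<^esub> x)"
    using coset_self[OF N x] by blast
  then show "a \<odot>\<^bsub>quotient_module M N\<^esub> (N +>\<^bsub>M\<^esub> x) = N +>\<^bsub>M\<^esub> (a \<odot>\<^bsub>M\<^esub> x)"
    by (simp only: quotient_module_def module.simps)
qed

lemma (in module) quotient_module_is_module:
  assumes N: "submodule R N M"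
  shows "module R (quotient_module M N)"
    "(\<lambda>x. N +>\<^bsub>M\<^esub> x) \<in> module_hom R M (quotient_module M N)"
proof -
  note Q = quotient_module_ops[OF N]
  show "module R (quotient_module M N)"
    by (rule module_surj_image[OF module_axioms, where f = "\<lambda>x. N +>\<^bsub>M\<^esub> x"])
      (simp_all only: Q)
  show "(\<lambda>x. N +>\<^bsub>M\<^esub> x) \<in> module_hom R M (quotient_module M N)"
    by (rule module_homI) (simp_all add: Q)
qed

lemma (in module) coset_zero_iff:
  assumes N: "submodule R N M" and x: "x \<in> carrier M"
  shows "N +>\<^bsub>M\<^esub> x = \<zero>\<^bsub>quotient_module M N\<^esub> \<longleftrightarrow> x \<in> N"
proof -
  have "x \<ominus>\<^bsub>M\<^esub> \<zero>\<^bsub>M\<^esub> = x" using x minus_add_cancel(2)[of "\<zero>\<^bsub>M\<^esub>" x] by simp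
  then show ?thesis
    using coset_eq_iff[OF N x M.zero_closed] by (simp only: quotient_module_ops(4)[OF N])
qed

section \<open>Finite free modules\<close>

context cring
begin

lemma pm_module: "module R (power_module R n)"
  by (rule func_space_is_module)

lemma pm_carrier_iff:
  "v \<in> carrier (power_module R n) \<longleftrightarrow> (\<forall>i<n. v i \<in> carrier R) \<and> (\<forall>i. \<not> i < n \<longrightarrow> v i = undefined)"
  by (auto simp: func_space_def PiE_def Pi_def extensional_def)

lemma pm_closed: "v \<in> carrier (power_module R n) \<Longrightarrow> i < n \<Longrightarrow> v i \<in> carrier R"
  by (simp add: pm_carrier_iff)

text \<open>Vectors are extensional functions on \<open>{..<n}\<close>, with value
  \<open>undefined\<close> elsewhere, so the coordinates below n decide equality.\<close>

lemma pm_eqI: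
  assumes "v \<in> carrier (power_module R n)" "w \<in> carrier (power_module R n)"
    "\<And>i. i < n \<Longrightarrow> v i = w i"
  shows "v = w"
proof
  fix i show "v i = w i" using assms by (cases "i < n") (auto simp: pm_carrier_iff)
qed

lemma pm_simps:
  "i < n \<Longrightarrow> (v \<oplus>\<^bsub>power_module R n\<^esub> w) i = v i \<oplus> w i"
  "i < n \<Longrightarrow> (a \<odot>\<^bsub>power_module R n\<^esub> v) i = a \<otimes> v i"
  "i < n \<Longrightarrow> \<zero>\<^bsub>power_module R n\<^esub> i = \<zero>"
  by (simp_all add: func_space_def)

lemma pm_minus:
  assumes "v \<in> carrier (power_module R n)" "w \<in> carrier (power_module R n)" "i < n"
  shows "(\<ominus>\<^bsub>power_module R n\<^esub> w) i = \<ominus> w i" "(v \<ominus>\<^bsub>power_module R n\<^esub> w) i = v i \<ominus> w i"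
proof -
  interpret F: module R "power_module R n" by (rule pm_module)
  show u: "(\<ominus>\<^bsub>power_module R n\<^esub> w) i = \<ominus> w i"
    using assms by (simp add: func_space_neg)
  show "(v \<ominus>\<^bsub>power_module R n\<^esub> w) i = v i \<ominus> w i"
    using assms by (simp add: F.M.minus_eq minus_eq pm_simps u)
qed

lemma pm_restrict_closed:
  "(\<And>i. i < n \<Longrightarrow> f i \<in> carrier R) \<Longrightarrow> (\<lambda>i\<in>{..<n}. f i) \<in> carrier (power_module R n)"
  by (simp add: pm_carrier_iff)

section \<open>Unit vectors and linear maps out of finite free modules\<close>

abbreviation uvec :: "nat \<Rightarrow> nat \<Rightarrow> nat \<Rightarrow> 'a" where
  "uvec n i \<equiv> free_gen R {..<n} i"

lemma uvec_closed: "uvec n i \<in> carrier (power_module R n)"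
  unfolding free_gen_def by (rule pm_restrict_closed) simp

lemma uvec_simp: "j < n \<Longrightarrow> uvec n i j = (if j = i then \<one> else \<zero>)"
  by (simp add: free_gen_def)

text \<open>The induction principle for finite free modules: a property closed under linear
  combinations, phrased as a submodule, holds everywhere once it holds at the unit vectors.\<close>

lemma pm_submodule_eq:
  assumes N: "submodule R N (power_module R n)" and u: "\<And>i. i < n \<Longrightarrow> uvec n i \<in> N"
  shows "N = carrier (power_module R n)"
proof
  note D = submoduleD[OF N]
  interpret F: module R "power_module R n" by (rule pm_module)
  show "N \<subseteq> carrier (power_module R n)" by (rule D)
  \<comment> \<open>Induction on the number k of leading coordinates that may be nonzero. In the
    step, w is v with coordinate k cleared, and v is w plus a multiple of a unit vector.\<close>
  have "k \<le> n \<Longrightarrow> v \<in> carrier (power_module R n) \<Longrightarrow> (\<And>i. k \<le> i \<Longrightarrow> i < n \<Longrightarrow> v i = \<zero>) \<Longrightarrow> v \<in> N" for k v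
  proof (induction k arbitrary: v)
    case 0
    then have "v = \<zero>\<^bsub>power_module R n\<^esub>" by (intro pm_eqI[of _ n]) (auto simp: pm_simps)
    then show ?case using D(3) by simp
  next
    case (Suc k)
    define w where "w = (\<lambda>i\<in>{..<n}. if i = k then \<zero> else v i)"
    have wc: "w \<in> carrier (power_module R n)"
      unfolding w_def by (rule pm_restrict_closed) (use Suc.prems(2) in \<open>simp add: pm_closed\<close>)
    have wN: "w \<in> N"
    proof (rule Suc.IH)
      show "w i = \<zero>" if "k \<le> i" "i < n" for i
        using that Suc.prems(3)[of i] by (cases "i = k") (auto simp: w_def)
    qed (use Suc.prems wc in auto)
    have vk: "v k \<in> carrier R" using Suc.prems by (simp add: pm_closed)
    have "v = w \<oplus>\<^bsub>power_module R n\<^esub> v k \<odot>\<^bsub>power_module R n\<^esub> uvec n k"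
    proof (rule pm_eqI[OF Suc.prems(2)])
      show "w \<oplus>\<^bsub>power_module R n\<^esub> v k \<odot>\<^bsub>power_module R n\<^esub> uvec n k \<in> carrier (power_module R n)"
        using wc vk uvec_closed by blast
    qed (use Suc.prems(2) vk in \<open>auto simp: pm_simps uvec_simp pm_closed w_def\<close>)
    then show ?case using D(4)[OF wN D(5)[OF vk u[of k]]] Suc.prems(1) by simp
  qed
  from this[of n] show "carrier (power_module R n) \<subseteq> N" by auto
qed

lemma pm_hom_ext:
  assumes X: "module R X" and f: "f \<in> module_hom R (power_module R n) X"
    and g: "g \<in> module_hom R (power_module R n) X"
    and u: "\<And>i. i < n \<Longrightarrow> f (uvec n i) = g (uvec n i)" and v: "v \<in> carrier (power_module R n)"
  shows "f v = g v"
proof -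
  interpret X: module R X by fact
  let ?d = "\<lambda>x. f x \<ominus>\<^bsub>X\<^esub> g x"
  have d: "?d \<in> module_hom R (power_module R n) X" by (rule module_hom_minus[OF X f g])
  have "{x \<in> carrier (power_module R n). ?d x \<in> {\<zero>\<^bsub>X\<^esub>}} = carrier (power_module R n)"
    by (rule pm_submodule_eq[OF submodule_preimage[OF pm_module d X.submodule_zero]])
      (use u module_homD(1)[OF g] in \<open>simp add: uvec_closed X.M.minus_other_side\<close>)
  with v have "f v \<ominus>\<^bsub>X\<^esub> g v = \<zero>\<^bsub>X\<^esub>" by blast
  then show ?thesis using module_homD(1)[OF f v] module_homD(1)[OF g v]
    by (simp add: X.M.minus_other_side)
qed

lemma pm_restrict_hom:
  assumes "m \<le> n"
  shows "(\<lambda>v. restrict v {..<m}) \<in> module_hom R (power_module R n) (power_module R m)"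
proof -
  interpret F: module R "power_module R n" by (rule pm_module)
  interpret G: module R "power_module R m" by (rule pm_module)
  have cl: "restrict v {..<m} \<in> carrier (power_module R m)" if "v \<in> carrier (power_module R n)" for v
    by (rule pm_restrict_closed) (use that assms in \<open>simp add: pm_closed\<close>)
  show ?thesis
  proof (rule module_homI)
    fix x y assume "x \<in> carrier (power_module R n)" "y \<in> carrier (power_module R n)"
    then show "restrict (x \<oplus>\<^bsub>power_module R n\<^esub> y) {..<m}
        = restrict x {..<m} \<oplus>\<^bsub>power_module R m\<^esub> restrict y {..<m}"
      by (intro pm_eqI[of _ m]) (use assms in \<open>auto simp: pm_simps cl\<close>)
  next
    fix a x assume "a \<in> carrier R" "x \<in> carrier (power_module R n)"
    then show "restrict (a \<odot>\<^bsub>power_module R n\<^esub> x) {..<m}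
        = a \<odot>\<^bsub>power_module R m\<^esub> restrict x {..<m}"
      by (intro pm_eqI[of _ m]) (use assms in \<open>auto simp: pm_simps cl\<close>)
  qed (rule cl)
qed

text \<open>Adjoins one more generator x: the new last coordinate becomes its coefficient. The
  description of the image serves generation arguments, the values at the unit vectors serve the
  universal property.\<close>

lemma pm_hom_snoc:
  assumes X: "module R X" and h: "h \<in> module_hom R (power_module R n) X" and x: "x \<in> carrier X"
  defines "h' \<equiv> \<lambda>v. h (restrict v {..<n}) \<oplus>\<^bsub>X\<^esub> v n \<odot>\<^bsub>X\<^esub> x"
  shows "h' \<in> module_hom R (power_module R (Suc n)) X"
    "\<And>i. i < n \<Longrightarrow> h' (uvec (Suc n) i) = h (uvec n i)"
    "h' (uvec (Suc n) n) = x"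
    "h' ` carrier (power_module R (Suc n)) = msum X (h ` carrier (power_module R n)) (cyc R X x)"
proof -
  interpret X: module R X by fact
  interpret F: module R "power_module R n" by (rule pm_module)
  have r: "(\<lambda>v. h (restrict v {..<n})) \<in> module_hom R (power_module R (Suc n)) X"
    by (rule module_hom_comp[OF pm_restrict_hom h]) simp
  have "(\<lambda>v. v n \<odot>\<^bsub>X\<^esub> x) \<in> module_hom R (power_module R (Suc n)) X"
    by (rule module_homI) (use x in \<open>simp_all add: pm_closed pm_simps X.smult_l_distr X.smult_assoc1\<close>)
  from module_hom_plus[OF X r this] show hh: "h' \<in> module_hom R (power_module R (Suc n)) X"
    unfolding h'_def .
  have hc: "\<And>v. v \<in> carrier (power_module R n) \<Longrightarrow> h v \<in> carrier X" by (rule module_homD(1)[OF h])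
  have ru: "restrict (uvec (Suc n) i) {..<n} = (if i < n then uvec n i else \<zero>\<^bsub>power_module R n\<^esub>)" for i
    by (rule pm_eqI[of _ n])
      (auto simp: uvec_simp uvec_closed pm_simps pm_closed intro!: pm_restrict_closed)
  show "h' (uvec (Suc n) i) = h (uvec n i)" if "i < n" for i
    using that x by (simp add: h'_def ru uvec_simp hc uvec_closed)
  show "h' (uvec (Suc n) n) = x"
    using x by (simp add: h'_def ru uvec_simp module_hom_zero_minus(1)[OF pm_module X h])
  show "h' ` carrier (power_module R (Suc n)) = msum X (h ` carrier (power_module R n)) (cyc R X x)"
  proof (intro equalityI subsetI)
    fix z assume "z \<in> h' ` carrier (power_module R (Suc n))"
    then obtain v where v: "v \<in> carrier (power_module R (Suc n))" "z = h' v" by blast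
    then have "restrict v {..<n} \<in> carrier (power_module R n)" "v n \<in> carrier R"
      by (auto simp: pm_closed intro!: pm_restrict_closed)
    then show "z \<in> msum X (h ` carrier (power_module R n)) (cyc R X x)"
      unfolding v(2) h'_def by (auto simp: cyc_def intro!: msumI)
  next
    fix z assume "z \<in> msum X (h ` carrier (power_module R n)) (cyc R X x)"
    then obtain w c where w: "w \<in> carrier (power_module R n)" "c \<in> carrier R"
      "z = h w \<oplus>\<^bsub>X\<^esub> c \<odot>\<^bsub>X\<^esub> x" by (auto simp: msum_def cyc_def)
    define v where "v = (\<lambda>i\<in>{..<Suc n}. if i < n then w i else c)"
    have vc: "v \<in> carrier (power_module R (Suc n))"
      unfolding v_def by (rule pm_restrict_closed) (use w in \<open>simp add: pm_closed\<close>)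
    have "restrict v {..<n} = w"
    proof (rule pm_eqI[of _ n])
      show "restrict v {..<n} \<in> carrier (power_module R n)"
        using module_homD(1)[OF pm_restrict_hom vc] by simp
    qed (use w in \<open>auto simp: v_def\<close>)
    then have "h' v = z" by (simp add: h'_def w(3)) (simp add: v_def)
    then show "z \<in> h' ` carrier (power_module R (Suc n))" using vc by blast
  qed
qed

lemma pm_zero_hom:
  assumes "module R X"
  shows "(\<lambda>_. \<zero>\<^bsub>X\<^esub>) \<in> module_hom R M X"
proof -
  interpret X: module R X by fact
  show ?thesis by (rule module_homI) auto
qed

lemma pm_hom_exists:
  assumes X: "module R X" and "\<And>i. i < n \<Longrightarrow> u i \<in> carrier X"
  shows "\<exists>h\<in>module_hom R (power_module R n) X. \<forall>i<n. h (uvec n i) = u i"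
  using assms(2)
proof (induction n)
  case 0
  show ?case using pm_zero_hom[OF X] by auto
next
  case (Suc n)
  then obtain h where h: "h \<in> module_hom R (power_module R n) X" "\<forall>i<n. h (uvec n i) = u i"
    by auto
  note s = pm_hom_snoc[OF X h(1) Suc.prems[of n]]
  show ?case
    by (rule bexI[OF _ s(1)]) (use s(2,3) h(2) in \<open>auto simp: less_Suc_eq\<close>)
qed

text \<open>Finite free modules are projective: choose preimages of the images of the unit vectors
  and extend linearly. Chain maps and homotopies are built from this.\<close>

lemma pm_lift:
  assumes X: "module R X" and Y: "module R Y" and f: "f \<in> module_hom R (power_module R n) X"
    and g: "g \<in> module_hom R Y X" and im: "\<And>v. v \<in> carrier (power_module R n) \<Longrightarrow> f v \<in> g ` carrier Y"
  shows "\<exists>h\<in>module_hom R (power_module R n) Y. \<forall>v\<in>carrier (power_module R n). g (h v) = f v"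
proof -
  have "\<exists>y. y \<in> carrier Y \<and> g y = f (uvec n i)" for i
  proof -
    obtain y where "f (uvec n i) = g y" "y \<in> carrier Y"
      using im[OF uvec_closed[of n i]] by (rule imageE)
    then show ?thesis by (intro exI[of _ y]) simp
  qed
  from choice[OF allI[OF this]] obtain u
    where "\<forall>i. u i \<in> carrier Y \<and> g (u i) = f (uvec n i)" ..
  then have u: "u i \<in> carrier Y" "g (u i) = f (uvec n i)" for i by simp_all
  obtain h where h: "h \<in> module_hom R (power_module R n) Y" "\<And>i. i < n \<Longrightarrow> h (uvec n i) = u i"
    using pm_hom_exists[OF Y, of n u] u(1) by blast
  show ?thesis
  proof (rule bexI[OF _ h(1)], rule ballI)
    fix v assume v: "v \<in> carrier (power_module R n)"
    show "g (h v) = f v"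
    proof (rule pm_hom_ext[OF X module_hom_comp[OF h(1) g] f _ v])
      fix i assume "i < n"
      show "g (h (uvec n i)) = f (uvec n i)" unfolding h(2)[OF \<open>i < n\<close>] by (rule u(2))
    qed
  qed
qed

text \<open>Identifies the free module of rank n with the vectors of rank n + 1 whose coordinate j
  vanishes, later coordinates moving up by one. It serves to discard a generator or a
  column.\<close>

definition ins :: "nat \<Rightarrow> nat \<Rightarrow> (nat \<Rightarrow> 'a) \<Rightarrow> nat \<Rightarrow> 'a" where
  "ins n j v = (\<lambda>i\<in>{..<Suc n}. if i < j then v i else if i = j then \<zero> else v (i - 1))"

lemma ins_hom:
  assumes "j \<le> n"
  shows "ins n j \<in> module_hom R (power_module R n) (power_module R (Suc n))"
proof -
  interpret F: module R "power_module R n" by (rule pm_module)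
  interpret G: module R "power_module R (Suc n)" by (rule pm_module)
  have cl: "ins n j v \<in> carrier (power_module R (Suc n))" if "v \<in> carrier (power_module R n)" for v
    unfolding ins_def by (rule pm_restrict_closed) (use that assms in \<open>auto simp: pm_closed\<close>)
  show ?thesis
  proof (rule module_homI)
    fix x y assume xy: "x \<in> carrier (power_module R n)" "y \<in> carrier (power_module R n)"
    show "ins n j (x \<oplus>\<^bsub>power_module R n\<^esub> y) = ins n j x \<oplus>\<^bsub>power_module R (Suc n)\<^esub> ins n j y"
    proof (rule pm_eqI[of _ "Suc n"])
      fix i assume "i < Suc n"
      then show "ins n j (x \<oplus>\<^bsub>power_module R n\<^esub> y) i = (ins n j x \<oplus>\<^bsub>power_module R (Suc n)\<^esub> ins n j y) i"
        using assms by (simp add: pm_simps) (auto simp: ins_def pm_simps)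
    qed (use xy in \<open>simp_all add: cl\<close>)
  next
    fix a x assume xy: "a \<in> carrier R" "x \<in> carrier (power_module R n)"
    show "ins n j (a \<odot>\<^bsub>power_module R n\<^esub> x) = a \<odot>\<^bsub>power_module R (Suc n)\<^esub> ins n j x"
    proof (rule pm_eqI[of _ "Suc n"])
      fix i assume "i < Suc n"
      then show "ins n j (a \<odot>\<^bsub>power_module R n\<^esub> x) i = (a \<odot>\<^bsub>power_module R (Suc n)\<^esub> ins n j x) i"
        using assms xy by (simp add: pm_simps) (auto simp: ins_def pm_simps)
    qed (use xy in \<open>simp_all add: cl\<close>)
  qed (rule cl)
qed

lemma ins_surj:
  assumes "j \<le> n" "w \<in> carrier (power_module R (Suc n))" "w j = \<zero>"
  shows "w \<in> ins n j ` carrier (power_module R n)"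
proof -
  define v where "v = (\<lambda>i\<in>{..<n}. if i < j then w i else w (Suc i))"
  have v: "v \<in> carrier (power_module R n)"
    unfolding v_def by (rule pm_restrict_closed) (use assms in \<open>auto simp: pm_closed\<close>)
  have "ins n j v = w"
    by (rule pm_eqI[of _ "Suc n", OF module_homD(1)[OF ins_hom[OF assms(1)] v] assms(2)])
      (use assms in \<open>auto simp: ins_def v_def\<close>)
  then show ?thesis using v by blast
qed

lemma ins_at:
  assumes "j \<le> n"
  shows "ins n j v j = \<zero>" "i < n \<Longrightarrow> ins n j v (if i < j then i else Suc i) = v i"
  using assms by (auto simp: ins_def)

section \<open>Vectors over an ideal\<close>

text \<open>This is the submodule \<open>I F\<close> of a finite free module \<open>F\<close>, in
  coordinates.\<close>

definition ivec :: "'a set \<Rightarrow> nat \<Rightarrow> (nat \<Rightarrow> 'a) set" where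
  "ivec I n = {v \<in> carrier (power_module R n). \<forall>i<n. v i \<in> I}"

lemma ivec_submodule:
  assumes "ideal I R"
  shows "submodule R (ivec I n) (power_module R n)"
proof -
  interpret I: ideal I R by fact
  interpret F: module R "power_module R n" by (rule pm_module)
  show ?thesis
    by (rule submodule.intro)
      (auto simp: ivec_def pm_simps I.I_l_closed F.module_axioms)
qed

lemma smult_in_ivec:
  assumes "ideal I R" "a \<in> I" "v \<in> carrier (power_module R n)"
  shows "a \<odot>\<^bsub>power_module R n\<^esub> v \<in> ivec I n"
proof -
  interpret I: ideal I R by fact
  interpret F: module R "power_module R n" by (rule pm_module)
  show ?thesis using assms
    by (auto simp: ivec_def pm_simps I.I_r_closed pm_closed I.a_Hcarr)
qed

text \<open>\<open>I F\<close> is generated by the multiples of unit vectors with scalars in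
  \<open>I\<close>, by the same clearing of coordinates as in \<open>pm_submodule_eq\<close>.
  Inclusions of \<open>I F\<close> are checked on these generators.\<close>

lemma ivec_least:
  assumes I: "ideal I R" and N: "submodule R N (power_module R n)"
    and u: "\<And>a i. a \<in> I \<Longrightarrow> i < n \<Longrightarrow> a \<odot>\<^bsub>power_module R n\<^esub> uvec n i \<in> N"
  shows "ivec I n \<subseteq> N"
proof -
  note D = submoduleD[OF N]
  interpret I: ideal I R by fact
  interpret F: module R "power_module R n" by (rule pm_module)
  have "k \<le> n \<Longrightarrow> v \<in> ivec I n \<Longrightarrow> (\<And>i. k \<le> i \<Longrightarrow> i < n \<Longrightarrow> v i = \<zero>) \<Longrightarrow> v \<in> N" for k v
  proof (induction k arbitrary: v)
    case 0
    then have "v = \<zero>\<^bsub>power_module R n\<^esub>" by (intro pm_eqI[of _ n]) (auto simp: pm_simps ivec_def)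
    then show ?case using D(3) by simp
  next
    case (Suc k)
    have vc: "v \<in> carrier (power_module R n)" using Suc.prems by (simp add: ivec_def)
    define w where "w = (\<lambda>i\<in>{..<n}. if i = k then \<zero> else v i)"
    have wc: "w \<in> carrier (power_module R n)"
      unfolding w_def by (rule pm_restrict_closed) (use vc in \<open>simp add: pm_closed\<close>)
    have wN: "w \<in> N"
    proof (rule Suc.IH)
      show "w \<in> ivec I n" using wc Suc.prems(2) by (auto simp: ivec_def w_def)
      show "w i = \<zero>" if "k \<le> i" "i < n" for i
        using that Suc.prems(3)[of i] by (cases "i = k") (auto simp: w_def)
    qed (use Suc.prems in auto)
    have vk: "v k \<in> I" using Suc.prems by (simp add: ivec_def)
    have vkc: "v k \<in> carrier R" using vk by (rule I.a_Hcarr)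
    have "v = w \<oplus>\<^bsub>power_module R n\<^esub> v k \<odot>\<^bsub>power_module R n\<^esub> uvec n k"
    proof (rule pm_eqI[OF vc])
      show "w \<oplus>\<^bsub>power_module R n\<^esub> v k \<odot>\<^bsub>power_module R n\<^esub> uvec n k \<in> carrier (power_module R n)"
        using wc vkc uvec_closed by blast
    qed (use vc vkc in \<open>auto simp: pm_simps uvec_simp pm_closed w_def\<close>)
    then show ?case using D(4)[OF wN u[OF vk, of k]] Suc.prems(1) by simp
  qed
  from this[of n] show ?thesis by auto
qed

text \<open>A linear map pulls the scalar out of a generator \<open>a e\<close> of
  \<open>I F\<close>, leaving a multiple by \<open>a\<close> of its value at \<open>e\<close>. So
  linear maps between free modules descend to the quotients modulo \<open>I\<close>.\<close>

lemma hom_ivec: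
  assumes I: "ideal I R" and f: "f \<in> module_hom R (power_module R n) (power_module R m)"
    and v: "v \<in> ivec I n"
  shows "f v \<in> ivec I m"
proof -
  interpret I: ideal I R by fact
  have "ivec I n \<subseteq> {x \<in> carrier (power_module R n). f x \<in> ivec I m}"
  proof (rule ivec_least[OF I submodule_preimage[OF pm_module f ivec_submodule[OF I]]])
    fix a i assume a: "a \<in> I" and i: "i < n"
    interpret F: module R "power_module R n" by (rule pm_module)
    note ac = I.a_Hcarr[OF a]
    have "f (a \<odot>\<^bsub>power_module R n\<^esub> uvec n i) \<in> ivec I m"
      unfolding module_homD(3)[OF f ac uvec_closed]
      by (rule smult_in_ivec[OF I a module_homD(1)[OF f uvec_closed]])
    then show "a \<odot>\<^bsub>power_module R n\<^esub> uvec n i \<in> {x \<in> carrier (power_module R n). f x \<in> ivec I m}"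
      using ac uvec_closed by simp
  qed
  then show ?thesis using v by blast
qed

text \<open>Fraction-free Gaussian elimination modulo \<open>p\<close>.\<close>

lemma pm_hom_dependent:
  assumes "primeideal p R" "f \<in> module_hom R (power_module R k) (power_module R n)" "n < k"
  shows "\<exists>v\<in>carrier (power_module R k). (\<exists>i<k. v i \<notin> p) \<and> f v \<in> ivec p n"
  using assms(2,3)
proof (induction n arbitrary: k f)
  interpret p: primeideal p R by fact
  case 0
  interpret F: module R "power_module R k" by (rule pm_module)
  have "uvec k 0 0 \<notin> p" using 0(2) p.I_notcarr p.one_imp_carrier by (auto simp: uvec_simp)
  moreover have "f (uvec k 0) \<in> ivec p 0"
    using module_homD(1)[OF 0(1) uvec_closed] by (simp add: ivec_def)
  ultimately show ?case using 0(2) uvec_closed by blast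
next
  interpret p: primeideal p R by fact
  case (Suc n)
  interpret F: module R "power_module R k" by (rule pm_module)
  interpret G: module R "power_module R (Suc n)" by (rule pm_module)
  note f = module_homD[OF Suc.prems(1)]
  let ?r = "\<lambda>v. restrict v {..<n}"
  have rh: "?r \<in> module_hom R (power_module R (Suc n)) (power_module R n)"
    by (rule pm_restrict_hom) simp
  have ivI: "v \<in> ivec p (Suc n)"
    if "v \<in> carrier (power_module R (Suc n))" "?r v \<in> ivec p n" "v n \<in> p" for v
    using that by (auto simp: ivec_def less_Suc_eq)
  show ?case
  proof (cases "\<exists>j<k. f (uvec k j) n \<notin> p")
    \<comment> \<open>All unit vectors, hence all vectors, have images with last coordinate in p.
      The last row imposes no condition and the target loses one coordinate.\<close>
    case False
    have "submodule R {y \<in> carrier (power_module R (Suc n)). y n \<in> p} (power_module R (Suc n))"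
    proof (rule submodule.intro[OF pm_module])
      fix v w assume "v \<in> {y \<in> carrier (power_module R (Suc n)). y n \<in> p}"
        "w \<in> {y \<in> carrier (power_module R (Suc n)). y n \<in> p}"
      then show "v \<oplus>\<^bsub>power_module R (Suc n)\<^esub> w \<in> {y \<in> carrier (power_module R (Suc n)). y n \<in> p}"
        by (simp add: pm_simps)
    next
      fix c v assume "c \<in> carrier R" "v \<in> {y \<in> carrier (power_module R (Suc n)). y n \<in> p}"
      then show "c \<odot>\<^bsub>power_module R (Suc n)\<^esub> v \<in> {y \<in> carrier (power_module R (Suc n)). y n \<in> p}"
        by (simp add: pm_simps p.I_l_closed)
    qed (simp_all add: pm_simps subset_iff)
    note sub = submodule_preimage[OF pm_module Suc.prems(1) this]
    have eq: "{x \<in> carrier (power_module R k). f x \<in> {y \<in> carrier (power_module R (Suc n)). y n \<in> p}}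
        = carrier (power_module R k)"
    proof (rule pm_submodule_eq[OF sub])
      fix i assume "i < k"
      then have "f (uvec k i) n \<in> p" using False by blast
      then show "uvec k i \<in> {x \<in> carrier (power_module R k). f x \<in> {y \<in> carrier (power_module R (Suc n)). y n \<in> p}}"
        using f(1)[OF uvec_closed] uvec_closed by blast
    qed
    have all: "f v n \<in> p" if "v \<in> carrier (power_module R k)" for v
      using subsetD[OF equalityD2[OF eq] that] by blast
    have "\<exists>v\<in>carrier (power_module R k). (\<exists>i<k. v i \<notin> p) \<and> ?r (f v) \<in> ivec p n"
      by (rule Suc.IH[OF module_hom_comp[OF Suc.prems(1) rh]]) (use Suc.prems(2) in simp)
    then obtain v where v: "v \<in> carrier (power_module R k)" "\<exists>i<k. v i \<notin> p" "?r (f v) \<in> ivec p n"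
      by blast
    show ?thesis using ivI[OF f(1)[OF v(1)] v(3) all[OF v(1)]] v(1,2) by blast
  next
    case True
    then obtain j where j: "j < k" "f (uvec k j) n \<notin> p" by blast
    define a where "a = f (uvec k j) n"
    have a: "a \<in> carrier R" "a \<notin> p"
      using j f(1)[OF uvec_closed[of k j]] by (auto simp: a_def pm_closed)
    obtain k' where k: "k = Suc k'" using j by (cases k) auto
    have jk: "j \<le> k'" using j k by simp
    note ih = ins_hom[OF jk, folded k]
    \<comment> \<open>Elimination with the pivot a in row n and column j. Multiplying by a replaces
      division by it: if c is the last coordinate of f at the vector with coordinate j inserted as
      zero, then \<open>\<psi> v\<close> is a times that vector minus c times the unit vector at j,
      and f of it has last coordinate a c - c a = 0.\<close>
    define \<psi> where "\<psi> = (\<lambda>v. a \<odot>\<^bsub>power_module R k\<^esub> ins k' j v \<ominus>\<^bsub>power_module R k\<^esub>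
        f (ins k' j v) n \<odot>\<^bsub>power_module R k\<^esub> uvec k j)"
    have fn: "f (ins k' j v) n \<in> carrier R" if "v \<in> carrier (power_module R k')" for v
      by (rule pm_closed[OF f(1)[OF module_homD(1)[OF ih that]]]) simp
    have "(\<lambda>v. f (ins k' j v) n \<odot>\<^bsub>power_module R k\<^esub> uvec k j)
        \<in> module_hom R (power_module R k') (power_module R k)"
    proof (rule module_homI)
      fix x y assume xy: "x \<in> carrier (power_module R k')" "y \<in> carrier (power_module R k')"
      show "f (ins k' j (x \<oplus>\<^bsub>power_module R k'\<^esub> y)) n \<odot>\<^bsub>power_module R k\<^esub> uvec k j =
          f (ins k' j x) n \<odot>\<^bsub>power_module R k\<^esub> uvec k j \<oplus>\<^bsub>power_module R k\<^esub>
          f (ins k' j y) n \<odot>\<^bsub>power_module R k\<^esub> uvec k j"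
        unfolding module_homD(2)[OF ih xy] f(2)[OF module_homD(1)[OF ih xy(1)] module_homD(1)[OF ih xy(2)]]
        by (simp add: pm_simps F.smult_l_distr fn[OF xy(1)] fn[OF xy(2)] uvec_closed)
    next
      fix b x assume x: "b \<in> carrier R" "x \<in> carrier (power_module R k')"
      show "f (ins k' j (b \<odot>\<^bsub>power_module R k'\<^esub> x)) n \<odot>\<^bsub>power_module R k\<^esub> uvec k j =
          b \<odot>\<^bsub>power_module R k\<^esub> (f (ins k' j x) n \<odot>\<^bsub>power_module R k\<^esub> uvec k j)"
        unfolding module_homD(3)[OF ih x] f(3)[OF x(1) module_homD(1)[OF ih x(2)]]
        by (simp add: pm_simps F.smult_assoc1 fn[OF x(2)] x(1) uvec_closed)
    qed (use fn uvec_closed in blast)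
    moreover have "(\<lambda>v. a \<odot>\<^bsub>power_module R k\<^esub> ins k' j v)
        \<in> module_hom R (power_module R k') (power_module R k)"
    proof (rule module_homI)
      fix b x assume x: "b \<in> carrier R" "x \<in> carrier (power_module R k')"
      show "a \<odot>\<^bsub>power_module R k\<^esub> ins k' j (b \<odot>\<^bsub>power_module R k'\<^esub> x) =
          b \<odot>\<^bsub>power_module R k\<^esub> (a \<odot>\<^bsub>power_module R k\<^esub> ins k' j x)"
        unfolding module_homD(3)[OF ih x] using module_homD(1)[OF ih x(2)] x(1) a(1)
        by (simp add: m_comm[of a b] flip: F.smult_assoc1)
    next
      fix x y assume xy: "x \<in> carrier (power_module R k')" "y \<in> carrier (power_module R k')"
      show "a \<odot>\<^bsub>power_module R k\<^esub> ins k' j (x \<oplus>\<^bsub>power_module R k'\<^esub> y) =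
          a \<odot>\<^bsub>power_module R k\<^esub> ins k' j x \<oplus>\<^bsub>power_module R k\<^esub> a \<odot>\<^bsub>power_module R k\<^esub> ins k' j y"
        unfolding module_homD(2)[OF ih xy] using module_homD(1)[OF ih] xy a(1)
        by (simp add: F.smult_r_distr)
    qed (use module_homD(1)[OF ih] a(1) in blast)
    ultimately have \<psi>: "\<psi> \<in> module_hom R (power_module R k') (power_module R k)"
      unfolding \<psi>_def by (intro module_hom_minus[OF pm_module])
    have "\<exists>v\<in>carrier (power_module R k'). (\<exists>i<k'. v i \<notin> p) \<and> ?r (f (\<psi> v)) \<in> ivec p n"
      by (rule Suc.IH[OF module_hom_comp[OF module_hom_comp[OF \<psi> Suc.prems(1)] rh]])
        (use Suc.prems(2) k in simp)
    then obtain v i where v: "v \<in> carrier (power_module R k')" "i < k'" "v i \<notin> p"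
      "?r (f (\<psi> v)) \<in> ivec p n" by blast
    have \<psi>v: "\<psi> v \<in> carrier (power_module R k)" using module_homD(1)[OF \<psi> v(1)] .
    define c where "c = f (ins k' j v) n"
    have iv: "ins k' j v \<in> carrier (power_module R k)" using module_homD(1)[OF ih v(1)] .
    have c: "c \<in> carrier R" unfolding c_def using f(1)[OF iv] by (simp add: pm_closed)
    have "f (\<psi> v) = a \<odot>\<^bsub>power_module R (Suc n)\<^esub> f (ins k' j v) \<ominus>\<^bsub>power_module R (Suc n)\<^esub>
        c \<odot>\<^bsub>power_module R (Suc n)\<^esub> f (uvec k j)"
      unfolding \<psi>_def c_def[symmetric]
        module_hom_zero_minus(3)[OF pm_module pm_module Suc.prems(1)
          F.smult_closed[OF a(1) iv] F.smult_closed[OF c uvec_closed]]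
        f(3)[OF a(1) iv] f(3)[OF c uvec_closed] ..
    then have "f (\<psi> v) n = a \<otimes> c \<ominus> c \<otimes> a"
      unfolding a_def c_def
      using pm_minus(2)[OF G.smult_closed[OF a(1) f(1)[OF iv]]
          G.smult_closed[OF c f(1)[OF uvec_closed[of k j]]], of n]
      by (simp add: pm_simps a_def c_def)
    then have "f (\<psi> v) n = \<zero>" using a c by (simp add: m_comm[of a c] minus_eq r_neg)
    then have "f (\<psi> v) \<in> ivec p (Suc n)" using ivI[OF f(1)[OF \<psi>v] v(4)] by simp
    moreover have "\<exists>l<k. \<psi> v l \<notin> p"
    proof (intro exI conjI)
      \<comment> \<open>The position of the old coordinate i after the insertion at j. It differs
        from j, so \<open>\<psi> v\<close> has there the product of a and \<open>v i\<close>, both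
        outside the prime p.\<close>
      let ?l = "if i < j then i else Suc i"
      show l: "?l < k" using v(2) k by auto
      have vi: "v i \<in> carrier R" using v by (simp add: pm_closed)
      have "?l \<noteq> j" by auto
      then have "\<psi> v ?l = a \<otimes> v i \<ominus> c \<otimes> \<zero>"
        unfolding \<psi>_def c_def[symmetric]
          pm_minus(2)[OF F.smult_closed[OF a(1) iv] F.smult_closed[OF c uvec_closed] l]
          pm_simps(2)[OF l] uvec_simp[OF l] ins_at(2)[OF jk v(2)]
        by (simp only: if_False)
      then have "\<psi> v ?l = a \<otimes> v i" using a c vi by (simp add: minus_eq)
      then show "\<psi> v ?l \<notin> p" using p.I_prime[OF a(1) vi] a(2) v(3) by auto
    qed
    ultimately show ?thesis using \<psi>v by blast
  qed
qed

end

section \<open>Noetherian modules\<close>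

text \<open>Stated as the maximum condition, since all arguments below pick a maximal member of some
  family of submodules.\<close>

definition noetherian_module ::
    "('a, 'r) ring_scheme \<Rightarrow> ('a, 'b, 'm) module_scheme \<Rightarrow> bool" where
  "noetherian_module R M \<longleftrightarrow> module R M \<and>
     (\<forall>S. S \<noteq> {} \<longrightarrow> (\<forall>N\<in>S. submodule R N M) \<longrightarrow> (\<exists>N\<in>S. \<forall>N'\<in>S. N \<subseteq> N' \<longrightarrow> N' = N))"

lemma noetherian_module_maximal:
  assumes "noetherian_module R M" "P N\<^sub>0" "\<And>N. P N \<Longrightarrow> submodule R N M"
  shows "\<exists>N. P N \<and> (\<forall>N'. P N' \<longrightarrow> N \<subseteq> N' \<longrightarrow> N' = N)"
proof -
  have "\<exists>N\<in>{N. P N}. \<forall>N'\<in>{N. P N}. N \<subseteq> N' \<longrightarrow> N' = N"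
    using assms(1)[unfolded noetherian_module_def, THEN conjunct2, rule_format, of "{N. P N}"] assms(2,3)
    by auto
  then show ?thesis by auto
qed

locale noetherian_cring = cring R + noetherian_ring R for R (structure)

context noetherian_cring
begin

lemma ring_module_simps:
  "carrier (ring_module R) = carrier R" "add (ring_module R) = add R" "\<zero>\<^bsub>ring_module R\<^esub> = \<zero>"
  "smult (ring_module R) = mult R"
  by (simp_all add: ring_module_def)

lemma ring_module_module: "module R (ring_module R)"
  by (rule module_criteria)
    (auto simp: ring_module_simps a_ac m_assoc l_distr r_distr is_cring intro!: bexI[of _ "\<ominus> _"] r_neg)

text \<open>Makes families of ideals, in particular of annihilators, accessible to the maximum
  condition for modules.\<close>

lemma submodule_ring_module_iff: "submodule R I (ring_module R) \<longleftrightarrow> ideal I R"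
proof
  assume "submodule R I (ring_module R)"
  note D = submoduleD[OF this, unfolded ring_module_simps]
  show "ideal I R"
  proof (rule idealI[OF ring_axioms])
    show "subgroup I (add_monoid R)"
    proof (rule add.subgroupI)
      fix a assume a: "a \<in> I"
      then have "\<ominus> a = (\<ominus> \<one>) \<otimes> a" using D(6) by (simp add: l_minus)
      then show "\<ominus> a \<in> I" using D(5)[of "\<ominus> \<one>" a] a by simp
    qed (use D in auto)
  next
    fix a x assume "a \<in> I" "x \<in> carrier R"
    then show "x \<otimes> a \<in> I" "a \<otimes> x \<in> I" using D(5)[of x a] D(6)[of a] m_comm[of a x] by simp_all
  qed
next
  assume "ideal I R"
  then interpret I: ideal I R .
  show "submodule R I (ring_module R)"
    by (rule submodule.intro[OF ring_module_module])
      (simp_all add: ring_module_simps I.a_subset I.I_l_closed)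
qed

lemma noetherian_ring_module: "noetherian_module R (ring_module R)"
  unfolding noetherian_module_def
proof (intro conjI allI impI)
  fix S :: "'a set set"
  assume ne: "S \<noteq> {}" and sub: "\<forall>N\<in>S. submodule R N (ring_module R)"
  show "\<exists>N\<in>S. \<forall>N'\<in>S. N \<subseteq> N' \<longrightarrow> N' = N"
  \<comment> \<open>The union of a nonempty chain of ideals is a member of the chain by the
    ascending chain condition, so it bounds the chain inside S. The empty chain is bounded by any
    member of S.\<close>
  proof (rule subset_Zorn)
    fix C assume C: "subset.chain S C"
    then have CS: "C \<subseteq> S" by (simp add: subset_chain_def)
    show "\<exists>U\<in>S. \<forall>X\<in>C. X \<subseteq> U"
    proof (cases "C = {}")
      case True
      then show ?thesis using ne by auto
    next
      case False
      have "C \<subseteq> {I. ideal I R}"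
        using CS sub by (auto simp: submodule_ring_module_iff)
      then have "subset.chain {I. ideal I R} C"
        using C by (simp add: subset_chain_def)
      from ideal_chain_is_trivial[OF False this] have U: "\<Union>C \<in> C" .
      show ?thesis by (rule bexI[of _ "\<Union>C"]) (use U CS in auto)
    qed
  qed
qed (rule ring_module_module)

lemma pm_last_hom: "(\<lambda>v. v n) \<in> module_hom R (power_module R (Suc n)) (ring_module R)"
  by (rule module_homI) (simp_all add: ring_module_simps pm_simps pm_closed)

text \<open>A two-stage maximal choice along the split sequence given by \<open>ins n n\<close> and
  the last coordinate. Among the submodules in S some have a maximal ideal \<open>?L\<close> of last
  coordinates; among these one has a maximal part \<open>?K\<close> with last coordinate zero. A
  larger member of S has the same \<open>?L\<close> and \<open>?K\<close>, and these determine it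
  among submodules containing the chosen one.\<close>

lemma noetherian_power_module: "noetherian_module R (power_module R n)"
proof (induction n)
  case 0
  have *: "N = carrier (power_module R 0)" if "submodule R N (power_module R 0)" for N
    by (rule pm_submodule_eq[OF that]) simp
  show ?case unfolding noetherian_module_def
  proof (intro conjI allI impI)
    fix S assume "S \<noteq> {}" and sub: "\<forall>N\<in>S. submodule R N (power_module R 0)"
    then obtain N where N: "N \<in> S" by (elim ex_in_conv[THEN iffD2, THEN exE])
    show "\<exists>N\<in>S. \<forall>N'\<in>S. N \<subseteq> N' \<longrightarrow> N' = N"
    proof (rule bexI[OF _ N], intro ballI impI)
      fix N' assume N': "N' \<in> S"
      show "N' = N" using *[OF bspec[OF sub N']] *[OF bspec[OF sub N]] by (rule trans[OF _ sym])
    qed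
  qed (rule pm_module)
next
  case (Suc n)
  let ?F = "power_module R (Suc n)"
  let ?L = "\<lambda>N. (\<lambda>v. v n) ` N"
  let ?K = "\<lambda>N. {v \<in> carrier (power_module R n). ins n n v \<in> N}"
  have ih: "ins n n \<in> module_hom R (power_module R n) ?F" by (rule ins_hom) simp
  interpret F: module R ?F by (rule pm_module)
  show ?case unfolding noetherian_module_def
  proof (intro conjI allI impI)
    fix S assume ne: "S \<noteq> {}" and sub: "\<forall>N\<in>S. submodule R N ?F"
    obtain N\<^sub>0 where N0: "N\<^sub>0 \<in> S" using ne by blast
    let ?P = "\<lambda>I. \<exists>N\<in>S. I = ?L N"
    have "\<exists>I. ?P I \<and> (\<forall>I'. ?P I' \<longrightarrow> I \<subseteq> I' \<longrightarrow> I' = I)"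
    proof (rule noetherian_module_maximal[OF noetherian_ring_module, of ?P "?L N\<^sub>0"])
      show "?P (?L N\<^sub>0)" using N0 by (rule bexI[rotated]) (rule refl)
      show "submodule R I (ring_module R)" if I: "?P I" for I
      proof -
        obtain N where "N \<in> S" "I = ?L N" using I ..
        then show ?thesis using sub submodule_image[OF _ ring_module_module pm_last_hom, of N n] by simp
      qed
    qed
    then obtain I where I: "?P I" "\<forall>I'. ?P I' \<longrightarrow> I \<subseteq> I' \<longrightarrow> I' = I" by (elim exE conjE)
    obtain N\<^sub>1 where N1: "N\<^sub>1 \<in> S" "I = ?L N\<^sub>1" using I(1) ..
    have N1max: "?L N = ?L N\<^sub>1" if "N \<in> S" "?L N\<^sub>1 \<subseteq> ?L N" for N
    proof -
      have "?L N = I"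
        by (rule I(2)[rule_format, OF bexI[OF refl that(1)]]) (simp only: N1(2) that(2))
      then show ?thesis unfolding N1(2) .
    qed
    let ?Q = "\<lambda>J. \<exists>N\<in>S. ?L N = ?L N\<^sub>1 \<and> J = ?K N"
    have "\<exists>J. ?Q J \<and> (\<forall>J'. ?Q J' \<longrightarrow> J \<subseteq> J' \<longrightarrow> J' = J)"
    proof (rule noetherian_module_maximal[OF Suc.IH, of ?Q "?K N\<^sub>1"])
      show "?Q (?K N\<^sub>1)" by (rule bexI[OF _ N1(1)]) simp
      show "submodule R J (power_module R n)" if J: "?Q J" for J
      proof -
        obtain N where "N \<in> S" "?L N = ?L N\<^sub>1 \<and> J = ?K N" using J ..
        then show ?thesis using sub submodule_preimage[OF pm_module ih, of N] by simp
      qed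
    qed
    then obtain J where J: "?Q J" "\<forall>J'. ?Q J' \<longrightarrow> J \<subseteq> J' \<longrightarrow> J' = J" by (elim exE conjE)
    obtain N where N': "N \<in> S" "?L N = ?L N\<^sub>1 \<and> J = ?K N" using J(1) ..
    have Nmax: "?K N' = ?K N" if "N' \<in> S" "?L N' = ?L N\<^sub>1" "?K N \<subseteq> ?K N'" for N'
    proof -
      have JK: "J = ?K N" using N'(2) by (rule conjunct2)
      have "?K N' = J"
        by (rule J(2)[rule_format]) (rule bexI[OF _ that(1)], simp only: that(2), simp only: JK that(3))
      then show ?thesis unfolding JK .
    qed
    note N = N'(1) conjunct1[OF N'(2)]
    have *: "N' = N" if N': "N' \<in> S" "N \<subseteq> N'" for N'
    proof (intro equalityI N'(2) subsetI)
      fix x assume x: "x \<in> N'"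
      have sN: "submodule R N ?F" by (rule bspec[OF sub N(1)])
      have sN': "submodule R N' ?F" by (rule bspec[OF sub N'(1)])
      have "?L N \<subseteq> ?L N'" by (rule image_mono[OF N'(2)])
      then have "?L N\<^sub>1 \<subseteq> ?L N'" unfolding N(2) .
      then have L: "?L N' = ?L N\<^sub>1" by (rule N1max[OF N'(1)])
      have K: "?K N' = ?K N" by (rule Nmax[OF N'(1) L]) (use N'(2) in auto)
      have "x n \<in> ?L N'" using x by (rule imageI)
      then have "x n \<in> ?L N" unfolding L N(2) .
      \<comment> \<open>Correcting x by an element y of N with the same last coordinate leaves a
        vector of the part \<open>?K N'\<close>, which equals \<open>?K N\<close>.\<close>
      then obtain y where y: "x n = y n" "y \<in> N" by (rule imageE)
      have xc: "x \<in> carrier ?F" "y \<in> carrier ?F"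
        by (rule submoduleD(6)[OF sN' x], rule submoduleD(6)[OF sN y(2)])
      have d: "x \<ominus>\<^bsub>?F\<^esub> y \<in> N'" by (rule submodule_minus[OF sN' x subsetD[OF N'(2) y(2)]])
      have "(x \<ominus>\<^bsub>?F\<^esub> y) n = x n \<ominus> y n" by (rule pm_minus(2)[OF xc]) simp
      then have "(x \<ominus>\<^bsub>?F\<^esub> y) n = \<zero>"
        unfolding y(1) using pm_closed[OF xc(2), of n] by (simp add: minus_eq r_neg)
      then have "x \<ominus>\<^bsub>?F\<^esub> y \<in> ins n n ` carrier (power_module R n)"
        by (intro ins_surj F.M.minus_closed xc) simp
      then obtain v where v: "x \<ominus>\<^bsub>?F\<^esub> y = ins n n v" "v \<in> carrier (power_module R n)" by (rule imageE)
      have "v \<in> ?K N'" using d v(2) unfolding v(1) by simp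
      then have "v \<in> ?K N" unfolding K .
      then have "x \<ominus>\<^bsub>?F\<^esub> y \<in> N" unfolding v(1) by simp
      from submoduleD(4)[OF sN y(2) this] show "x \<in> N"
        unfolding F.minus_add_cancel(1)[OF xc(2,1)] .
    qed
    show "\<exists>N\<in>S. \<forall>N'\<in>S. N \<subseteq> N' \<longrightarrow> N' = N"
      by (rule bexI[OF _ N(1)], intro ballI impI) (rule *)
  qed (rule pm_module)
qed

text \<open>A maximal member among the finitely generated submodules of N absorbs every cyclic
  submodule of N. Finite generation is expressed as being the image of a finite free module, the
  form that resolutions use.\<close>

lemma submodule_fg:
  assumes M: "noetherian_module R M" and N: "submodule R N M"
  shows "\<exists>k. \<exists>h\<in>module_hom R (power_module R k) M. h ` carrier (power_module R k) = N"
proof -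
  interpret M: module R M using M by (simp add: noetherian_module_def)
  let ?P = "\<lambda>L. L \<subseteq> N \<and> (\<exists>k. \<exists>h\<in>module_hom R (power_module R k) M. h ` carrier (power_module R k) = L)"
  have im: "submodule R (h ` carrier (power_module R k)) M" if "h \<in> module_hom R (power_module R k) M" for h k
    by (rule submodule_image[OF module.submodule_carrier[OF pm_module] M.module_axioms that])
  have "\<exists>L. ?P L \<and> (\<forall>L'. ?P L' \<longrightarrow> L \<subseteq> L' \<longrightarrow> L' = L)"
  proof (rule noetherian_module_maximal[OF M, of ?P "{\<zero>\<^bsub>M\<^esub>}"])
    interpret F: module R "power_module R 0" by (rule pm_module)
    have z: "(\<lambda>_. \<zero>\<^bsub>M\<^esub>) \<in> module_hom R (power_module R 0) M" by (rule pm_zero_hom[OF M.module_axioms])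
    have "(\<lambda>_. \<zero>\<^bsub>M\<^esub>) ` carrier (power_module R 0) = {\<zero>\<^bsub>M\<^esub>}"
      using F.M.zero_closed by auto
    then show "?P {\<zero>\<^bsub>M\<^esub>}" using z submoduleD(3)[OF N] by blast
    show "submodule R L M" if "?P L" for L using that im by blast
  qed
  then obtain L where "?P L \<and> (\<forall>L'. ?P L' \<longrightarrow> L \<subseteq> L' \<longrightarrow> L' = L)" by (rule exE)
  note L = conjunct1[OF this] conjunct2[OF this]
  have "N \<subseteq> L"
  proof
    fix x assume x: "x \<in> N"
    have xc: "x \<in> carrier M" by (rule submoduleD(6)[OF N x])
    obtain k h where h: "h \<in> module_hom R (power_module R k) M" "h ` carrier (power_module R k) = L"
      using L(1) by blast
    note s = pm_hom_snoc[OF M.module_axioms h(1) xc]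
    have sL: "submodule R L M" using im[OF h(1)] h(2) by simp
    note m = submodule_msum[OF sL M.submodule_cyc(1)[OF xc]]
    have "?P (msum M L (cyc R M x))"
    proof (intro conjI exI bexI)
      show "msum M L (cyc R M x) \<subseteq> N"
        by (rule msum_least[OF N]) (use L(1) cyc_least[OF N x] in blast)+
      show "(\<lambda>v. h (restrict v {..<k}) \<oplus>\<^bsub>M\<^esub> v k \<odot>\<^bsub>M\<^esub> x) ` carrier (power_module R (Suc k))
          = msum M L (cyc R M x)" using s(4) unfolding h(2) .
    qed (rule s(1))
    then have "msum M L (cyc R M x) = L" using L(2)[rule_format, OF _ m(2)] by blast
    then show "x \<in> L" using m(3) M.submodule_cyc(2)[OF xc] by blast
  qed
  then show ?thesis using L(1) by blast
qed

section \<open>Saturation and associated primes\<close>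

definition mult_set :: "'a set \<Rightarrow> bool" where
  "mult_set S \<longleftrightarrow> S \<subseteq> carrier R \<and> \<one> \<in> S \<and> (\<forall>s\<in>S. \<forall>t\<in>S. s \<otimes> t \<in> S)"

lemma mult_setD:
  assumes "mult_set S"
  shows "s \<in> S \<Longrightarrow> s \<in> carrier R" "\<one> \<in> S" "s \<in> S \<Longrightarrow> t \<in> S \<Longrightarrow> s \<otimes> t \<in> S"
  using assms by (auto simp: mult_set_def)

lemma mult_set_prime:
  assumes "primeideal p R"
  shows "mult_set (carrier R - p)"
proof -
  interpret p: primeideal p R by fact
  show ?thesis using p.I_prime p.I_notcarr p.one_imp_carrier by (auto simp: mult_set_def)
qed

text \<open>The preimage in \<open>M\<close> of the localization of \<open>C\<close> at \<open>S\<close>.\<close>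

definition sat :: "('a, 'c, 'd) module_scheme \<Rightarrow> 'a set \<Rightarrow> 'c set \<Rightarrow> 'c set" where
  "sat M S C = {x \<in> carrier M. \<exists>s\<in>S. s \<odot>\<^bsub>M\<^esub> x \<in> C}"

lemma sat_mono: "C \<subseteq> D \<Longrightarrow> sat M S C \<subseteq> sat M S D"
  by (auto simp: sat_def)

lemma sat_submodule:
  assumes S: "mult_set S" and C: "submodule R C M"
  shows "submodule R (sat M S C) M" "C \<subseteq> sat M S C"
proof -
  note D = submoduleD[OF C] and S = mult_setD[OF S]
  interpret M: module R M by (rule D)
  show sub: "C \<subseteq> sat M S C"
  proof
    fix x assume "x \<in> C"
    then show "x \<in> sat M S C" using D(6)[of x] S(2) unfolding sat_def by (auto intro!: bexI[of _ "\<one>"])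
  qed
  show "submodule R (sat M S C) M"
  proof (rule submodule.intro[OF D(1)])
    show "sat M S C \<subseteq> carrier M" by (auto simp: sat_def)
    show "\<zero>\<^bsub>M\<^esub> \<in> sat M S C" using sub D(3) by blast
  next
    fix v w assume "v \<in> sat M S C" "w \<in> sat M S C"
    then obtain s t where st: "s \<in> S" "t \<in> S" "s \<odot>\<^bsub>M\<^esub> v \<in> C" "t \<odot>\<^bsub>M\<^esub> w \<in> C"
      and vw: "v \<in> carrier M" "w \<in> carrier M" by (auto simp: sat_def)
    have c: "s \<in> carrier R" "t \<in> carrier R" using S(1) st by blast+
    have "(s \<otimes> t) \<odot>\<^bsub>M\<^esub> (v \<oplus>\<^bsub>M\<^esub> w) = t \<odot>\<^bsub>M\<^esub> (s \<odot>\<^bsub>M\<^esub> v) \<oplus>\<^bsub>M\<^esub> s \<odot>\<^bsub>M\<^esub> (t \<odot>\<^bsub>M\<^esub> w)"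
      using vw c by (simp add: M.smult_r_distr m_comm[of s t] flip: M.smult_assoc1)
    also have "\<dots> \<in> C" by (rule D(4)[OF D(5)[OF c(2) st(3)] D(5)[OF c(1) st(4)]])
    finally show "v \<oplus>\<^bsub>M\<^esub> w \<in> sat M S C" using S(3)[OF st(1,2)] vw by (auto simp: sat_def)
  next
    fix a v assume a: "a \<in> carrier R" and "v \<in> sat M S C"
    then obtain s where s: "s \<in> S" "s \<odot>\<^bsub>M\<^esub> v \<in> C" "v \<in> carrier M" by (auto simp: sat_def)
    have c: "s \<in> carrier R" using S(1) s by blast
    have "s \<odot>\<^bsub>M\<^esub> (a \<odot>\<^bsub>M\<^esub> v) = a \<odot>\<^bsub>M\<^esub> (s \<odot>\<^bsub>M\<^esub> v)"
      using s(3) c a by (simp add: m_comm[of s a] flip: M.smult_assoc1)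
    then have "s \<odot>\<^bsub>M\<^esub> (a \<odot>\<^bsub>M\<^esub> v) \<in> C" using D(5)[OF a s(2)] by simp
    then show "a \<odot>\<^bsub>M\<^esub> v \<in> sat M S C" using s a by (auto simp: sat_def)
  qed
qed

lemma sat_cancel:
  assumes S: "mult_set S" and M: "module R M" and x: "x \<in> carrier M" "s \<in> S" "s \<odot>\<^bsub>M\<^esub> x \<in> sat M S C"
  shows "x \<in> sat M S C"
proof -
  interpret M: module R M by fact
  obtain t where t: "t \<in> S" "t \<odot>\<^bsub>M\<^esub> (s \<odot>\<^bsub>M\<^esub> x) \<in> C" using x(3) by (auto simp: sat_def)
  have "(t \<otimes> s) \<odot>\<^bsub>M\<^esub> x \<in> C"
    using t(2) M.smult_assoc1[OF mult_setD(1)[OF S t(1)] mult_setD(1)[OF S x(2)] x(1)] by simp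
  then show ?thesis using mult_setD(3)[OF S t(1) x(2)] x(1) by (auto simp: sat_def)
qed

lemma sat_sat:
  assumes S: "mult_set S" and M: "module R M"
  shows "sat M S (sat M S C) \<subseteq> sat M S C"
proof
  fix x assume "x \<in> sat M S (sat M S C)"
  then obtain s where "x \<in> carrier M" "s \<in> S" "s \<odot>\<^bsub>M\<^esub> x \<in> sat M S C" unfolding sat_def by blast
  then show "x \<in> sat M S C" by (rule sat_cancel[OF S M])
qed

lemma sat_trans:
  assumes S: "mult_set S" and M: "module R M" and "C \<subseteq> sat M S D"
  shows "sat M S C \<subseteq> sat M S D"
  using sat_mono[OF assms(3)] sat_sat[OF S M] by blast

text \<open>The submodules of all x with s x in C grow when s is replaced by a multiple of s. A
  maximal one already contains every element of the saturation, because s may be multiplied by the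
  denominator of that element.\<close>

lemma sat_uniform:
  assumes M: "noetherian_module R M" and S: "mult_set S" and C: "submodule R C M"
  shows "\<exists>s\<in>S. \<forall>x\<in>sat M S C. s \<odot>\<^bsub>M\<^esub> x \<in> C"
proof -
  note D = submoduleD[OF C] and S' = mult_setD[OF S]
  interpret M: module R M by (rule D)
  let ?Q = "\<lambda>s. {x \<in> carrier M. s \<odot>\<^bsub>M\<^esub> x \<in> C}"
  have h: "(\<lambda>x. s \<odot>\<^bsub>M\<^esub> x) \<in> module_hom R M M" if "s \<in> carrier R" for s
    by (rule module_homI) (use that in \<open>simp_all add: M.smult_r_distr m_comm flip: M.smult_assoc1\<close>)
  let ?P = "\<lambda>N. \<exists>s\<in>S. N = ?Q s"
  have "\<exists>N. ?P N \<and> (\<forall>N'. ?P N' \<longrightarrow> N \<subseteq> N' \<longrightarrow> N' = N)"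
  proof (rule noetherian_module_maximal[OF M, of ?P "?Q \<one>"])
    show "?P (?Q \<one>)" using S'(2) by blast
    show "submodule R N M" if "\<exists>s\<in>S. N = ?Q s" for N
      using that submodule_preimage[OF M.module_axioms h C] S'(1) by blast
  qed
  then obtain N where N: "?P N" "\<forall>N'. ?P N' \<longrightarrow> N \<subseteq> N' \<longrightarrow> N' = N" by (elim exE conjE)
  obtain s where s: "s \<in> S" "N = ?Q s" using N(1) ..
  show ?thesis
  proof (rule bexI[OF _ s(1)], rule ballI)
    fix x assume "x \<in> sat M S C"
    then obtain t where t: "t \<in> S" "t \<odot>\<^bsub>M\<^esub> x \<in> C" and xc: "x \<in> carrier M" by (auto simp: sat_def)
    have c: "s \<in> carrier R" "t \<in> carrier R" using S'(1) s t by blast+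
    have "?Q s \<subseteq> ?Q (s \<otimes> t)"
    proof
      fix y assume y: "y \<in> ?Q s"
      then have "(s \<otimes> t) \<odot>\<^bsub>M\<^esub> y = t \<odot>\<^bsub>M\<^esub> (s \<odot>\<^bsub>M\<^esub> y)"
        using c by (simp add: m_comm[of s t] M.smult_assoc1)
      then show "y \<in> ?Q (s \<otimes> t)" using y D(5)[OF c(2)] by simp
    qed
    then have "?Q (s \<otimes> t) = ?Q s" using N(2)[rule_format, of "?Q (s \<otimes> t)"] S'(3)[OF s(1) t(1)] unfolding s(2) by blast
    moreover have "x \<in> ?Q (s \<otimes> t)" using D(5)[OF c(1) t(2)] xc c by (simp add: M.smult_assoc1)
    ultimately show "s \<odot>\<^bsub>M\<^esub> x \<in> C" by blast
  qed
qed

text \<open>The annihilator of the class of x in M / C.\<close>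

definition colon :: "('a, 'c, 'd) module_scheme \<Rightarrow> 'c set \<Rightarrow> 'c \<Rightarrow> 'a set" where
  "colon M C x = {a \<in> carrier R. a \<odot>\<^bsub>M\<^esub> x \<in> C}"

lemma colon_ideal:
  assumes C: "submodule R C M" and x: "x \<in> carrier M"
  shows "ideal (colon M C x) R"
proof -
  interpret M: module R M by (rule submoduleD[OF C])
  have "(\<lambda>a. a \<odot>\<^bsub>M\<^esub> x) \<in> module_hom R (ring_module R) M"
    by (rule module_homI) (use x in \<open>simp_all add: ring_module_simps M.smult_l_distr M.smult_assoc1\<close>)
  from submodule_preimage[OF ring_module_module this C] show ?thesis
    by (simp add: submodule_ring_module_iff colon_def ring_module_simps)
qed

text \<open>A nonzero module has an associated prime: a maximal annihilator of a nonzero class is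
  prime. If a b annihilates y and b does not, then b y is again nonzero in the quotient, its
  annihilator contains that of y and a, and by maximality it is no larger.\<close>

lemma exists_prime_colon:
  assumes T: "submodule R T M" and x: "x \<in> carrier M" "x \<notin> T"
  obtains y where "y \<in> carrier M" "y \<notin> T" "primeideal (colon M T y) R"
proof -
  note D = submoduleD[OF T]
  interpret M: module R M by (rule D)
  let ?P = "\<lambda>I. \<exists>y\<in>carrier M. y \<notin> T \<and> I = colon M T y"
  have "\<exists>I. ?P I \<and> (\<forall>I'. ?P I' \<longrightarrow> I \<subseteq> I' \<longrightarrow> I' = I)"
  proof (rule noetherian_module_maximal[OF noetherian_ring_module, of ?P "colon M T x"])
    show "?P (colon M T x)" by (rule bexI[OF _ x(1)]) (simp add: x(2))
    show "submodule R I (ring_module R)" if "?P I" for I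
      using that unfolding submodule_ring_module_iff by (elim bexE conjE) (simp add: colon_ideal[OF T])
  qed
  then obtain I where I: "?P I" "\<forall>I'. ?P I' \<longrightarrow> I \<subseteq> I' \<longrightarrow> I' = I" by (elim exE conjE)
  from I(1) obtain y where y: "y \<in> carrier M" "y \<notin> T" "I = colon M T y" by (elim bexE conjE)
  interpret I: ideal I R unfolding y(3) by (rule colon_ideal[OF T y(1)])
  have "primeideal I R"
  proof (rule primeidealI[OF I.is_ideal is_cring])
    show "carrier R \<noteq> I"
    proof
      assume "carrier R = I"
      then have "\<one> \<in> I" using one_closed by (rule subst[where P = "\<lambda>X. \<one> \<in> X"])
      then have "\<one> \<in> colon M T y" unfolding y(3) .
      then show False using y(1,2) by (simp add: colon_def)
    qed
    fix a b assume a: "a \<in> carrier R" and b: "b \<in> carrier R" and ab: "a \<otimes> b \<in> I"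
    show "a \<in> I \<or> b \<in> I"
    proof (rule disjCI)
      assume "b \<notin> I"
      then have by1: "b \<odot>\<^bsub>M\<^esub> y \<in> carrier M" "b \<odot>\<^bsub>M\<^esub> y \<notin> T"
        using b y(1) unfolding y(3) by (simp_all add: colon_def)
      have sub: "I \<subseteq> colon M T (b \<odot>\<^bsub>M\<^esub> y)"
      proof
        fix c assume "c \<in> I"
        then have c: "c \<in> carrier R" "c \<odot>\<^bsub>M\<^esub> y \<in> T" unfolding y(3) by (auto simp: colon_def)
        have "c \<odot>\<^bsub>M\<^esub> (b \<odot>\<^bsub>M\<^esub> y) = b \<odot>\<^bsub>M\<^esub> (c \<odot>\<^bsub>M\<^esub> y)"
          using c b y(1) by (simp add: m_comm[of c b] flip: M.smult_assoc1)
        then show "c \<in> colon M T (b \<odot>\<^bsub>M\<^esub> y)" using D(5)[OF b c(2)] c(1) by (simp add: colon_def)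
      qed
      have "colon M T (b \<odot>\<^bsub>M\<^esub> y) = I"
        by (rule I(2)[rule_format]) (rule bexI[OF _ by1(1)], rule conjI[OF by1(2) refl], rule sub)
      moreover have "a \<in> colon M T (b \<odot>\<^bsub>M\<^esub> y)"
      proof -
        have "(a \<otimes> b) \<odot>\<^bsub>M\<^esub> y \<in> T" using ab unfolding y(3) by (simp add: colon_def)
        then show ?thesis unfolding M.smult_assoc1[OF a b y(1)] using a by (simp add: colon_def)
      qed
      ultimately show "a \<in> I" by simp
    qed
  qed
  then have "primeideal (colon M T y) R" unfolding y(3) .
  then show ?thesis by (rule that[OF y(1,2)])
qed

text \<open>An associated prime of the localized quotient is also one of M / C itself. Take a prime
  colon ideal of the saturation at y and multiply y by the uniform denominator t: then a t y lies in
  C exactly if a y lies in the saturation. The prime misses S since otherwise y would lie in the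
  saturation.\<close>

lemma exists_prime_colon_below:
  assumes M: "noetherian_module R M" and C: "submodule R C M" and S: "mult_set S"
    and x: "x \<in> carrier M" "x \<notin> sat M S C"
  obtains y where "y \<in> carrier M" "primeideal (colon M C y) R" "colon M C y \<inter> S = {}"
proof -
  note D = submoduleD[OF C]
  interpret M: module R M by (rule D)
  note T = sat_submodule[OF S C]
  obtain y where y: "y \<in> carrier M" "y \<notin> sat M S C" "primeideal (colon M (sat M S C) y) R"
    by (rule exists_prime_colon[OF T(1) x])
  obtain t where t: "\<forall>x\<in>sat M S C. t \<odot>\<^bsub>M\<^esub> x \<in> C" "t \<in> S"
    using sat_uniform[OF M S C] by (rule bexE)
  have tc: "t \<in> carrier R" by (rule mult_setD(1)[OF S t(2)])
  have ty: "t \<odot>\<^bsub>M\<^esub> y \<in> carrier M" using tc y(1) by simp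
  have eq: "colon M C (t \<odot>\<^bsub>M\<^esub> y) = colon M (sat M S C) y"
  proof (intro equalityI subsetI)
    fix a assume "a \<in> colon M C (t \<odot>\<^bsub>M\<^esub> y)"
    then have a: "a \<in> carrier R" "a \<odot>\<^bsub>M\<^esub> (t \<odot>\<^bsub>M\<^esub> y) \<in> C" by (auto simp: colon_def)
    have "t \<odot>\<^bsub>M\<^esub> (a \<odot>\<^bsub>M\<^esub> y) \<in> C"
      using a tc y(1) by (simp add: m_comm[of a t] flip: M.smult_assoc1)
    then show "a \<in> colon M (sat M S C) y" using a(1) y(1) t(2) by (auto simp: colon_def sat_def)
  next
    fix a assume "a \<in> colon M (sat M S C) y"
    then have a: "a \<in> carrier R" "a \<odot>\<^bsub>M\<^esub> y \<in> sat M S C" by (auto simp: colon_def)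
    have "t \<odot>\<^bsub>M\<^esub> (a \<odot>\<^bsub>M\<^esub> y) \<in> C" by (rule bspec[OF t(1) a(2)])
    then have "a \<odot>\<^bsub>M\<^esub> (t \<odot>\<^bsub>M\<^esub> y) \<in> C"
      using a(1) tc y(1) by (simp add: m_comm[of a t] flip: M.smult_assoc1)
    then show "a \<in> colon M C (t \<odot>\<^bsub>M\<^esub> y)" using a(1) by (simp add: colon_def)
  qed
  have "colon M (sat M S C) y \<inter> S = {}"
  proof -
    have False if "s \<in> S" "s \<odot>\<^bsub>M\<^esub> y \<in> sat M S C" for s
      using sat_cancel[OF S D(1) y(1) that] y(2) by simp
    then show ?thesis by (auto simp: colon_def)
  qed
  then show ?thesis using that[OF ty] y(3) unfolding eq by simp
qed

section \<open>Associated primes of the ring\<close>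

definition annR :: "'a \<Rightarrow> 'a set" where
  "annR z = {a \<in> carrier R. a \<otimes> z = \<zero>}"

definition Ass :: "'a set set" where
  "Ass = {p. primeideal p R \<and> (\<exists>z\<in>carrier R. p = annR z)}"

lemma AssD: "p \<in> Ass \<Longrightarrow> primeideal p R"
  by (simp add: Ass_def)

text \<open>Take an ideal N maximal with finitely many primes among the annihilators of its
  elements. If N is proper, there is y outside N whose colon ideal q is prime, and N + R y acquires
  at most the one new prime q, because (N + R y) / N is isomorphic to R / q.\<close>

lemma finite_Ass: "finite Ass"
proof -
  let ?A = "\<lambda>N. {p. primeideal p R \<and> (\<exists>z\<in>N. p = annR z)}"
  let ?P = "\<lambda>N. submodule R N (ring_module R) \<and> finite (?A N)"
  interpret M: module R "ring_module R" by (rule ring_module_module)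
  have z: "?A {\<zero>} = {}"
  proof -
    have "annR \<zero> = carrier R" by (auto simp: annR_def)
    then show ?thesis using primeideal.I_notcarr by fastforce
  qed
  have "\<exists>N. ?P N \<and> (\<forall>N'. ?P N' \<longrightarrow> N \<subseteq> N' \<longrightarrow> N' = N)"
  proof (rule noetherian_module_maximal[OF noetherian_ring_module, of ?P "{\<zero>}"])
    show "?P {\<zero>}" using M.submodule_zero unfolding z ring_module_simps by simp
  qed blast
  then obtain N where "?P N \<and> (\<forall>N'. ?P N' \<longrightarrow> N \<subseteq> N' \<longrightarrow> N' = N)" by (rule exE)
  note N = conjunct1[OF this] conjunct2[OF this]
  have sN: "submodule R N (ring_module R)" using N(1) by blast
  interpret N: ideal N R using sN by (simp add: submodule_ring_module_iff)
  have "carrier R \<subseteq> N"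
  proof (rule ccontr)
    assume "\<not> carrier R \<subseteq> N"
    then obtain x where "x \<in> carrier (ring_module R)" "x \<notin> N" by (auto simp: ring_module_simps)
    then obtain y where y: "y \<in> carrier (ring_module R)" "y \<notin> N" "primeideal (colon (ring_module R) N y) R"
      by (rule exists_prime_colon[OF sN])
    define q where "q = colon (ring_module R) N y"
    interpret q: primeideal q R unfolding q_def by (rule y(3))
    have yc: "y \<in> carrier R" using y(1) by (simp add: ring_module_simps)
    have q: "a \<in> q \<longleftrightarrow> a \<in> carrier R \<and> a \<otimes> y \<in> N" for a
      by (simp only: q_def colon_def ring_module_simps mem_Collect_eq)
    let ?N' = "msum (ring_module R) N (cyc R (ring_module R) y)"
    note m = submodule_msum[OF sN M.submodule_cyc(1)[OF y(1)]]
    have "?A ?N' \<subseteq> insert q (?A N)"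
    proof
      fix p assume "p \<in> ?A ?N'"
      then obtain w where p: "primeideal p R" "w \<in> ?N'" "p = annR w" by blast
      interpret p: primeideal p R by (rule p)
      obtain n r where n: "n \<in> N" "r \<in> carrier R" "w = n \<oplus> r \<otimes> y"
        using p(2) unfolding msum_def cyc_def ring_module_simps by blast
      have nc: "n \<in> carrier R" by (rule N.a_Hcarr[OF n(1)])
      have wc: "w \<in> carrier R" using n nc yc by simp
      show "p \<in> insert q (?A N)"
      \<comment> \<open>Either R w meets N in a nonzero element a w, whose annihilator is still p
        because p is prime, or R w embeds into (N + R y) / N, a copy of R / q, in which nonzero
        elements have annihilator q.\<close>
      proof (cases "\<exists>a\<in>carrier R. a \<otimes> w \<in> N \<and> a \<otimes> w \<noteq> \<zero>")
        case True
        then obtain a where a: "a \<in> carrier R" "a \<otimes> w \<in> N" "a \<otimes> w \<noteq> \<zero>" by blast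
        have ap: "a \<notin> p" unfolding p(3) annR_def using a(3) by blast
        have "p = annR (a \<otimes> w)"
        proof (intro equalityI subsetI)
          fix c assume "c \<in> p"
          then have c: "c \<in> carrier R" "c \<otimes> w = \<zero>" unfolding p(3) annR_def by blast+
          have "c \<otimes> (a \<otimes> w) = a \<otimes> (c \<otimes> w)" by (rule m_lcomm[OF c(1) a(1) wc])
          then have "c \<otimes> (a \<otimes> w) = \<zero>" unfolding c(2) r_null[OF a(1)] .
          then show "c \<in> annR (a \<otimes> w)" unfolding annR_def using c(1) by blast
        next
          fix c assume "c \<in> annR (a \<otimes> w)"
          then have c: "c \<in> carrier R" "c \<otimes> (a \<otimes> w) = \<zero>" unfolding annR_def by blast+
          have "(c \<otimes> a) \<otimes> w = \<zero>" unfolding m_assoc[OF c(1) a(1) wc] by (rule c(2))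
          then have "c \<otimes> a \<in> p" unfolding p(3) annR_def using m_closed[OF c(1) a(1)] by blast
          then show "c \<in> p" using p.I_prime[OF c(1) a(1)] ap by blast
        qed
        then show ?thesis using p(1) a(2) by blast
      next
        case False
        have iff: "a \<in> p \<longleftrightarrow> a \<otimes> r \<in> q" if a: "a \<in> carrier R" for a
        proof -
          have e: "a \<otimes> w = a \<otimes> n \<oplus> (a \<otimes> r) \<otimes> y"
            unfolding n(3) m_assoc[OF a n(2) yc] by (rule r_distr[OF nc m_closed[OF n(2) yc] a])
          have an: "a \<otimes> n \<in> N" using a n(1) by (rule N.I_l_closed[rotated])
          have "a \<in> p \<longleftrightarrow> a \<otimes> w = \<zero>" unfolding p(3) annR_def using a by blast
          also have "\<dots> \<longleftrightarrow> a \<otimes> w \<in> N"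
          proof
            assume "a \<otimes> w = \<zero>"
            then show "a \<otimes> w \<in> N" using N.zero_closed by (rule ssubst)
          next
            assume "a \<otimes> w \<in> N"
            then show "a \<otimes> w = \<zero>" using False a by blast
          qed
          also have "\<dots> \<longleftrightarrow> (a \<otimes> r) \<otimes> y \<in> N"
          proof
            assume "(a \<otimes> r) \<otimes> y \<in> N"
            then show "a \<otimes> w \<in> N" unfolding e by (rule N.a_closed[OF an])
          next
            assume "a \<otimes> w \<in> N"
            then have "\<ominus> (a \<otimes> n) \<oplus> a \<otimes> w \<in> N" by (rule N.a_closed[OF N.a_inv_closed[OF an]])
            then show "(a \<otimes> r) \<otimes> y \<in> N"
              unfolding e r_neg1[OF m_closed[OF a nc] m_closed[OF m_closed[OF a n(2)] yc]] .
          qed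
          also have "\<dots> \<longleftrightarrow> a \<otimes> r \<in> q" unfolding q using m_closed[OF a n(2)] by blast
          finally show ?thesis .
        qed
        have "r \<notin> q"
        proof
          assume "r \<in> q"
          then have "\<one> \<in> p" unfolding iff[OF one_closed] l_one[OF n(2)] .
          then show False using p.one_imp_carrier p.I_notcarr by blast
        qed
        then have "a \<in> p \<longleftrightarrow> a \<in> q" if a: "a \<in> carrier R" for a
          using iff[OF a] q.I_prime[OF a n(2)] q.I_r_closed[OF _ n(2)] by blast
        then have "p = q" using p.a_subset q.a_subset by blast
        then show ?thesis by blast
      qed
    qed
    then have "finite (?A ?N')" using N(1) finite_subset by auto
    then have "?N' = N" using N(2)[rule_format, of ?N'] m(1,2) by blast
    then show False using m(3) M.submodule_cyc(2)[OF y(1)] y(2) by blast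
  qed
  then have "Ass \<subseteq> ?A N" unfolding Ass_def by blast
  then show ?thesis using N(1) finite_subset by blast
qed

lemma common_denominator:
  assumes S: "mult_set S" and "\<And>i. i < n \<Longrightarrow> \<exists>s\<in>S. s \<otimes> v i = \<zero>" "\<And>i. i < (n::nat) \<Longrightarrow> v i \<in> carrier R"
  shows "\<exists>s\<in>S. \<forall>i<n. s \<otimes> v i = \<zero>"
  using assms(2,3)
proof (induction n)
  case 0
  then show ?case using mult_setD(2)[OF S] by blast
next
  case (Suc n)
  have "\<exists>s\<in>S. \<forall>i<n. s \<otimes> v i = \<zero>" by (rule Suc.IH) (use Suc.prems in auto)
  then obtain s where s: "s \<in> S" "\<forall>i<n. s \<otimes> v i = \<zero>" by blast
  obtain t where t: "t \<in> S" "t \<otimes> v n = \<zero>" using Suc.prems(1)[of n] by blast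
  have c: "s \<in> carrier R" "t \<in> carrier R" using mult_setD(1)[OF S] s(1) t(1) by blast+
  have "(s \<otimes> t) \<otimes> v i = \<zero>" if "i < Suc n" for i
  proof (cases "i = n")
    case True
    then show ?thesis using c t Suc.prems(2)[of n] by (simp add: m_assoc)
  next
    case False
    then have "i < n" using that by simp
    then show ?thesis using c s(2) Suc.prems(2)[of i] by (simp add: m_comm[of s t] m_assoc)
  qed
  then show ?case using mult_setD(3)[OF S s(1) t(1)] by blast
qed

text \<open>Modulo the kernel of f the annihilator of y is that of the vector f y, the intersection
  of the annihilators of its coordinates. A prime that is a finite intersection of ideals is one of
  them: otherwise each coordinate is killed by some element outside P, and the product of these
  kills all of them.\<close>

lemma colon_ker_in_Ass:
  assumes f: "f \<in> module_hom R M (power_module R n)" and M: "module R M" and y: "y \<in> carrier M"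
    and P: "primeideal (colon M {x \<in> carrier M. f x = \<zero>\<^bsub>power_module R n\<^esub>} y) R"
  shows "colon M {x \<in> carrier M. f x = \<zero>\<^bsub>power_module R n\<^esub>} y \<in> Ass"
proof -
  interpret M: module R M by fact
  interpret F: module R "power_module R n" by (rule pm_module)
  define P where "P = colon M {x \<in> carrier M. f x = \<zero>\<^bsub>power_module R n\<^esub>} y"
  interpret P: primeideal P R unfolding P_def by (rule P)
  define v where "v = f y"
  have v: "v \<in> carrier (power_module R n)" unfolding v_def by (rule module_homD(1)[OF f y])
  have mem: "a \<in> P \<longleftrightarrow> a \<in> carrier R \<and> (\<forall>i<n. a \<otimes> v i = \<zero>)" for a
  proof -
    have "a \<in> P \<longleftrightarrow> a \<in> carrier R \<and> a \<odot>\<^bsub>power_module R n\<^esub> v = \<zero>\<^bsub>power_module R n\<^esub>"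
    proof -
      have "a \<in> P \<longleftrightarrow> a \<in> carrier R \<and> a \<odot>\<^bsub>M\<^esub> y \<in> carrier M \<and>
          f (a \<odot>\<^bsub>M\<^esub> y) = \<zero>\<^bsub>power_module R n\<^esub>"
        by (simp only: P_def colon_def mem_Collect_eq)
      then show ?thesis using M.smult_closed[of a, OF _ y] module_homD(3)[OF f, of a, OF _ y]
        by (simp only: v_def cong: conj_cong) simp
    qed
    moreover have "a \<odot>\<^bsub>power_module R n\<^esub> v = \<zero>\<^bsub>power_module R n\<^esub> \<longleftrightarrow> (\<forall>i<n. a \<otimes> v i = \<zero>)"
      if a: "a \<in> carrier R"
    proof
      assume "a \<odot>\<^bsub>power_module R n\<^esub> v = \<zero>\<^bsub>power_module R n\<^esub>"
      then have eq: "(a \<odot>\<^bsub>power_module R n\<^esub> v) i = \<zero>\<^bsub>power_module R n\<^esub> i" for i by (rule fun_cong)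
      show "\<forall>i<n. a \<otimes> v i = \<zero>"
      proof (intro allI impI)
        fix i assume i: "i < n"
        show "a \<otimes> v i = \<zero>" using eq[of i] unfolding pm_simps(2)[OF i] pm_simps(3)[OF i] .
      qed
    next
      assume "\<forall>i<n. a \<otimes> v i = \<zero>"
      then show "a \<odot>\<^bsub>power_module R n\<^esub> v = \<zero>\<^bsub>power_module R n\<^esub>"
        by (intro pm_eqI[of _ n] F.smult_closed[OF a v] F.M.zero_closed) (simp only: pm_simps)
    qed
    ultimately show ?thesis by blast
  qed
  note S = mult_set_prime[OF P.primeideal_axioms]
  have "\<exists>i<n. \<forall>s\<in>carrier R - P. s \<otimes> v i \<noteq> \<zero>"
  proof (rule ccontr)
    assume "\<not> (\<exists>i<n. \<forall>s\<in>carrier R - P. s \<otimes> v i \<noteq> \<zero>)"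
    then have "\<exists>s\<in>carrier R - P. \<forall>i<n. s \<otimes> v i = \<zero>"
      by (intro common_denominator[OF S]) (use v in \<open>auto simp: pm_closed\<close>)
    then show False using mem by blast
  qed
  then obtain i where i: "i < n" "\<And>s. s \<in> carrier R - P \<Longrightarrow> s \<otimes> v i \<noteq> \<zero>" by blast
  have "P = annR (v i)"
  proof (intro equalityI subsetI)
    fix a assume "a \<in> P"
    then show "a \<in> annR (v i)" using mem i(1) unfolding annR_def by blast
  next
    fix a assume "a \<in> annR (v i)"
    then show "a \<in> P" using i(2) unfolding annR_def by blast
  qed
  moreover have "v i \<in> carrier R" using v i(1) by (rule pm_closed)
  ultimately have "P \<in> Ass" using P.primeideal_axioms unfolding Ass_def by blast
  then show ?thesis unfolding P_def .
qed

section \<open>Localized rank arguments\<close>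

lemma prime_compl_mono:
  "q \<subseteq> p \<Longrightarrow> sat M (carrier R - p) C \<subseteq> sat M (carrier R - q) C"
  by (auto simp: sat_def)

text \<open>Nakayama's lemma at \<open>p\<close>: the unit vectors are eliminated one after the other.\<close>

lemma nakayama_local:
  assumes p: "primeideal p R" and C: "submodule R C (power_module R n)"
    and full: "carrier (power_module R n)
      \<subseteq> sat (power_module R n) (carrier R - p) (msum (power_module R n) C (ivec p n))"
  shows "carrier (power_module R n) \<subseteq> sat (power_module R n) (carrier R - p) C"
proof -
  interpret p: primeideal p R by fact
  let ?F = "power_module R n" and ?S = "carrier R - p"
  interpret F: module R ?F by (rule pm_module)
  have S: "mult_set ?S" by (rule mult_set_prime[OF p])
  have M: "module R ?F" by (rule pm_module)
  \<comment> \<open>\<open>E j\<close> is the span of the first j unit vectors. The free module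
    stays locally equal to \<open>C + E j\<close> while j falls from n, where this is trivial, to 0,
    where it is the claim.\<close>
  define E where "E = (\<lambda>j. {r \<in> carrier ?F. \<forall>i. j \<le> i \<longrightarrow> i < n \<longrightarrow> r i = \<zero>})"
  have Ec: "E j \<subseteq> carrier ?F" for j by (auto simp: E_def)
  have Es: "submodule R (E j) ?F" for j
    by (rule submodule.intro[OF M]) (auto simp: E_def pm_simps)
  have iv: "submodule R (ivec p n) ?F" by (rule ivec_submodule[OF p.is_ideal])
  have split: "\<exists>r'\<in>E j. r = r' \<oplus>\<^bsub>?F\<^esub> r j \<odot>\<^bsub>?F\<^esub> uvec n j" if r: "r \<in> E (Suc j)" and j: "j < n" for r j
  proof -
    define r' where "r' = (\<lambda>i\<in>{..<n}. if i = j then \<zero> else r i)"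
    have rc: "r \<in> carrier ?F" using r Ec by blast
    have r'c: "r' \<in> carrier ?F" unfolding r'_def by (rule pm_restrict_closed) (simp add: pm_closed[OF rc])
    have rj: "r j \<in> carrier R" using rc j by (rule pm_closed)
    have "r' i = \<zero>" if "j \<le> i" "i < n" for i
    proof (cases "i = j")
      case False
      then show ?thesis using that r by (simp add: r'_def E_def)
    qed (use that in \<open>simp add: r'_def\<close>)
    then have "r' \<in> E j" using r'c by (simp add: E_def)
    moreover have "r = r' \<oplus>\<^bsub>?F\<^esub> r j \<odot>\<^bsub>?F\<^esub> uvec n j"
    proof (rule pm_eqI[OF rc])
      show "r' \<oplus>\<^bsub>?F\<^esub> r j \<odot>\<^bsub>?F\<^esub> uvec n j \<in> carrier ?F"
        by (rule F.M.a_closed[OF r'c F.smult_closed[OF rj uvec_closed]])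
      fix i assume i: "i < n"
      show "r i = (r' \<oplus>\<^bsub>?F\<^esub> r j \<odot>\<^bsub>?F\<^esub> uvec n j) i"
        using rj pm_closed[OF rc i] i by (simp add: pm_simps uvec_simp r'_def)
    qed
    ultimately show ?thesis by blast
  qed
  have main: "carrier ?F \<subseteq> sat ?F ?S (msum ?F C (E (n - k)))" if "k \<le> n" for k
    using that
  proof (induction k)
    case 0
    have "carrier ?F \<subseteq> E n" by (auto simp: E_def)
    also have "\<dots> \<subseteq> msum ?F C (E n)" by (rule submodule_msum(3)[OF C Es])
    also have "\<dots> \<subseteq> sat ?F ?S (msum ?F C (E n))"
      by (rule sat_submodule(2)[OF S submodule_msum(1)[OF C Es]])
    finally show ?case by simp
  next
    case (Suc k)
    define j where "j = n - Suc k"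
    have j: "j < n" and Sj: "n - k = Suc j" using Suc.prems by (auto simp: j_def)
    have IH: "carrier ?F \<subseteq> sat ?F ?S (msum ?F C (E (Suc j)))"
      using Suc.IH Suc.prems unfolding Sj by simp
    let ?pE = "E (Suc j) \<inter> ivec p n"
    have pE: "submodule R ?pE ?F" by (rule submodule_Int[OF Es iv])
    let ?A = "msum ?F C ?pE" and ?B = "msum ?F C (E j)"
    have A: "submodule R ?A ?F" by (rule submodule_msum(1)[OF C pE])
    have B: "submodule R ?B ?F" by (rule submodule_msum(1)[OF C Es])
    \<comment> \<open>Everything is locally in \<open>C + E (Suc j)\<close>, so p times everything
      is locally in \<open>C + p E (Suc j)\<close>. The hypothesis \<open>full\<close> thereby
      improves to \<open>C + ?pE\<close>, whose second summand has no coordinates beyond j.\<close>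
    have "ivec p n \<subseteq> sat ?F ?S ?A"
    proof (rule ivec_least[OF p.is_ideal sat_submodule(1)[OF S A]])
      fix a i assume a: "a \<in> p" and i: "i < n"
      have ac: "a \<in> carrier R" by (rule p.a_Hcarr[OF a])
      have "uvec n i \<in> sat ?F ?S (msum ?F C (E (Suc j)))" by (rule subsetD[OF IH uvec_closed])
      then obtain s where s: "s \<in> ?S" "s \<odot>\<^bsub>?F\<^esub> uvec n i \<in> msum ?F C (E (Suc j))"
        unfolding sat_def by blast
      obtain c r where cr: "c \<in> C" "r \<in> E (Suc j)" "s \<odot>\<^bsub>?F\<^esub> uvec n i = c \<oplus>\<^bsub>?F\<^esub> r"
        using s(2) by (rule msumE)
      have sc: "s \<in> carrier R" using s(1) by blast
      have cc: "c \<in> carrier ?F" by (rule submoduleD(6)[OF C cr(1)])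
      have rc: "r \<in> carrier ?F" by (rule subsetD[OF Ec cr(2)])
      have "s \<odot>\<^bsub>?F\<^esub> (a \<odot>\<^bsub>?F\<^esub> uvec n i) = a \<odot>\<^bsub>?F\<^esub> (s \<odot>\<^bsub>?F\<^esub> uvec n i)"
        unfolding F.smult_assoc1[OF sc ac uvec_closed, symmetric]
          F.smult_assoc1[OF ac sc uvec_closed, symmetric] m_comm[OF sc ac] ..
      also have "\<dots> = a \<odot>\<^bsub>?F\<^esub> c \<oplus>\<^bsub>?F\<^esub> a \<odot>\<^bsub>?F\<^esub> r"
        unfolding cr(3) by (rule F.smult_r_distr[OF ac cc rc])
      also have "\<dots> \<in> ?A"
        by (rule msumI[OF submoduleD(5)[OF C ac cr(1)] IntI[OF submoduleD(5)[OF Es ac cr(2)]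
              smult_in_ivec[OF p.is_ideal a rc]]])
      finally show "a \<odot>\<^bsub>?F\<^esub> uvec n i \<in> sat ?F ?S ?A"
        using s(1) F.smult_closed[OF ac uvec_closed[of n i]] unfolding sat_def by blast
    qed
    moreover have "C \<subseteq> sat ?F ?S ?A"
      using submodule_msum(2)[OF C pE] sat_submodule(2)[OF S A] by (rule subset_trans)
    ultimately have "msum ?F C (ivec p n) \<subseteq> sat ?F ?S ?A"
      by (intro msum_least[OF sat_submodule(1)[OF S A]])
    from subset_trans[OF full sat_trans[OF S M this]] have fA: "carrier ?F \<subseteq> sat ?F ?S ?A" .
    have ej: "uvec n j \<in> sat ?F ?S ?B"
    proof -
      have "uvec n j \<in> sat ?F ?S ?A" by (rule subsetD[OF fA uvec_closed])
      then obtain t where t: "t \<in> ?S" "t \<odot>\<^bsub>?F\<^esub> uvec n j \<in> ?A" unfolding sat_def by blast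
      obtain c r where cr: "c \<in> C" "r \<in> ?pE" "t \<odot>\<^bsub>?F\<^esub> uvec n j = c \<oplus>\<^bsub>?F\<^esub> r"
        using t(2) by (rule msumE)
      obtain r' where r': "r = r' \<oplus>\<^bsub>?F\<^esub> r j \<odot>\<^bsub>?F\<^esub> uvec n j" "r' \<in> E j"
        using split[OF IntD1[OF cr(2)] j] by (rule bexE)
      have tc: "t \<in> carrier R" using t(1) by blast
      have cc: "c \<in> carrier ?F" by (rule submoduleD(6)[OF C cr(1)])
      have r'c: "r' \<in> carrier ?F" by (rule subsetD[OF Ec r'(2)])
      have rp: "r j \<in> p" using cr(2) j by (simp add: ivec_def)
      have rjc: "r j \<in> carrier R" by (rule p.a_Hcarr[OF rp])
      \<comment> \<open>The point where Nakayama's lemma works: t times unit vector j is in C up to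
        a vector r with \<open>r j\<close> in p. Moving the j-th term of r to the left changes the
        factor to \<open>t - r j\<close>, still outside p, and leaves only earlier coordinates on
        the right.\<close>
      have u: "t \<ominus> r j \<in> ?S"
      proof -
        have "t = (t \<ominus> r j) \<oplus> r j" using tc rjc by (simp add: minus_eq a_assoc l_neg)
        then have "t \<in> p" if "t \<ominus> r j \<in> p" using p.a_closed[OF that rp] by simp
        then show ?thesis using t(1) tc rjc by auto
      qed
      let ?w = "r j \<odot>\<^bsub>?F\<^esub> uvec n j"
      have wc: "?w \<in> carrier ?F" by (rule F.smult_closed[OF rjc uvec_closed])
      have "(t \<ominus> r j) \<odot>\<^bsub>?F\<^esub> uvec n j = t \<odot>\<^bsub>?F\<^esub> uvec n j \<ominus>\<^bsub>?F\<^esub> ?w"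
        using tc rjc uvec_closed[of n j]
        by (simp add: minus_eq F.M.minus_eq F.smult_l_distr F.smult_l_minus)
      also have "\<dots> = ((c \<oplus>\<^bsub>?F\<^esub> r') \<oplus>\<^bsub>?F\<^esub> ?w) \<ominus>\<^bsub>?F\<^esub> ?w"
        unfolding cr(3) F.M.a_assoc[OF cc r'c wc] arg_cong[OF r'(1), of "\<lambda>z. c \<oplus>\<^bsub>?F\<^esub> z"] ..
      also have "\<dots> = c \<oplus>\<^bsub>?F\<^esub> r'"
        by (rule F.minus_add_cancel(3)[OF wc F.M.a_closed[OF cc r'c]])
      also have "\<dots> \<in> ?B" by (rule msumI[OF cr(1) r'(2)])
      finally show ?thesis using u uvec_closed[of n j] unfolding sat_def by blast
    qed
    have "E (Suc j) \<subseteq> sat ?F ?S ?B"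
    proof
      fix r assume r: "r \<in> E (Suc j)"
      obtain r' where r': "r = r' \<oplus>\<^bsub>?F\<^esub> r j \<odot>\<^bsub>?F\<^esub> uvec n j" "r' \<in> E j"
        using split[OF r j] by (rule bexE)
      have rj: "r j \<in> carrier R" using pm_closed[OF subsetD[OF Ec r] j] .
      note sB = sat_submodule[OF S B]
      have "r' \<in> sat ?F ?S ?B" using r'(2) submodule_msum(3)[OF C Es] sB(2) by blast
      from submoduleD(4)[OF sB(1) this submoduleD(5)[OF sB(1) rj ej]]
      show "r \<in> sat ?F ?S ?B" by (subst r'(1))
    qed
    moreover have "C \<subseteq> sat ?F ?S ?B"
      using submodule_msum(2)[OF C Es] sat_submodule(2)[OF S B] by (rule subset_trans)
    ultimately have "msum ?F C (E (Suc j)) \<subseteq> sat ?F ?S ?B"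
      by (intro msum_least[OF sat_submodule(1)[OF S B]])
    from subset_trans[OF IH sat_trans[OF S M this]] show ?case unfolding j_def .
  qed
  have "E 0 \<subseteq> C"
  proof
    fix r assume r: "r \<in> E 0"
    have "r = \<zero>\<^bsub>?F\<^esub>"
      by (rule pm_eqI[OF subsetD[OF Ec r] F.M.zero_closed]) (use r in \<open>simp add: E_def pm_simps\<close>)
    then show "r \<in> C" using submoduleD(3)[OF C] by simp
  qed
  then have "msum ?F C (E 0) \<subseteq> C" by (intro msum_least[OF C]) auto
  from subset_trans[OF main[of n, simplified] sat_mono[OF this]] show ?thesis .
qed

text \<open>Let p be the annihilator of z. If f v vanishes modulo p, then f (z v) = z f v = 0, so
  some s outside p kills z v. Each s v i then annihilates z, that is, lies in p, and s can be
  cancelled.\<close>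

lemma injective_mod_Ass:
  assumes p: "p \<in> Ass" and f: "f \<in> module_hom R (power_module R c) (power_module R b)"
    and inj: "\<And>v. v \<in> carrier (power_module R c) \<Longrightarrow> f v = \<zero>\<^bsub>power_module R b\<^esub> \<Longrightarrow>
      v \<in> sat (power_module R c) (carrier R - p) {\<zero>\<^bsub>power_module R c\<^esub>}"
    and v: "v \<in> carrier (power_module R c)" "f v \<in> ivec p b"
  shows "v \<in> ivec p c"
proof -
  interpret p: primeideal p R by (rule AssD[OF p])
  interpret F: module R "power_module R c" by (rule pm_module)
  interpret G: module R "power_module R b" by (rule pm_module)
  obtain z where z: "z \<in> carrier R" "p = annR z" using p unfolding Ass_def by blast
  have fv: "f v \<in> carrier (power_module R b)" by (rule module_homD(1)[OF f v(1)])
  have zv: "z \<odot>\<^bsub>power_module R c\<^esub> v \<in> carrier (power_module R c)" by (rule F.smult_closed[OF z(1) v(1)])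
  have "f (z \<odot>\<^bsub>power_module R c\<^esub> v) = z \<odot>\<^bsub>power_module R b\<^esub> f v"
    by (rule module_homD(3)[OF f z(1) v(1)])
  also have "\<dots> = \<zero>\<^bsub>power_module R b\<^esub>"
  proof (rule pm_eqI[OF G.smult_closed[OF z(1) fv] G.M.zero_closed])
    fix i assume i: "i < b"
    have "f v i \<in> annR z" using v(2) i unfolding ivec_def z(2) by blast
    then have "f v i \<in> carrier R" "f v i \<otimes> z = \<zero>" unfolding annR_def by blast+
    then show "(z \<odot>\<^bsub>power_module R b\<^esub> f v) i = \<zero>\<^bsub>power_module R b\<^esub> i"
      using i z(1) by (simp add: pm_simps m_comm[of z])
  qed
  finally have "z \<odot>\<^bsub>power_module R c\<^esub> v \<in> sat (power_module R c) (carrier R - p) {\<zero>\<^bsub>power_module R c\<^esub>}"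
    by (rule inj[OF zv])
  then obtain s where s: "s \<in> carrier R - p"
    "s \<odot>\<^bsub>power_module R c\<^esub> (z \<odot>\<^bsub>power_module R c\<^esub> v) = \<zero>\<^bsub>power_module R c\<^esub>"
    unfolding sat_def by blast
  have sc: "s \<in> carrier R" using s(1) by blast
  have "v i \<in> p" if i: "i < c" for i
  proof -
    have vi: "v i \<in> carrier R" by (rule pm_closed[OF v(1) i])
    have "s \<otimes> (z \<otimes> v i) = \<zero>"
      using fun_cong[OF s(2), of i] unfolding pm_simps(2)[OF i] pm_simps(3)[OF i] .
    moreover have "(s \<otimes> v i) \<otimes> z = s \<otimes> (z \<otimes> v i)"
      using sc vi z(1) by (simp add: m_assoc m_comm[of "v i" z])
    ultimately have "s \<otimes> v i \<in> p" unfolding z(2) annR_def using m_closed[OF sc vi] by simp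
    then show ?thesis using p.I_prime[OF sc vi] s(1) by blast
  qed
  then show ?thesis using v(1) by (simp add: ivec_def)
qed

text \<open>With more columns than rows there would be a vector with a coordinate outside p that f
  sends to zero modulo p.\<close>

lemma injective_mod_rank_le:
  assumes p: "primeideal p R" and f: "f \<in> module_hom R (power_module R c) (power_module R b)"
    and inj: "\<And>v. v \<in> carrier (power_module R c) \<Longrightarrow> f v \<in> ivec p b \<Longrightarrow> v \<in> ivec p c"
  shows "c \<le> b"
proof (rule ccontr)
  assume "\<not> c \<le> b"
  then obtain v where v: "v \<in> carrier (power_module R c)" "\<exists>i<c. v i \<notin> p" "f v \<in> ivec p b"
    using pm_hom_dependent[OF p f] by auto
  have "v \<in> ivec p c" by (rule inj[OF v(1,3)])
  then show False using v(2) by (auto simp: ivec_def)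
qed

text \<open>The images of b unit vectors together with any x are b + 1 vectors of rank b, hence
  dependent modulo p. Injectivity forces the coefficient of x outside p, so x is locally in the
  image modulo p, and Nakayama's lemma removes the last restriction.\<close>

lemma injective_mod_surjective:
  assumes p: "primeideal p R" and f: "f \<in> module_hom R (power_module R c) (power_module R b)"
    and inj: "\<And>v. v \<in> carrier (power_module R c) \<Longrightarrow> f v \<in> ivec p b \<Longrightarrow> v \<in> ivec p c"
    and bc: "b \<le> c"
  shows "carrier (power_module R b) \<subseteq>
    sat (power_module R b) (carrier R - p) (f ` carrier (power_module R c))"
proof -
  interpret p: primeideal p R by fact
  let ?F = "power_module R b" and ?G = "power_module R c"
  interpret F: module R ?F by (rule pm_module)
  interpret G: module R ?G by (rule pm_module)
  have im: "submodule R (f ` carrier ?G) ?F"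
    by (rule submodule_image[OF G.submodule_carrier pm_module f])
  \<comment> \<open>Includes rank b into rank c by zeros: precisely b columns of f are used, so that
    adding x exceeds the number of rows by one.\<close>
  define pad where "pad = (\<lambda>v::nat \<Rightarrow> 'a. \<lambda>i\<in>{..<c}. if i < b then v i else \<zero>)"
  have padc: "pad v \<in> carrier ?G" if "v \<in> carrier ?F" for v
    unfolding pad_def by (rule pm_restrict_closed) (simp add: pm_closed[OF that])
  have padi: "i < c \<Longrightarrow> pad v i = (if i < b then v i else \<zero>)" for i v by (simp add: pad_def)
  have pad: "pad \<in> module_hom R ?F ?G"
  proof (rule module_homI)
    fix x y assume xy: "x \<in> carrier ?F" "y \<in> carrier ?F"
    show "pad (x \<oplus>\<^bsub>?F\<^esub> y) = pad x \<oplus>\<^bsub>?G\<^esub> pad y"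
      by (rule pm_eqI[OF padc[OF F.M.a_closed[OF xy]] G.M.a_closed[OF padc[OF xy(1)] padc[OF xy(2)]]])
        (simp add: padi pm_simps)
  next
    fix a x assume a: "a \<in> carrier R" and x: "x \<in> carrier ?F"
    show "pad (a \<odot>\<^bsub>?F\<^esub> x) = a \<odot>\<^bsub>?G\<^esub> pad x"
      by (rule pm_eqI[OF padc[OF F.smult_closed[OF a x]] G.smult_closed[OF a padc[OF x]]])
        (simp add: padi pm_simps a)
  qed (rule padc)
  show ?thesis
  proof (rule nakayama_local[OF p im], rule subsetI)
    fix x assume x: "x \<in> carrier ?F"
    note h = pm_hom_snoc[OF pm_module module_hom_comp[OF pad f] x]
    obtain v where v: "v \<in> carrier (power_module R (Suc b))" "\<exists>i<Suc b. v i \<notin> p"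
      "f (pad (restrict v {..<b})) \<oplus>\<^bsub>?F\<^esub> v b \<odot>\<^bsub>?F\<^esub> x \<in> ivec p b"
      using pm_hom_dependent[OF p h(1) lessI] by blast
    define w where "w = restrict v {..<b}"
    have w: "w \<in> carrier ?F" unfolding w_def by (rule pm_restrict_closed) (simp add: pm_closed[OF v(1)])
    have fw: "f (pad w) \<in> carrier ?F" by (rule module_homD(1)[OF f padc[OF w]])
    have vb: "v b \<in> carrier R" by (rule pm_closed[OF v(1)]) simp
    have vbx: "v b \<odot>\<^bsub>?F\<^esub> x \<in> carrier ?F" by (rule F.smult_closed[OF vb x])
    define u where "u = f (pad w) \<oplus>\<^bsub>?F\<^esub> v b \<odot>\<^bsub>?F\<^esub> x"
    have u: "u \<in> ivec p b" using v(3) unfolding u_def w_def .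
    have iv: "submodule R (ivec p b) ?F" by (rule ivec_submodule[OF p.is_ideal])
    \<comment> \<open>If the coefficient of x were in p, then f (pad w) would vanish modulo p, hence
      so would w, and the dependence relation would have no coefficient outside p.\<close>
    have vbp: "v b \<notin> p"
    proof
      assume vp: "v b \<in> p"
      have "u \<ominus>\<^bsub>?F\<^esub> v b \<odot>\<^bsub>?F\<^esub> x \<in> ivec p b"
        by (rule submodule_minus[OF iv u smult_in_ivec[OF p.is_ideal vp x]])
      then have "f (pad w) \<in> ivec p b" unfolding u_def F.minus_add_cancel(3)[OF vbx fw] .
      then have pw: "pad w \<in> ivec p c" by (rule inj[OF padc[OF w]])
      have "v i \<in> p" if i: "i < Suc b" for i
      proof (cases "i = b")
        case False
        then have ib: "i < b" using i by simp
        then have "pad w i \<in> p" using pw bc by (simp add: ivec_def)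
        then show ?thesis using ib bc by (simp add: padi w_def)
      qed (simp add: vp)
      then show False using v(2) by blast
    qed
    have "v b \<odot>\<^bsub>?F\<^esub> x = u \<ominus>\<^bsub>?F\<^esub> f (pad w)"
      unfolding u_def by (rule F.minus_add_cancel(4)[OF fw vbx, symmetric])
    also have "\<dots> \<in> msum ?F (f ` carrier ?G) (ivec p b)"
      by (rule submodule_minus[OF submodule_msum(1)[OF im iv]
            subsetD[OF submodule_msum(3)[OF im iv] u]
            subsetD[OF submodule_msum(2)[OF im iv] imageI[OF padc[OF w]]]])
    finally show "x \<in> sat ?F (carrier R - p) (msum ?F (f ` carrier ?G) (ivec p b))"
      using vb vbp x unfolding sat_def by blast
  qed
qed

text \<open>The element 1 stays nonzero after localization at q, so some annihilator of an element
  of \<open>R\<close> is prime and disjoint from the complement of q.\<close>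

lemma exists_Ass_below:
  assumes q: "primeideal q R"
  obtains p where "p \<in> Ass" "p \<subseteq> q"
proof -
  interpret q: primeideal q R by fact
  interpret M: module R "ring_module R" by (rule ring_module_module)
  let ?S = "carrier R - q"
  have x: "\<one> \<in> carrier (ring_module R)" by (simp add: ring_module_simps)
  have "\<one> \<notin> sat (ring_module R) ?S {\<zero>\<^bsub>ring_module R\<^esub>}"
  proof
    assume "\<one> \<in> sat (ring_module R) ?S {\<zero>\<^bsub>ring_module R\<^esub>}"
    then obtain s where s: "s \<in> ?S" "s \<otimes> \<one> = \<zero>" unfolding sat_def ring_module_simps by blast
    have sc: "s \<in> carrier R" using s(1) by blast
    have "s = \<zero>" using s(2) unfolding r_one[OF sc] .
    then show False using s(1) q.zero_closed by blast
  qed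
  then obtain y where y: "y \<in> carrier (ring_module R)"
    "primeideal (colon (ring_module R) {\<zero>\<^bsub>ring_module R\<^esub>} y) R"
    "colon (ring_module R) {\<zero>\<^bsub>ring_module R\<^esub>} y \<inter> ?S = {}"
    by (rule exists_prime_colon_below[OF noetherian_ring_module M.submodule_zero mult_set_prime[OF q] x])
  have eq: "colon (ring_module R) {\<zero>\<^bsub>ring_module R\<^esub>} y = annR y"
    unfolding colon_def annR_def ring_module_simps by blast
  have yc: "y \<in> carrier R" using y(1) by (simp only: ring_module_simps)
  have 1: "annR y \<in> Ass" unfolding Ass_def using y(2)[unfolded eq] yc by blast
  have 2: "annR y \<subseteq> q" using y(3)[unfolded eq] unfolding annR_def by blast
  show ?thesis by (rule that[OF 1 2])
qed

text \<open>Extends the rank inequality from associated primes to arbitrary ones. An associated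
  prime below q has more denominators, so local injectivity passes down to it.\<close>

lemma injective_local_rank_le:
  assumes q: "primeideal q R" and f: "f \<in> module_hom R (power_module R c) (power_module R b)"
    and inj: "\<And>v. v \<in> carrier (power_module R c) \<Longrightarrow> f v = \<zero>\<^bsub>power_module R b\<^esub> \<Longrightarrow>
      v \<in> sat (power_module R c) (carrier R - q) {\<zero>\<^bsub>power_module R c\<^esub>}"
  shows "c \<le> b"
proof -
  obtain p where p: "p \<in> Ass" "p \<subseteq> q" by (rule exists_Ass_below[OF q])
  have "v \<in> ivec p c" if "v \<in> carrier (power_module R c)" "f v \<in> ivec p b" for v
  proof (rule injective_mod_Ass[OF p(1) f _ that])
    fix w assume "w \<in> carrier (power_module R c)" "f w = \<zero>\<^bsub>power_module R b\<^esub>"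
    then have "w \<in> sat (power_module R c) (carrier R - q) {\<zero>\<^bsub>power_module R c\<^esub>}" by (rule inj)
    then show "w \<in> sat (power_module R c) (carrier R - p) {\<zero>\<^bsub>power_module R c\<^esub>}"
      by (rule subsetD[OF prime_compl_mono[OF p(2)]])
  qed
  then show ?thesis by (rule injective_mod_rank_le[OF AssD[OF p(1)] f])
qed

lemma injective_local_surjective:
  assumes p: "p \<in> Ass" and f: "f \<in> module_hom R (power_module R c) (power_module R b)"
    and inj: "\<And>v. v \<in> carrier (power_module R c) \<Longrightarrow> f v = \<zero>\<^bsub>power_module R b\<^esub> \<Longrightarrow>
      v \<in> sat (power_module R c) (carrier R - p) {\<zero>\<^bsub>power_module R c\<^esub>}"
    and bc: "b \<le> c"
  shows "carrier (power_module R b) \<subseteq>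
    sat (power_module R b) (carrier R - p) (f ` carrier (power_module R c))"
  by (rule injective_mod_surjective[OF AssD[OF p] f injective_mod_Ass[OF p f inj] bc])

section \<open>Length at a prime\<close>

text \<open>The steps of a chain have to stay proper after localization at \<open>S\<close>.\<close>

inductive chain :: "('a, 'c, 'd) module_scheme \<Rightarrow> 'a set \<Rightarrow> 'c set \<Rightarrow> 'c set \<Rightarrow> nat \<Rightarrow> bool"
  for M S K where
  chain_base: "submodule R L M \<Longrightarrow> K \<subseteq> L \<Longrightarrow> chain M S K L 0"
| chain_step: "chain M S K L n \<Longrightarrow> submodule R L' M \<Longrightarrow> L \<subseteq> L' \<Longrightarrow> \<not> L' \<subseteq> sat M S L \<Longrightarrow>
    chain M S K L' (Suc n)"

lemma chain_sub: "chain M S K L n \<Longrightarrow> submodule R L M \<and> K \<subseteq> L"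
  by (induction rule: chain.induct) auto

lemma chain_mono:
  assumes "chain M S K L n" "submodule R L' M" "L \<subseteq> L'"
  shows "chain M S K L' n"
  using assms(1)
proof cases
  case chain_base
  then show ?thesis using assms(2,3) by (auto intro: chain.chain_base)
next
  case (chain_step L0 m)
  have "\<not> L' \<subseteq> sat M S L0" using chain_step(5) assms(3) by blast
  then show ?thesis unfolding chain_step(1)
    by (rule chain.chain_step[OF chain_step(2) assms(2) subset_trans[OF chain_step(4) assms(3)]])
qed

lemma chain_lower:
  "chain M S K' L n \<Longrightarrow> K \<subseteq> K' \<Longrightarrow> chain M S K L n"
  by (induction rule: chain.induct) (auto intro: chain.intros)

lemma chain_concat:
  assumes "chain M S Q L b" "chain M S K Q a"
  shows "chain M S K L (a + b)"
  using assms(1)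
proof (induction rule: chain.induct)
  case (chain_base L)
  then show ?case using chain_mono[OF assms(2)] by simp
next
  case (chain_step L n L')
  then show ?case by (simp add: chain.chain_step)
qed

lemma chain_trivial:
  assumes "chain M S K L n" "L \<subseteq> sat M S K"
  shows "n = 0"
  using assms(1)
proof cases
  case (chain_step L0 m)
  have "K \<subseteq> L0" using chain_sub[OF chain_step(2)] by blast
  then have "sat M S K \<subseteq> sat M S L0" by (rule sat_mono)
  then show ?thesis using chain_step(5) assms(2) by blast
qed simp

text \<open>The modular law after localization: nested submodules with locally equal intersection
  and locally equal sum with Q are locally equal. From s x = c + q with c in L, the difference q
  lies in L' and Q, hence locally in L.\<close>

lemma sat_modular:
  assumes S: "mult_set S" and L: "submodule R L M" and L': "submodule R L' M" and Q: "submodule R Q M"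
    and "L \<subseteq> L'" and int: "L' \<inter> Q \<subseteq> sat M S (L \<inter> Q)" and sum: "msum M L' Q \<subseteq> sat M S (msum M L Q)"
  shows "L' \<subseteq> sat M S L"
proof
  interpret M: module R M by (rule submoduleD[OF L])
  fix x assume x: "x \<in> L'"
  have xc: "x \<in> carrier M" by (rule submoduleD(6)[OF L' x])
  have "x \<in> msum M L' Q" by (rule subsetD[OF submodule_msum(2)[OF L' Q] x])
  then have "x \<in> sat M S (msum M L Q)" by (rule subsetD[OF sum])
  then obtain s where s: "s \<in> S" "s \<odot>\<^bsub>M\<^esub> x \<in> msum M L Q" unfolding sat_def by blast
  have sc: "s \<in> carrier R" by (rule mult_setD(1)[OF S s(1)])
  obtain c q where cq: "c \<in> L" "q \<in> Q" "s \<odot>\<^bsub>M\<^esub> x = c \<oplus>\<^bsub>M\<^esub> q" using s(2) by (rule msumE)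
  have cc: "c \<in> carrier M" by (rule submoduleD(6)[OF L cq(1)])
  have qc: "q \<in> carrier M" by (rule submoduleD(6)[OF Q cq(2)])
  have "s \<odot>\<^bsub>M\<^esub> x \<ominus>\<^bsub>M\<^esub> c \<in> L'"
    by (rule submodule_minus[OF L' submoduleD(5)[OF L' sc x] subsetD[OF assms(5) cq(1)]])
  then have "q \<in> L'" unfolding cq(3) M.minus_add_cancel(4)[OF cc qc] .
  then have "q \<in> sat M S (L \<inter> Q)" using int cq(2) by blast
  then have "q \<in> sat M S L" by (rule subsetD[OF sat_mono[OF Int_lower1]])
  note sL = sat_submodule[OF S L]
  have "s \<odot>\<^bsub>M\<^esub> x \<in> sat M S L"
    unfolding cq(3) by (rule submoduleD(4)[OF sL(1) subsetD[OF sL(2) cq(1)]]) fact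
  then show "x \<in> sat M S L" by (rule sat_cancel[OF S M.module_axioms xc s(1)])
qed

text \<open>Each step of a chain remains proper either in its intersections with Q or in its sums
  with Q, by the modular law. This is the upper bound in the additivity of length.\<close>

lemma chain_split:
  assumes S: "mult_set S" and Q: "submodule R Q M" and KQ: "K \<subseteq> Q" and ch: "chain M S K L n"
  shows "\<exists>a b. n \<le> a + b \<and> chain M S K (L \<inter> Q) a \<and> chain M S Q (msum M L Q) b"
  using ch
proof (induction rule: chain.induct)
  case (chain_base L)
  have "chain M S K (L \<inter> Q) 0" "chain M S Q (msum M L Q) 0"
    using chain_base KQ submodule_Int[OF _ Q] submodule_msum[OF _ Q] by (blast intro: chain.chain_base)+
  then show ?case by blast
next
  case (chain_step L n L')
  obtain a b where ab: "n \<le> a + b" "chain M S K (L \<inter> Q) a" "chain M S Q (msum M L Q) b"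
    using chain_step.IH by blast
  have sL: "submodule R L M" using chain_sub[OF chain_step.hyps(1)] by blast
  note sL' = chain_step.hyps(2)
  have i: "submodule R (L' \<inter> Q) M" by (rule submodule_Int[OF sL' Q])
  have m: "submodule R (msum M L' Q) M" by (rule submodule_msum(1)[OF sL' Q])
  have ii: "L \<inter> Q \<subseteq> L' \<inter> Q" using chain_step.hyps(3) by blast
  have mm: "msum M L Q \<subseteq> msum M L' Q" by (rule msum_mono[OF chain_step.hyps(3) subset_refl])
  show ?case
  proof (cases "L' \<inter> Q \<subseteq> sat M S (L \<inter> Q)")
    case False
    have "chain M S K (L' \<inter> Q) (Suc a)" by (rule chain.chain_step[OF ab(2) i ii False])
    moreover have "chain M S Q (msum M L' Q) b" by (rule chain_mono[OF ab(3) m mm])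
    moreover have "Suc n \<le> Suc a + b" using ab(1) by simp
    ultimately show ?thesis by blast
  next
    case True
    have "\<not> msum M L' Q \<subseteq> sat M S (msum M L Q)"
      using sat_modular[OF S sL sL' Q chain_step.hyps(3) True] chain_step.hyps(4) by blast
    then have "chain M S Q (msum M L' Q) (Suc b)" by (rule chain.chain_step[OF ab(3) m mm])
    moreover have "chain M S K (L' \<inter> Q) a" by (rule chain_mono[OF ab(2) i ii])
    moreover have "Suc n \<le> a + Suc b" using ab(1) by simp
    ultimately show ?thesis by blast
  qed
qed

text \<open>Since all members of the chain contain the kernel, a relation s f x = f c in the image
  lifts to s x being in the same member as c. So steps stay proper.\<close>

lemma chain_image:
  assumes S: "mult_set S" and N: "module R N" and f: "f \<in> module_hom R M N"
    and ker: "\<And>x. x \<in> carrier M \<Longrightarrow> f x = \<zero>\<^bsub>N\<^esub> \<Longrightarrow> x \<in> K" and ch: "chain M S K L n"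
  shows "chain N S (f ` K) (f ` L) n"
  using ch
proof (induction rule: chain.induct)
  case (chain_base L)
  show ?case
    by (rule chain.chain_base[OF submodule_image[OF chain_base(1) N f] image_mono[OF chain_base(2)]])
next
  case (chain_step L n L')
  have sL: "submodule R L M" and KL: "K \<subseteq> L" using chain_sub[OF chain_step.hyps(1)] by blast+
  note sL' = chain_step.hyps(2)
  interpret M: module R M by (rule submoduleD[OF sL])
  interpret N: module R N by fact
  have "\<not> f ` L' \<subseteq> sat N S (f ` L)"
  proof
    assume a: "f ` L' \<subseteq> sat N S (f ` L)"
    have "L' \<subseteq> sat M S L"
    proof
      fix x assume x: "x \<in> L'"
      have xc: "x \<in> carrier M" by (rule submoduleD(6)[OF sL' x])
      obtain s where s: "s \<in> S" "s \<odot>\<^bsub>N\<^esub> f x \<in> f ` L"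
        using subsetD[OF a imageI[OF x]] unfolding sat_def by blast
      have sc: "s \<in> carrier R" by (rule mult_setD(1)[OF S s(1)])
      obtain c where c: "s \<odot>\<^bsub>N\<^esub> f x = f c" "c \<in> L" using s(2) by (rule imageE)
      have cc: "c \<in> carrier M" by (rule submoduleD(6)[OF sL c(2)])
      have sx: "s \<odot>\<^bsub>M\<^esub> x \<in> carrier M" by (rule M.smult_closed[OF sc xc])
      have "f (s \<odot>\<^bsub>M\<^esub> x) = f c" unfolding module_homD(3)[OF f sc xc] by (rule c(1))
      then have "f (s \<odot>\<^bsub>M\<^esub> x \<ominus>\<^bsub>M\<^esub> c) = \<zero>\<^bsub>N\<^esub>"
        unfolding module_hom_zero_minus(3)[OF M.module_axioms N f sx cc]
        using module_homD(1)[OF f cc] by (simp add: N.M.minus_eq N.M.r_neg)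
      then have "s \<odot>\<^bsub>M\<^esub> x \<ominus>\<^bsub>M\<^esub> c \<in> L" by (rule subsetD[OF KL ker[OF M.M.minus_closed[OF sx cc]]])
      from submoduleD(4)[OF sL c(2) this] have "s \<odot>\<^bsub>M\<^esub> x \<in> L"
        unfolding M.minus_add_cancel(1)[OF cc sx] .
      then show "x \<in> sat M S L" using xc s(1) unfolding sat_def by blast
    qed
    then show False using chain_step.hyps(4) by blast
  qed
  then show ?case
    by (rule chain.chain_step[OF chain_step.IH submodule_image[OF sL' N f] image_mono[OF chain_step.hyps(3)]])
qed

text \<open>The members lie in the image of f, so an element that violates properness downstairs has
  a preimage that does so upstairs.\<close>

lemma chain_preimage:
  assumes S: "mult_set S" and M: "module R M" and f: "f \<in> module_hom R M N" and K: "K \<subseteq> carrier M"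
    and ch: "chain N S (f ` K) D n"
  shows "D \<subseteq> f ` carrier M \<Longrightarrow> chain M S K {x \<in> carrier M. f x \<in> D} n"
  using ch
proof (induction rule: chain.induct)
  case (chain_base D)
  show ?case
    by (rule chain.chain_base[OF submodule_preimage[OF M f chain_base(1)]]) (use K chain_base(2) in blast)
next
  case (chain_step D n D')
  have IH: "chain M S K {x \<in> carrier M. f x \<in> D} n"
    by (rule chain_step.IH[OF subset_trans[OF chain_step.hyps(3) chain_step.prems]])
  have "\<not> {x \<in> carrier M. f x \<in> D'} \<subseteq> sat M S {x \<in> carrier M. f x \<in> D}"
  proof
    assume a: "{x \<in> carrier M. f x \<in> D'} \<subseteq> sat M S {x \<in> carrier M. f x \<in> D}"
    have "D' \<subseteq> sat N S D"
    proof
      fix y assume y: "y \<in> D'"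
      obtain x where x: "y = f x" "x \<in> carrier M" using subsetD[OF chain_step.prems y] by (rule imageE)
      have "x \<in> sat M S {x \<in> carrier M. f x \<in> D}" using a y x by blast
      then obtain s where s: "s \<in> S" "f (s \<odot>\<^bsub>M\<^esub> x) \<in> D" unfolding sat_def by blast
      have "s \<odot>\<^bsub>N\<^esub> y \<in> D"
        using s(2) unfolding module_homD(3)[OF f mult_setD(1)[OF S s(1)] x(2)] x(1) .
      moreover have "y \<in> carrier N" unfolding x(1) by (rule module_homD(1)[OF f x(2)])
      ultimately show "y \<in> sat N S D" using s(1) unfolding sat_def by blast
    qed
    then show False using chain_step.hyps(4) by blast
  qed
  moreover have "{x \<in> carrier M. f x \<in> D} \<subseteq> {x \<in> carrier M. f x \<in> D'}"
    using chain_step.hyps(3) by blast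
  ultimately show ?case
    using chain.chain_step[OF IH submodule_preimage[OF M f chain_step.hyps(2)]] by blast
qed

text \<open>The length of L / K after localization at S. As a relation it carries the finiteness of
  the length, which has to be proved in each case.\<close>

definition has_length :: "('a, 'c, 'd) module_scheme \<Rightarrow> 'a set \<Rightarrow> 'c set \<Rightarrow> 'c set \<Rightarrow> nat \<Rightarrow> bool" where
  "has_length M S K L n \<longleftrightarrow> chain M S K L n \<and> (\<forall>m. chain M S K L m \<longrightarrow> m \<le> n)"

lemma has_lengthD:
  assumes "has_length M S K L n"
  shows "chain M S K L n" "\<And>m. chain M S K L m \<Longrightarrow> m \<le> n"
  using assms by (simp_all add: has_length_def)

lemma has_length_unique: "has_length M S K L m \<Longrightarrow> has_length M S K L n \<Longrightarrow> m = n"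
  unfolding has_length_def by (simp add: le_antisym)

lemma has_length_exists:
  assumes "\<And>n. chain M S K L n \<Longrightarrow> n \<le> B" "submodule R L M" "K \<subseteq> L"
  shows "\<exists>n. has_length M S K L n"
proof -
  let ?A = "{n. chain M S K L n}"
  have fin: "finite ?A" by (rule finite_subset[of _ "{..B}"]) (use assms(1) in auto)
  have ne: "?A \<noteq> {}" using chain_base[OF assms(2,3)] by blast
  have "has_length M S K L (Max ?A)"
    using Max_in[OF fin ne] Max_ge[OF fin] by (simp add: has_length_def)
  then show ?thesis ..
qed

lemma has_length_sub:
  assumes "has_length M S K L n" "K \<subseteq> K'" "K' \<subseteq> L'" "L' \<subseteq> L" "submodule R L' M" "submodule R L M"
  shows "\<exists>m. has_length M S K' L' m"
proof (rule has_length_exists[OF _ assms(5,3)])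
  fix m assume "chain M S K' L' m"
  from chain_mono[OF chain_lower[OF this assms(2)] assms(6,4)] show "m \<le> n"
    by (rule has_lengthD(2)[OF assms(1)])
qed

text \<open>Concatenation of chains bounds the length from below, splitting them along Q bounds it
  from above.\<close>

lemma has_length_add:
  assumes S: "mult_set S" and a: "has_length M S K Q a" and b: "has_length M S Q L b"
  shows "has_length M S K L (a + b)"
proof -
  have Q: "submodule R Q M" and KQ: "K \<subseteq> Q" using chain_sub[OF has_lengthD(1)[OF a]] by blast+
  have L: "submodule R L M" and QL: "Q \<subseteq> L" using chain_sub[OF has_lengthD(1)[OF b]] by blast+
  have "m \<le> a + b" if m: "chain M S K L m" for m
  proof -
    obtain a' b' where ab: "m \<le> a' + b'" "chain M S K (L \<inter> Q) a'" "chain M S Q (msum M L Q) b'"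
      using chain_split[OF S Q KQ m] by blast
    have "L \<inter> Q = Q" using QL by blast
    then have "a' \<le> a" using has_lengthD(2)[OF a] ab(2) by simp
    moreover have "b' \<le> b"
      by (rule has_lengthD(2)[OF b chain_mono[OF ab(3) L msum_least[OF L subset_refl QL]]])
    ultimately show ?thesis using ab(1) by simp
  qed
  then show ?thesis
    using chain_concat[OF has_lengthD(1)[OF b] has_lengthD(1)[OF a]] by (simp add: has_length_def)
qed

section \<open>Finite length of modules that are torsion for a prime\<close>

lemma prime_pow:
  assumes p: "primeideal p R" and a: "a \<in> carrier R" "a [^] (k::nat) \<in> p"
  shows "a \<in> p"
  using a(2)
proof (induction k)
  interpret p: primeideal p R by fact
  case 0
  then show ?case using p.one_imp_carrier p.I_notcarr by simp
next
  interpret p: primeideal p R by fact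
  case (Suc k)
  then show ?case using p.I_prime[of "a [^] k" a] a(1) by auto
qed

text \<open>The denominators for the localization at p with a inverted as well. An element vanishes
  there exactly if, locally at p, some power of a kills it.\<close>

definition pows :: "'a set \<Rightarrow> 'a \<Rightarrow> 'a set" where
  "pows p a = {s \<otimes> a [^] (k::nat) | s k. s \<in> carrier R - p}"

lemma mult_set_pows:
  assumes p: "primeideal p R" and a: "a \<in> carrier R"
  shows "mult_set (pows p a)" "carrier R - p \<subseteq> pows p a" "a \<in> pows p a"
proof -
  note S = mult_setD[OF mult_set_prime[OF p]]
  show sub: "carrier R - p \<subseteq> pows p a"
  proof
    fix s assume s: "s \<in> carrier R - p"
    have "s = s \<otimes> a [^] (0::nat)" using s by simp
    then show "s \<in> pows p a" using s unfolding pows_def by blast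
  qed
  have "a = \<one> \<otimes> a [^] (1::nat)" using a by simp
  then show "a \<in> pows p a" using S(2) unfolding pows_def by blast
  show "mult_set (pows p a)" unfolding mult_set_def
  proof (intro conjI ballI)
    show "pows p a \<subseteq> carrier R" using a unfolding pows_def by auto
    show "\<one> \<in> pows p a" by (rule subsetD[OF sub S(2)])
    fix x y assume "x \<in> pows p a" "y \<in> pows p a"
    then obtain s t and k l :: nat where st: "s \<in> carrier R - p" "t \<in> carrier R - p"
      and xy: "x = s \<otimes> a [^] k" "y = t \<otimes> a [^] l" unfolding pows_def by blast
    have c: "s \<in> carrier R" "t \<in> carrier R" using st by blast+
    have "x \<otimes> y = (s \<otimes> t) \<otimes> a [^] (k + l)"
      unfolding xy using c a by (simp add: nat_pow_mult[symmetric] m_ac)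
    then show "x \<otimes> y \<in> pows p a" using S(3)[OF st] unfolding pows_def by blast
  qed
qed

text \<open>Take D maximal with finite local length over C. If D is not locally everything, a prime
  colon ideal of its saturation exists at some y; torsion forces this prime to be p, and D + R y has
  local length one over D because its quotient is locally the residue field at p. This contradicts
  maximality.\<close>

lemma has_length_torsion:
  assumes M: "noetherian_module R M" and p: "primeideal p R" and C: "submodule R C M"
    and tor: "\<And>x a. x \<in> carrier M \<Longrightarrow> a \<in> p \<Longrightarrow> x \<in> sat M (pows p a) C"
  shows "\<exists>n. has_length M (carrier R - p) C (carrier M) n"
proof -
  interpret p: primeideal p R by fact
  interpret M: module R M by (rule submoduleD[OF C])
  let ?S = "carrier R - p"
  have S: "mult_set ?S" by (rule mult_set_prime[OF p])
  let ?P = "\<lambda>D. C \<subseteq> D \<and> submodule R D M \<and> (\<exists>n. has_length M ?S C D n)"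
  have "\<exists>D. ?P D \<and> (\<forall>D'. ?P D' \<longrightarrow> D \<subseteq> D' \<longrightarrow> D' = D)"
  proof (rule noetherian_module_maximal[OF M, of ?P C])
    have "has_length M ?S C C 0"
      unfolding has_length_def
      using chain_base[OF C subset_refl] chain_trivial[OF _ sat_submodule(2)[OF S C]] by auto
    then show "?P C" using C by blast
  qed blast
  then obtain D where "?P D \<and> (\<forall>D'. ?P D' \<longrightarrow> D \<subseteq> D' \<longrightarrow> D' = D)" by (rule exE)
  note D = conjunct1[OF this] and max = conjunct2[OF this]
  have CD: "C \<subseteq> D" and sD: "submodule R D M" using D by blast+
  obtain n where n: "has_length M ?S C D n" using D by blast
  note satD = sat_submodule[OF S sD]
  show ?thesis
  proof (cases "carrier M \<subseteq> sat M ?S D")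
    case True
    have "has_length M ?S D (carrier M) 0"
      unfolding has_length_def
      using chain_base[OF M.submodule_carrier submoduleD(2)[OF sD]] chain_trivial[OF _ True] by auto
    from has_length_add[OF S n this] show ?thesis by blast
  next
    case False
    then obtain x where x: "x \<in> carrier M" "x \<notin> sat M ?S D" by blast
    obtain y where y: "y \<in> carrier M" "y \<notin> sat M ?S D" "primeideal (colon M (sat M ?S D) y) R"
      by (rule exists_prime_colon[OF satD(1) x])
    define P where "P = colon M (sat M ?S D) y"
    interpret P: primeideal P R unfolding P_def by (rule y(3))
    have Pp: "P \<subseteq> p"
    proof
      fix a assume "a \<in> P"
      then have a: "a \<in> carrier R" "a \<odot>\<^bsub>M\<^esub> y \<in> sat M ?S D" unfolding P_def colon_def by blast+
      show "a \<in> p"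
      proof (rule ccontr)
        assume "a \<notin> p"
        then have "y \<in> sat M ?S D" using sat_cancel[OF S M.module_axioms y(1) _ a(2)] a(1) by blast
        then show False using y(2) by blast
      qed
    qed
    \<comment> \<open>Torsion puts some product of s outside p and a power of a into P. As P lies in
      p, the factor s is outside P, so the power and then a itself are in P.\<close>
    have pP: "p \<subseteq> P"
    proof
      fix a assume a: "a \<in> p"
      have ac: "a \<in> carrier R" by (rule p.a_Hcarr[OF a])
      obtain u where u: "u \<in> pows p a" "u \<odot>\<^bsub>M\<^esub> y \<in> C" using tor[OF y(1) a] unfolding sat_def by blast
      obtain s and k :: nat where s: "s \<in> ?S" "u = s \<otimes> a [^] k" using u(1) unfolding pows_def by blast
      have "u \<odot>\<^bsub>M\<^esub> y \<in> sat M ?S D" using u(2) CD satD(2) by blast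
      then have "s \<otimes> a [^] k \<in> P"
        using s ac unfolding P_def colon_def by auto
      then have "a [^] k \<in> P" using P.I_prime[of s "a [^] k"] s(1) ac Pp by auto
      then show "a \<in> P" by (rule prime_pow[OF P.primeideal_axioms ac])
    qed
    note cy = M.submodule_cyc[OF y(1)]
    let ?D' = "msum M D (cyc R M y)"
    note D' = submodule_msum[OF sD cy(1)]
    have yD': "y \<in> ?D'" by (rule subsetD[OF D'(3) cy(2)])
    have "\<not> ?D' \<subseteq> sat M ?S D" using yD' y(2) by blast
    then have c1: "chain M ?S D ?D' (Suc 0)"
      by (rule chain_step[OF chain_base[OF sD subset_refl] D'(1,2)])
    \<comment> \<open>In a chain with two steps the middle member E1 contains some d + r y that is
      not locally in D. Then r is outside p, and r y lies in E1, so y is locally in E1 and the last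
      step is not proper.\<close>
    have "m \<le> 1" if m: "chain M ?S D ?D' m" for m
    proof (rule ccontr)
      assume "\<not> m \<le> 1"
      then obtain k where "m = Suc (Suc k)" by (metis One_nat_def Suc_le_D not_less_eq_eq le_0_eq nat.exhaust zero_le)
      with m have "chain M ?S D ?D' (Suc (Suc k))" by simp
      then obtain E1 where E1: "chain M ?S D E1 (Suc k)" "E1 \<subseteq> ?D'" "\<not> ?D' \<subseteq> sat M ?S E1"
        by cases auto
      from E1(1) obtain E0 where E0: "chain M ?S D E0 k" "submodule R E1 M" "\<not> E1 \<subseteq> sat M ?S E0"
        by cases auto
      have DE0: "D \<subseteq> E0" and DE1: "D \<subseteq> E1" using chain_sub[OF E0(1)] chain_sub[OF E1(1)] by blast+
      obtain e where e: "e \<in> E1" "e \<notin> sat M ?S D" using E0(3) sat_mono[OF DE0] by blast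
      obtain d w where dw: "d \<in> D" "w \<in> cyc R M y" "e = d \<oplus>\<^bsub>M\<^esub> w"
        using subsetD[OF E1(2) e(1)] by (rule msumE)
      obtain r where r: "r \<in> carrier R" "w = r \<odot>\<^bsub>M\<^esub> y" using dw(2) unfolding cyc_def by blast
      have dc: "d \<in> carrier M" by (rule submoduleD(6)[OF sD dw(1)])
      have wc: "w \<in> carrier M" unfolding r(2) by (rule M.smult_closed[OF r(1) y(1)])
      have "r \<notin> p"
      proof
        assume "r \<in> p"
        then have "r \<in> P" by (rule subsetD[OF pP])
        then have "w \<in> sat M ?S D" unfolding r(2) P_def colon_def by blast
        then have "e \<in> sat M ?S D"
          unfolding dw(3) by (rule submoduleD(4)[OF satD(1) subsetD[OF satD(2) dw(1)]])
        then show False using e(2) by blast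
      qed
      moreover have "r \<odot>\<^bsub>M\<^esub> y \<in> E1"
      proof -
        have "e \<ominus>\<^bsub>M\<^esub> d \<in> E1" by (rule submodule_minus[OF E0(2) e(1) subsetD[OF DE1 dw(1)]])
        then have "w \<in> E1" unfolding dw(3) M.minus_add_cancel(4)[OF dc wc] .
        then show ?thesis unfolding r(2) .
      qed
      ultimately have yE: "y \<in> sat M ?S E1" using r(1) y(1) unfolding sat_def by blast
      note sE = sat_submodule[OF S E0(2)]
      have "?D' \<subseteq> sat M ?S E1"
        by (rule msum_least[OF sE(1) subset_trans[OF DE1 sE(2)] cyc_least[OF sE(1) yE]])
      then show False using E1(3) by blast
    qed
    then have "has_length M ?S D ?D' 1" using c1 unfolding has_length_def by simp
    note l = has_length_add[OF S n this]
    have "?P ?D'" by (intro conjI exI) (rule subset_trans[OF CD D'(2)], rule D'(1), rule l)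
    from max[rule_format, OF this D'(2)] have "y \<in> D" using yD' by (rule subst)
    then have "y \<in> sat M ?S D" by (rule subsetD[OF satD(2)])
    then show ?thesis using y(2) by blast
  qed
qed

lemma noetherian_submodule:
  assumes M: "noetherian_module R M" and L: "submodule R L M"
  shows "noetherian_module R (M\<lparr>carrier := L\<rparr>)"
    "submodule R N (M\<lparr>carrier := L\<rparr>) \<longleftrightarrow> submodule R N M \<and> N \<subseteq> L"
proof -
  interpret M: module R M by (rule submoduleD[OF L])
  have mL: "module R (M\<lparr>carrier := L\<rparr>)" by (rule M.submodule_is_module[OF L])
  have iff: "submodule R N (M\<lparr>carrier := L\<rparr>) \<longleftrightarrow> submodule R N M \<and> N \<subseteq> L" for N
    using mL M.module_axioms submoduleD(2)[OF L] unfolding submodule_def by auto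
  show "submodule R N (M\<lparr>carrier := L\<rparr>) \<longleftrightarrow> submodule R N M \<and> N \<subseteq> L" by (rule iff)
  show "noetherian_module R (M\<lparr>carrier := L\<rparr>)"
    using M mL unfolding noetherian_module_def iff by blast
qed

text \<open>Finite length is proved for whole modules; this carries it to a submodule N regarded
  inside M.\<close>

lemma chain_in_submodule:
  assumes N: "submodule R N M" and ch: "chain M S K L n"
  shows "L \<subseteq> N \<Longrightarrow> chain (M\<lparr>carrier := N\<rparr>) S K L n"
  using ch
proof (induction rule: chain.induct)
  interpret M: module R M by (rule submoduleD[OF N])
  have mN: "module R (M\<lparr>carrier := N\<rparr>)" by (rule M.submodule_is_module[OF N])
  have sub: "submodule R L (M\<lparr>carrier := N\<rparr>)" if "submodule R L M" "L \<subseteq> N" for L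
    using mN that unfolding submodule_def by auto
  {
    case (chain_base L)
    then show ?case using sub by (blast intro: chain.chain_base)
  next
    case (chain_step L n L')
    have 1: "chain (M\<lparr>carrier := N\<rparr>) S K L n"
      by (rule chain_step.IH[OF subset_trans[OF chain_step.hyps(3) chain_step.prems]])
    have 2: "\<not> L' \<subseteq> sat (M\<lparr>carrier := N\<rparr>) S L"
      using chain_step.hyps(4) submoduleD(2)[OF N] unfolding sat_def by auto
    show ?case
      by (rule chain.chain_step[OF 1 sub[OF chain_step.hyps(2) chain_step.prems] chain_step.hyps(3) 2])
  }
qed

text \<open>Length is invariant under the isomorphism of L / K with f L / f K, which holds as K
  contains the kernel.\<close>

lemma chain_hom_iff:
  assumes S: "mult_set S" and N: "module R N" and f: "f \<in> module_hom R M N"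
    and ker: "\<And>x. x \<in> carrier M \<Longrightarrow> f x = \<zero>\<^bsub>N\<^esub> \<Longrightarrow> x \<in> K" and KL: "K \<subseteq> L" and L: "submodule R L M"
  shows "chain M S K L n \<longleftrightarrow> chain N S (f ` K) (f ` L) n"
proof
  assume ch: "chain M S K L n"
  show "chain N S (f ` K) (f ` L) n" by (rule chain_image[OF S N f _ ch]) (rule ker)
next
  interpret M: module R M by (rule submoduleD[OF L])
  interpret N: module R N by fact
  note LD = submoduleD[OF L]
  assume ch: "chain N S (f ` K) (f ` L) n"
  have "{x \<in> carrier M. f x \<in> f ` L} = L"
  proof (intro equalityI subsetI)
    fix x assume "x \<in> {x \<in> carrier M. f x \<in> f ` L}"
    then have x: "x \<in> carrier M" "f x \<in> f ` L" by blast+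
    obtain y where y: "f x = f y" "y \<in> L" using x(2) by (rule imageE)
    have yc: "y \<in> carrier M" by (rule LD(6)[OF y(2)])
    have "f (x \<ominus>\<^bsub>M\<^esub> y) = \<zero>\<^bsub>N\<^esub>"
      unfolding module_hom_zero_minus(3)[OF M.module_axioms N f x(1) yc] y(1)
      using module_homD(1)[OF f yc] by (simp add: N.M.minus_eq N.M.r_neg)
    then have "x \<ominus>\<^bsub>M\<^esub> y \<in> L" using ker[OF M.M.minus_closed[OF x(1) yc]] KL by blast
    from LD(4)[OF y(2) this] show "x \<in> L" unfolding M.minus_add_cancel(1)[OF yc x(1)] .
  next
    fix x assume "x \<in> L"
    then show "x \<in> {x \<in> carrier M. f x \<in> f ` L}" using LD(2) by blast
  qed
  then show "chain M S K L n"
    using chain_preimage[OF S M.module_axioms f subset_trans[OF KL LD(2)] ch image_mono[OF LD(2)]]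
    by simp
qed

text \<open>If inverting a left something of M / C, a prime colon ideal P would miss
  \<open>pows p a\<close>. It would lie in p and omit a, so be strictly smaller than p, yet the
  class of y survives at P, against the assumption on primes below p.\<close>

lemma torsion_of_support:
  assumes M: "noetherian_module R M" and C: "submodule R C M" and p: "primeideal p R" and a: "a \<in> p"
    and sup: "\<And>q. primeideal q R \<Longrightarrow> q \<subset> p \<Longrightarrow> carrier M \<subseteq> sat M (carrier R - q) C"
    and x: "x \<in> carrier M"
  shows "x \<in> sat M (pows p a) C"
proof (rule ccontr)
  interpret p: primeideal p R by fact
  assume nx: "x \<notin> sat M (pows p a) C"
  note S = mult_set_pows[OF p p.a_Hcarr[OF a]]
  obtain y where y: "y \<in> carrier M" "primeideal (colon M C y) R" "colon M C y \<inter> pows p a = {}"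
    by (rule exists_prime_colon_below[OF M C S(1) x nx])
  define P where "P = colon M C y"
  interpret P: primeideal P R unfolding P_def by (rule y(2))
  have P: "P \<inter> pows p a = {}" unfolding P_def by (rule y(3))
  have "P \<subseteq> p"
  proof
    fix c assume c: "c \<in> P"
    have "c \<notin> carrier R - p" using c P S(2) by blast
    then show "c \<in> p" using P.a_Hcarr[OF c] by blast
  qed
  moreover have "a \<notin> P" using P S(3) by blast
  ultimately have "P \<subset> p" using a by blast
  from subsetD[OF sup[OF P.primeideal_axioms this] y(1)]
  obtain s where s: "s \<in> carrier R - P" "s \<odot>\<^bsub>M\<^esub> y \<in> C" unfolding sat_def by blast
  then have "s \<in> P" unfolding P_def colon_def by blast
  then show False using s(1) by blast
qed

text \<open>With \<open>N\<close> the \<open>p\<close>-power torsion of \<open>F\<close>, the endomorphism \<open>f\<close> of \<open>N\<close> has kernel and cokernel of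
  equal length, and \<open>N / f N\<close> embeds properly into \<open>F / f F\<close>: if \<open>F = f F + N\<close> locally, then Nakayama
  applies because \<open>N \<subseteq> p F\<close> for non-minimal \<open>p\<close>.\<close>

lemma length_descent:
  fixes n :: nat
  defines "F \<equiv> power_module R n"
  assumes p: "primeideal p R" and q: "primeideal q R" "q \<subset> p" and f: "f \<in> module_hom R F F"
    and torF: "\<And>x a. x \<in> carrier F \<Longrightarrow> a \<in> p \<Longrightarrow> x \<in> sat F (pows p a) (f ` carrier F)"
    and torK: "\<And>x a. x \<in> carrier F \<Longrightarrow> f x = \<zero>\<^bsub>F\<^esub> \<Longrightarrow> a \<in> p \<Longrightarrow> x \<in> sat F (pows p a) {\<zero>\<^bsub>F\<^esub>}"
    and ne: "\<not> carrier F \<subseteq> sat F (carrier R - p) (f ` carrier F)"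
  shows "\<exists>l0 l1. has_length F (carrier R - p) (f ` carrier F) (carrier F) l0 \<and>
    has_length F (carrier R - p) {\<zero>\<^bsub>F\<^esub>} {x \<in> carrier F. f x = \<zero>\<^bsub>F\<^esub>} l1 \<and> l1 < l0"
proof -
  interpret p: primeideal p R by fact
  interpret q: primeideal q R by fact
  have M: "module R F" unfolding F_def by (rule pm_module)
  interpret F: module R F by (rule M)
  have nM: "noetherian_module R F" unfolding F_def by (rule noetherian_power_module)
  let ?S = "carrier R - p" and ?z = "{\<zero>\<^bsub>F\<^esub>}"
  have S: "mult_set ?S" by (rule mult_set_prime[OF p])
  note Sa = mult_set_pows[OF p p.a_Hcarr]
  define K where "K = {x \<in> carrier F. f x = \<zero>\<^bsub>F\<^esub>}"
  define N where "N = {x \<in> carrier F. \<forall>a\<in>p. x \<in> sat F (pows p a) ?z}"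
  have K: "submodule R K F"
    using submodule_preimage[OF M f F.submodule_zero] unfolding K_def by simp
  have zs: "submodule R (sat F (pows p a) ?z) F" if "a \<in> p" for a
    by (rule sat_submodule(1)[OF Sa(1)[OF that] F.submodule_zero])
  have N: "submodule R N F"
  proof (rule submodule.intro[OF M])
    show "N \<subseteq> carrier F" unfolding N_def by blast
    show "\<zero>\<^bsub>F\<^esub> \<in> N" unfolding N_def using submoduleD(3)[OF zs] F.M.zero_closed by blast
    show "v \<oplus>\<^bsub>F\<^esub> w \<in> N" if "v \<in> N" "w \<in> N" for v w
      using that submoduleD(4)[OF zs] F.M.a_closed unfolding N_def by blast
    show "c \<odot>\<^bsub>F\<^esub> v \<in> N" if "c \<in> carrier R" "v \<in> N" for c v
      using that submoduleD(5)[OF zs] F.smult_closed unfolding N_def by blast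
  qed
  note ND = submoduleD[OF N]
  have KN: "K \<subseteq> N" using torK unfolding K_def N_def by blast
  have im: "submodule R (f ` carrier F) F" by (rule submodule_image[OF F.submodule_carrier M f])
  have fN: "submodule R (f ` N) F" by (rule submodule_image[OF N M f])
  have f0: "f \<zero>\<^bsub>F\<^esub> = \<zero>\<^bsub>F\<^esub>" by (rule module_hom_zero_minus(1)[OF M M f])
  have fc: "\<And>x. x \<in> carrier F \<Longrightarrow> f x \<in> carrier F" by (rule module_homD(1)[OF f])
  have fNN: "f ` N \<subseteq> N"
  proof
    fix y assume "y \<in> f ` N"
    then obtain x where x: "y = f x" "x \<in> N" by (rule imageE)
    have xc: "x \<in> carrier F" by (rule ND(6)[OF x(2)])
    have "f x \<in> sat F (pows p a) ?z" if a: "a \<in> p" for a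
    proof -
      have "x \<in> sat F (pows p a) ?z" using x(2) a unfolding N_def by blast
      then obtain u where u: "u \<in> pows p a" "u \<odot>\<^bsub>F\<^esub> x = \<zero>\<^bsub>F\<^esub>" unfolding sat_def by blast
      have "u \<odot>\<^bsub>F\<^esub> f x = f (u \<odot>\<^bsub>F\<^esub> x)"
        by (rule module_homD(3)[OF f mult_setD(1)[OF Sa(1)[OF a] u(1)] xc, symmetric])
      then have "u \<odot>\<^bsub>F\<^esub> f x = \<zero>\<^bsub>F\<^esub>" unfolding u(2) f0 .
      then show ?thesis using u(1) fc[OF xc] unfolding sat_def by blast
    qed
    then show "y \<in> N" unfolding x(1) N_def using fc[OF xc] by blast
  qed
  \<comment> \<open>A multiple of x by a denominator u falls into the kernel of f, which is torsion;
    so x is torsion too. Hence an element of f F that lies in N comes from N, and N / f N injects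
    into F / f F.\<close>
  have inv: "x \<in> N" if x: "x \<in> carrier F" "f x \<in> N" for x
  proof -
    have "x \<in> sat F (pows p a) ?z" if a: "a \<in> p" for a
    proof -
      note Sp = Sa(1)[OF a]
      have "f x \<in> sat F (pows p a) ?z" using x(2) a unfolding N_def by blast
      then obtain u where u: "u \<in> pows p a" "u \<odot>\<^bsub>F\<^esub> f x = \<zero>\<^bsub>F\<^esub>" unfolding sat_def by blast
      have uc: "u \<in> carrier R" by (rule mult_setD(1)[OF Sp u(1)])
      have "f (u \<odot>\<^bsub>F\<^esub> x) = \<zero>\<^bsub>F\<^esub>" unfolding module_homD(3)[OF f uc x(1)] by (rule u(2))
      then have "u \<odot>\<^bsub>F\<^esub> x \<in> sat F (pows p a) ?z" by (rule torK[OF F.smult_closed[OF uc x(1)] _ a])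
      then show ?thesis by (rule sat_cancel[OF Sp M x(1) u(1)])
    qed
    then show ?thesis using x(1) unfolding N_def by blast
  qed
  \<comment> \<open>Here p is not minimal: choose a in p outside q. An element of N is killed by
    some s times a power of a, which is outside q, so all coordinates lie in q and therefore in
    p.\<close>
  have Niv: "N \<subseteq> ivec p n"
  proof
    fix x assume x: "x \<in> N"
    have xc: "x \<in> carrier (power_module R n)" using ND(6)[OF x] unfolding F_def .
    obtain a where a: "a \<in> p" "a \<notin> q" using q(2) by blast
    have ac: "a \<in> carrier R" by (rule p.a_Hcarr[OF a(1)])
    have "x \<in> sat F (pows p a) ?z" using x a(1) unfolding N_def by blast
    then obtain u where u: "u \<in> pows p a" "u \<odot>\<^bsub>F\<^esub> x = \<zero>\<^bsub>F\<^esub>" unfolding sat_def by blast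
    obtain s and k :: nat where s: "s \<in> ?S" "u = s \<otimes> a [^] k" using u(1) unfolding pows_def by blast
    have sc: "s \<in> carrier R" using s(1) by blast
    have uc: "u \<in> carrier R" by (rule mult_setD(1)[OF Sa(1)[OF a(1)] u(1)])
    have uq: "u \<notin> q"
    proof
      assume "u \<in> q"
      then have "s \<in> q \<or> a [^] k \<in> q" unfolding s(2) by (rule q.I_prime[OF sc nat_pow_closed[OF ac]])
      then show False using s(1) q(2) prime_pow[OF q(1) ac, of k] a(2) by blast
    qed
    have "x i \<in> p" if i: "i < n" for i
    proof -
      have xi: "x i \<in> carrier R" by (rule pm_closed[OF xc i])
      have "u \<otimes> x i = \<zero>"
        using fun_cong[OF u(2), of i] unfolding F_def pm_simps(2)[OF i] pm_simps(3)[OF i] .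
      then have "u \<otimes> x i \<in> q" using q.zero_closed by simp
      then have "x i \<in> q" using q.I_prime[OF uc xi] uq by blast
      then show ?thesis using q(2) by blast
    qed
    then show "x \<in> ivec p n" using xc by (simp add: ivec_def)
  qed
  have "\<exists>l. has_length F ?S (f ` carrier F) (carrier F) l"
    by (rule has_length_torsion[OF nM p im]) (rule torF)
  then obtain l0 where l0: "has_length F ?S (f ` carrier F) (carrier F) l0" ..
  have zN: "?z \<subseteq> N" using ND(3) by blast
  have "\<exists>l. has_length F ?S ?z N l"
  proof -
    let ?N = "F\<lparr>carrier := N\<rparr>"
    have "\<exists>l. has_length ?N ?S ?z (carrier ?N) l"
    proof (rule has_length_torsion[OF noetherian_submodule(1)[OF nM N] p])
      show "submodule R ?z ?N"
        unfolding noetherian_submodule(2)[OF nM N] using F.submodule_zero zN by blast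
      fix x a assume "x \<in> carrier ?N" "a \<in> p"
      then have "x \<in> N" "x \<in> sat F (pows p a) ?z" unfolding N_def by auto
      then show "x \<in> sat ?N (pows p a) ?z" unfolding sat_def by simp
    qed
    then obtain l where l: "has_length ?N ?S ?z (carrier ?N) l" ..
    have "m \<le> l" if "chain F ?S ?z N m" for m
      using has_lengthD(2)[OF l] chain_in_submodule[OF N that subset_refl] by simp
    then show ?thesis by (rule has_length_exists[OF _ N zN])
  qed
  then obtain l where l: "has_length F ?S ?z N l" ..
  have zK: "?z \<subseteq> K" using submoduleD(3)[OF K] by blast
  have zfN: "?z \<subseteq> f ` N" using submoduleD(3)[OF fN] by blast
  obtain k1 where k1: "has_length F ?S ?z K k1"
    using has_length_sub[OF l subset_refl zK KN K N] ..
  obtain k2 where k2: "has_length F ?S K N k2"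
    using has_length_sub[OF l zK KN subset_refl N N] ..
  obtain k3 where k3: "has_length F ?S ?z (f ` N) k3"
    using has_length_sub[OF l subset_refl zfN fNN fN N] ..
  obtain k4 where k4: "has_length F ?S (f ` N) N k4"
    using has_length_sub[OF l zfN fNN subset_refl N N] ..
  have fK: "f ` K = ?z"
  proof -
    have "f ` K \<subseteq> ?z" unfolding K_def by blast
    moreover have "\<zero>\<^bsub>F\<^esub> \<in> f ` K" using f0 submoduleD(3)[OF K] by (intro image_eqI[of _ f "\<zero>\<^bsub>F\<^esub>"]) simp_all
    ultimately show ?thesis by blast
  qed
  have "x \<in> K" if "x \<in> carrier F" "f x = \<zero>\<^bsub>F\<^esub>" for x using that unfolding K_def by blast
  note kerK = this
  have "chain F ?S K N m \<longleftrightarrow> chain F ?S ?z (f ` N) m" for m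
    by (rule chain_hom_iff[OF S M f _ KN N, unfolded fK]) (rule kerK)
  then have "has_length F ?S ?z (f ` N) k2" using k2 unfolding has_length_def by blast
  from has_length_unique[OF this k3] have "k2 = k3" .
  \<comment> \<open>The length of N is counted through K and through f N. Since N / K is isomorphic
    to f N, the kernel and the cokernel of f on N have equal length.\<close>
  moreover have "k1 + k2 = k3 + k4"
    by (rule has_length_unique[OF has_length_add[OF S k1 k2] has_length_add[OF S k3 k4]])
  ultimately have k14: "k1 = k4" by simp
  have "f ` N \<subseteq> f ` carrier F" by (rule image_mono[OF ND(2)])
  \<comment> \<open>A longest chain from f N to N is split along f F. The part inside f F is trivial
    by \<open>inv\<close>, so the sums with f F still have k4 proper steps.\<close>
  then obtain a b where ab: "k4 \<le> a + b" "chain F ?S (f ` N) (N \<inter> f ` carrier F) a"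
    "chain F ?S (f ` carrier F) (msum F N (f ` carrier F)) b"
    using chain_split[OF S im _ has_lengthD(1)[OF k4]] by blast
  have "N \<inter> f ` carrier F \<subseteq> f ` N" using inv by blast
  then have "N \<inter> f ` carrier F \<subseteq> sat F ?S (f ` N)" using sat_submodule(2)[OF S fN] by blast
  then have "a = 0" by (rule chain_trivial[OF ab(2)])
  have "\<not> carrier F \<subseteq> sat F ?S (msum F N (f ` carrier F))"
  proof
    assume h: "carrier F \<subseteq> sat F ?S (msum F N (f ` carrier F))"
    have iv: "submodule R (ivec p n) F" unfolding F_def by (rule ivec_submodule[OF p.is_ideal])
    have "msum F N (f ` carrier F) \<subseteq> msum F (f ` carrier F) (ivec p n)"
      by (rule msum_least[OF submodule_msum(1)[OF im iv] subset_trans[OF Niv submodule_msum(3)[OF im iv]]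
            submodule_msum(2)[OF im iv]])
    from subset_trans[OF h sat_mono[OF this]]
    have "carrier F \<subseteq> sat F ?S (f ` carrier F)" using nakayama_local[OF p, of "f ` carrier F" n] im
      unfolding F_def by blast
    then show False using ne by blast
  qed
  \<comment> \<open>One more proper step leads from N + f F to F; this is the strict inequality of
    the lengths.\<close>
  then have "chain F ?S (f ` carrier F) (carrier F) (Suc b)"
    by (rule chain_step[OF ab(3) F.submodule_carrier submoduleD(2)[OF submodule_msum(1)[OF N im]]])
  then have "Suc b \<le> l0" by (rule has_lengthD(2)[OF l0])
  then have "k1 < l0" using k14 ab(1) \<open>a = 0\<close> by simp
  then show ?thesis using l0 k1 unfolding K_def by blast
qed

text \<open>Adding the cardinalities of neighbours treats both parities at once: g (n + 1) - g n is
  the difference of the cardinalities of A (n + 2) and A n. So g is non-decreasing and bounded by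
  twice the size of X, and once it is maximal these cardinalities agree.\<close>

lemma eventually_stable:
  fixes A :: "nat \<Rightarrow> 'x set"
  assumes fin: "finite X" and AX: "\<And>n. A n \<subseteq> X" and mono: "\<And>n. n \<ge> N0 \<Longrightarrow> A n \<subseteq> A (n + 2)"
  shows "\<exists>N\<ge>N0. \<forall>n\<ge>N. A (n + 2) = A n"
proof -
  define g where "g = (\<lambda>n. card (A n) + card (A (n + 1)))"
  have finA: "finite (A n)" for n by (rule finite_subset[OF AX fin])
  have step: "card (A n) \<le> card (A (n + 2))" if "n \<ge> N0" for n
    by (rule card_mono[OF finA mono[OF that]])
  have bound: "g n < 2 * card X + 1" for n
    using card_mono[OF fin AX[of n]] card_mono[OF fin AX[of "n + 1"]] by (simp add: g_def)
  obtain N where N: "N \<ge> N0" "\<And>n. n \<ge> N0 \<Longrightarrow> g n \<le> g N"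
    using ex_has_greatest_nat[of "\<lambda>n. n \<ge> N0" N0 g "2 * card X + 1"] bound by auto
  have ge: "g N \<le> g n" if "n \<ge> N" for n
    using that
  proof (induction n rule: dec_induct)
    case (step n)
    then have "card (A n) \<le> card (A (n + 2))" using N(1) \<open>\<And>n. n \<ge> N0 \<Longrightarrow> card (A n) \<le> card (A (n + 2))\<close> by simp
    then show ?case using step.IH by (simp add: g_def)
  qed simp
  have "A (n + 2) = A n" if n: "n \<ge> N" for n
  proof -
    have "g (Suc n) = g n" using ge[of n] ge[of "Suc n"] N(2)[of n] N(2)[of "Suc n"] n N(1) by simp
    then have "card (A n) = card (A (n + 2))" by (simp add: g_def)
    then show ?thesis using card_subset_eq[OF finA mono[of n]] n N(1) by auto
  qed
  then show ?thesis using N(1) by blast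
qed

end

section \<open>Supports along an exact complex of free modules\<close>

text \<open>What remains of a resolution after the augmentation is dropped: exactness in positive
  degrees.\<close>

locale exact_free_complex = noetherian_cring R for R (structure) +
  fixes b :: "nat \<Rightarrow> nat" and d :: "nat \<Rightarrow> (nat \<Rightarrow> 'a) \<Rightarrow> nat \<Rightarrow> 'a"
  assumes hom: "d (Suc i) \<in> module_hom R (power_module R (b (Suc i))) (power_module R (b i))"
    and exact: "{x \<in> carrier (power_module R (b (Suc i))). d (Suc i) x = \<zero>\<^bsub>power_module R (b i)\<^esub>}
      = d (Suc (Suc i)) ` carrier (power_module R (b (Suc (Suc i))))"

context exact_free_complex
begin

text \<open>The relations of the syzygy of index n, which is the free module of rank
  \<open>b n\<close> modulo \<open>bound n\<close>.\<close>

definition bound :: "nat \<Rightarrow> (nat \<Rightarrow> 'a) set" where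
  "bound n = d (Suc n) ` carrier (power_module R (b (Suc n)))"

definition supp :: "nat \<Rightarrow> 'a set set" where
  "supp n = {p. primeideal p R \<and>
     \<not> carrier (power_module R (b n)) \<subseteq> sat (power_module R (b n)) (carrier R - p) (bound n)}"

lemma bound_submodule: "submodule R (bound n) (power_module R (b n))"
  unfolding bound_def by (rule submodule_image[OF module.submodule_carrier[OF pm_module] pm_module hom])

lemma bound_eq_ker:
  "bound (Suc n) = {x \<in> carrier (power_module R (b (Suc n))). d (Suc n) x = \<zero>\<^bsub>power_module R (b n)\<^esub>}"
  unfolding bound_def by (rule exact[symmetric])

lemma supp_upward:
  assumes "q \<in> supp n" "primeideal p R" "q \<subseteq> p"
  shows "p \<in> supp n"
proof (rule ccontr)
  assume "p \<notin> supp n"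
  then have "carrier (power_module R (b n)) \<subseteq> sat (power_module R (b n)) (carrier R - p) (bound n)"
    using assms(2) unfolding supp_def by blast
  from subset_trans[OF this prime_compl_mono[OF assms(3)]] show False
    using assms(1) unfolding supp_def by blast
qed

lemma not_suppD:
  "primeideal p R \<Longrightarrow> p \<notin> supp n \<Longrightarrow>
    carrier (power_module R (b n)) \<subseteq> sat (power_module R (b n)) (carrier R - p) (bound n)"
  unfolding supp_def by blast

text \<open>In positive degree the boundaries are a kernel, so a prime colon ideal P of them below q
  is an associated prime of \<open>R\<close>. Its generator y of the colon ideal witnesses that the
  syzygy does not vanish at P.\<close>

lemma supp_Ass:
  assumes q: "q \<in> supp (Suc n)"
  obtains p where "p \<in> Ass" "p \<subseteq> q" "p \<in> supp (Suc n)"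
proof -
  let ?F = "power_module R (b (Suc n))"
  have qp: "primeideal q R" using q unfolding supp_def by blast
  obtain x where x: "x \<in> carrier ?F" "x \<notin> sat ?F (carrier R - q) (bound (Suc n))"
    using q unfolding supp_def by blast
  obtain y where y: "y \<in> carrier ?F" "primeideal (colon ?F (bound (Suc n)) y) R"
    "colon ?F (bound (Suc n)) y \<inter> (carrier R - q) = {}"
    by (rule exists_prime_colon_below[OF noetherian_power_module bound_submodule mult_set_prime[OF qp] x])
  define P where "P = colon ?F (bound (Suc n)) y"
  have P: "P \<in> Ass"
    using colon_ker_in_Ass[OF hom pm_module y(1), folded bound_eq_ker, OF y(2)] unfolding P_def .
  have "P \<subseteq> q" using y(3) unfolding P_def colon_def by blast
  moreover have "P \<in> supp (Suc n)"
  proof -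
    have "y \<notin> sat ?F (carrier R - P) (bound (Suc n))" unfolding sat_def P_def colon_def by blast
    then show ?thesis using y(1) AssD[OF P] unfolding supp_def by blast
  qed
  ultimately show ?thesis by (rule that[OF P])
qed

text \<open>An element v of the kernel is d w. If the syzygy of w vanishes after inverting S, some s
  w is a boundary, and s v = d (s w) = 0. A general S is allowed because the lemma serves both
  complements of primes and the sets \<open>pows\<close>.\<close>

lemma ker_torsion:
  assumes S: "mult_set S"
    and C: "carrier (power_module R (b (Suc (Suc n)))) \<subseteq>
      sat (power_module R (b (Suc (Suc n)))) S (bound (Suc (Suc n)))"
    and v: "v \<in> carrier (power_module R (b (Suc n)))" "d (Suc n) v = \<zero>\<^bsub>power_module R (b n)\<^esub>"
  shows "v \<in> sat (power_module R (b (Suc n))) S {\<zero>\<^bsub>power_module R (b (Suc n))\<^esub>}"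
proof -
  have "v \<in> bound (Suc n)" unfolding bound_eq_ker using v by blast
  then obtain w where w: "v = d (Suc (Suc n)) w" "w \<in> carrier (power_module R (b (Suc (Suc n))))"
    unfolding bound_def by (rule imageE)
  obtain s where s: "s \<in> S" "s \<odot>\<^bsub>power_module R (b (Suc (Suc n)))\<^esub> w \<in> bound (Suc (Suc n))"
    using subsetD[OF C w(2)] unfolding sat_def by blast
  have "d (Suc (Suc n)) (s \<odot>\<^bsub>power_module R (b (Suc (Suc n)))\<^esub> w) = \<zero>\<^bsub>power_module R (b (Suc n))\<^esub>"
    using s(2) unfolding bound_eq_ker by blast
  then have "s \<odot>\<^bsub>power_module R (b (Suc n))\<^esub> v = \<zero>\<^bsub>power_module R (b (Suc n))\<^esub>"
    unfolding w(1) module_homD(3)[OF hom mult_setD(1)[OF S s(1)] w(2)] .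
  then show ?thesis using s(1) v(1) unfolding sat_def by blast
qed

lemma supp_Ass_mono:
  assumes p: "p \<in> Ass" "p \<in> supp n" and b: "b n \<le> b (Suc n)"
  shows "p \<in> supp (Suc (Suc n))"
proof (rule ccontr)
  assume h: "p \<notin> supp (Suc (Suc n))"
  note pp = AssD[OF p(1)]
  have "carrier (power_module R (b n)) \<subseteq> sat (power_module R (b n)) (carrier R - p) (bound n)"
    unfolding bound_def
    by (rule injective_local_surjective[OF p(1) hom _ b])
      (rule ker_torsion[OF mult_set_prime[OF pp] not_suppD[OF pp h]])
  then show False using p(2) unfolding supp_def by blast
qed

text \<open>Local injectivity of \<open>d (Suc n)\<close> at any prime, associated or not, bounds
  the rank of its source by that of its target.\<close>

lemma not_supp_rank_le:
  assumes q: "primeideal q R" "q \<notin> supp (Suc (Suc n))"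
  shows "b (Suc n) \<le> b n"
  by (rule injective_local_rank_le[OF q(1) hom])
    (rule ker_torsion[OF mult_set_prime[OF q(1)] not_suppD[OF q]])

text \<open>Equal ranks make \<open>d (Suc n)\<close> an endomorphism whose cokernel is the syzygy
  of index n and whose kernel is that of index n + 2. Minimality of p in both supports supplies the
  torsion hypotheses of \<open>length_descent\<close>.\<close>

lemma supp_length_descent:
  assumes p: "p \<in> supp n" and b: "b (Suc n) = b n" and q: "primeideal q R" "q \<subset> p"
    and min: "\<And>q. q \<in> supp n \<Longrightarrow> q \<subseteq> p \<Longrightarrow> q = p"
    and min2: "\<And>q. q \<in> supp (Suc (Suc n)) \<Longrightarrow> q \<subseteq> p \<Longrightarrow> q = p"
  shows "\<exists>l0 l1. has_length (power_module R (b n)) (carrier R - p) (bound n)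
        (carrier (power_module R (b n))) l0 \<and>
      has_length (power_module R (b (Suc (Suc n)))) (carrier R - p) (bound (Suc (Suc n)))
        (carrier (power_module R (b (Suc (Suc n))))) l1 \<and> l1 < l0"
proof -
  have pp: "primeideal p R" using p unfolding supp_def by blast
  interpret p: primeideal p R by (rule pp)
  let ?F = "power_module R (b n)" and ?G = "power_module R (b (Suc (Suc n)))"
  let ?f = "d (Suc n)" and ?g = "d (Suc (Suc n))" and ?S = "carrier R - p"
  have S: "mult_set ?S" by (rule mult_set_prime[OF pp])
  have f: "?f \<in> module_hom R ?F ?F" using hom[of n] unfolding b .
  have fim: "?f ` carrier ?F = bound n" unfolding bound_def b ..
  have g: "?g \<in> module_hom R ?G ?F" using hom[of "Suc n"] unfolding b .
  have ns: "primeideal r R \<Longrightarrow> r \<subset> p \<Longrightarrow> r \<notin> supp n" for r using min by blast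
  have ns2: "primeideal r R \<Longrightarrow> r \<subset> p \<Longrightarrow> r \<notin> supp (Suc (Suc n))" for r using min2 by blast
  have tor: "x \<in> sat ?F (pows p a) (?f ` carrier ?F)" if "x \<in> carrier ?F" "a \<in> p" for x a
    unfolding fim
    by (rule torsion_of_support[OF noetherian_power_module bound_submodule pp that(2) not_suppD[OF _ ns] that(1)])
  have tor2: "carrier ?G \<subseteq> sat ?G (pows p a) (bound (Suc (Suc n)))" if "a \<in> p" for a
    by (rule subsetI)
      (rule torsion_of_support[OF noetherian_power_module bound_submodule pp that not_suppD[OF _ ns2]])
  have torK: "x \<in> sat ?F (pows p a) {\<zero>\<^bsub>?F\<^esub>}" if "x \<in> carrier ?F" "?f x = \<zero>\<^bsub>?F\<^esub>" "a \<in> p" for x a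
    using ker_torsion[OF mult_set_pows(1)[OF pp p.a_Hcarr[OF that(3)]] tor2[OF that(3)], of x]
      that(1,2) unfolding b by blast
  have ne: "\<not> carrier ?F \<subseteq> sat ?F ?S (?f ` carrier ?F)"
    using p unfolding fim supp_def by blast
  obtain l0 l1 where l: "has_length ?F ?S (?f ` carrier ?F) (carrier ?F) l0"
    "has_length ?F ?S {\<zero>\<^bsub>?F\<^esub>} {x \<in> carrier ?F. ?f x = \<zero>\<^bsub>?F\<^esub>} l1" "l1 < l0"
  proof -
    have "\<exists>l0 l1. has_length ?F ?S (?f ` carrier ?F) (carrier ?F) l0 \<and>
        has_length ?F ?S {\<zero>\<^bsub>?F\<^esub>} {x \<in> carrier ?F. ?f x = \<zero>\<^bsub>?F\<^esub>} l1 \<and> l1 < l0"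
      by (rule length_descent[OF pp q f _ _ ne]) (rule tor, assumption+, rule torK)
    then show ?thesis using that by blast
  qed
  interpret G: module R ?G by (rule pm_module)
  have ker: "{x \<in> carrier ?F. ?f x = \<zero>\<^bsub>?F\<^esub>} = ?g ` carrier ?G"
    using exact[of n] unfolding b .
  have gB: "?g ` bound (Suc (Suc n)) = {\<zero>\<^bsub>?F\<^esub>}"
  proof -
    have g0: "?g x = \<zero>\<^bsub>?F\<^esub>" if "x \<in> bound (Suc (Suc n))" for x
      using that unfolding bound_eq_ker b by simp
    have z: "\<zero>\<^bsub>?G\<^esub> \<in> bound (Suc (Suc n))" by (rule submoduleD(3)[OF bound_submodule])
    show ?thesis
    proof (intro equalityI subsetI)
      fix y assume "y \<in> ?g ` bound (Suc (Suc n))"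
      then obtain x where x: "y = ?g x" "x \<in> bound (Suc (Suc n))" by (rule imageE)
      show "y \<in> {\<zero>\<^bsub>?F\<^esub>}" unfolding x(1) g0[OF x(2)] by (rule singletonI)
    next
      fix y assume "y \<in> {\<zero>\<^bsub>?F\<^esub>}"
      then have "y = \<zero>\<^bsub>?F\<^esub>" by (rule singletonD)
      then show "y \<in> ?g ` bound (Suc (Suc n))" by (intro image_eqI[OF _ z]) (simp only: g0[OF z])
    qed
  qed
  have kerg: "x \<in> bound (Suc (Suc n))" if "x \<in> carrier ?G" "?g x = \<zero>\<^bsub>?F\<^esub>" for x
    unfolding bound_eq_ker b mem_Collect_eq by (rule conjI[OF that])
  \<comment> \<open>The kernel is the image of \<open>d (Suc (Suc n))\<close>, so its length is that
    of the free module of rank \<open>b (Suc (Suc n))\<close> modulo the kernel of this map, that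
    is, of the syzygy of index n + 2.\<close>
  have "chain ?G ?S (bound (Suc (Suc n))) (carrier ?G) m \<longleftrightarrow>
      chain ?F ?S {\<zero>\<^bsub>?F\<^esub>} {x \<in> carrier ?F. ?f x = \<zero>\<^bsub>?F\<^esub>} m" for m
    unfolding ker
    by (rule chain_hom_iff[OF S pm_module g _ submoduleD(2)[OF bound_submodule] G.submodule_carrier,
          unfolded gB]) (rule kerg)
  then have "has_length ?G ?S (bound (Suc (Suc n))) (carrier ?G) l1"
    using l(2) unfolding has_length_def by blast
  then show ?thesis using l(1,3) unfolding fim by blast
qed

theorem supp_stable:
  assumes mono: "\<And>i. i \<ge> N0 \<Longrightarrow> b i \<le> b (Suc i)"
  shows "\<exists>N. \<forall>n\<ge>N.
    (\<forall>p\<in>supp n. (\<forall>q\<in>supp n. q \<subseteq> p \<longrightarrow> q = p) \<longrightarrow> (\<forall>q. primeideal q R \<longrightarrow> q \<subseteq> p \<longrightarrow> q = p)) \<and>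
    (\<forall>i. supp n = supp (n + 2 * i)) \<and>
    (supp n \<noteq> {p. primeideal p R} \<longrightarrow> (\<forall>i. b (n + 2 * i) = b (n + 2 * i + 1)))"
proof -
  \<comment> \<open>The successor guarantees n to be positive, so that supports are generated by
    associated primes.\<close>
  have "\<exists>N\<ge>Suc N0. \<forall>n\<ge>N. Ass \<inter> supp (n + 2) = Ass \<inter> supp n"
  proof (rule eventually_stable[OF finite_Ass])
    show "Ass \<inter> supp n \<subseteq> Ass" for n by blast
    show "Ass \<inter> supp n \<subseteq> Ass \<inter> supp (n + 2)" if "n \<ge> Suc N0" for n
    proof
      fix p assume "p \<in> Ass \<inter> supp n"
      then show "p \<in> Ass \<inter> supp (n + 2)" using supp_Ass_mono[of p n] mono[of n] that by simp
    qed
  qed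
  then obtain N where N: "N \<ge> Suc N0" "\<And>n. n \<ge> N \<Longrightarrow> Ass \<inter> supp (n + 2) = Ass \<inter> supp n" by blast
  \<comment> \<open>A support in positive degree is the upward closure of its associated primes, so
    agreement on \<open>Ass\<close> gives agreement everywhere.\<close>
  have sub: "supp n \<subseteq> supp m" if "Ass \<inter> supp n = Ass \<inter> supp m" "n \<ge> 1" for n m
  proof
    fix q assume q: "q \<in> supp n"
    obtain n' where n': "n = Suc n'" using \<open>n \<ge> 1\<close> by (cases n) auto
    obtain p where p: "p \<in> Ass" "p \<subseteq> q" "p \<in> supp n" using supp_Ass[of q n'] q unfolding n' by blast
    have "p \<in> supp m" using p that(1) by blast
    then show "q \<in> supp m" by (rule supp_upward[OF _ _ p(2)]) (use q in \<open>simp add: supp_def\<close>)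
  qed
  have eq2: "supp (n + 2) = supp n" if "n \<ge> N" for n
    by (intro equalityI sub) (use N(1) N(2)[OF that] that in simp_all)
  have eq: "supp (n + 2 * i) = supp n" if n: "n \<ge> N" for n i
  proof (induction i)
    case (Suc i)
    have "supp (n + 2 * Suc i) = supp (n + 2 * i + 2)" by simp
    also have "\<dots> = supp (n + 2 * i)" by (rule eq2) (use n in simp)
    finally show ?case unfolding Suc.IH .
  qed simp
  have beq: "b (n + 2 * i + 1) = b (n + 2 * i)" if n: "n \<ge> N" and q: "primeideal q R" "q \<notin> supp n" for n i q
  proof (rule antisym)
    have "q \<notin> supp (n + 2 * Suc i)" using q(2) unfolding eq[OF n] .
    then have "q \<notin> supp (Suc (Suc (n + 2 * i)))" by simp
    from not_supp_rank_le[OF q(1) this] show "b (n + 2 * i + 1) \<le> b (n + 2 * i)" by simp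
    show "b (n + 2 * i) \<le> b (n + 2 * i + 1)" using mono[of "n + 2 * i"] n N(1) by simp
  qed
  have minimal: "q = p" if n: "n \<ge> N" and p: "p \<in> supp n" and min: "\<forall>q\<in>supp n. q \<subseteq> p \<longrightarrow> q = p"
    and q: "primeideal q R" "q \<subseteq> p" for n p q
  proof (rule ccontr)
    assume "q \<noteq> p"
    then have qp: "q \<subset> p" using q(2) by (rule psubsetI[rotated])
    have qn: "q \<notin> supp n"
    proof
      assume "q \<in> supp n"
      from min[rule_format, OF this q(2)] show False using \<open>q \<noteq> p\<close> by contradiction
    qed
    let ?L = "\<lambda>i. has_length (power_module R (b (n + 2 * i))) (carrier R - p) (bound (n + 2 * i))
      (carrier (power_module R (b (n + 2 * i))))"
    have desc: "\<exists>l0 l1. ?L i l0 \<and> ?L (Suc i) l1 \<and> l1 < l0" for i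
    proof -
      have e1: "supp (n + 2 * i) = supp n" by (rule eq[OF n])
      have e2: "supp (Suc (Suc (n + 2 * i))) = supp n" using eq[OF n, of "Suc i"] by simp
      have "\<exists>l0 l1. ?L i l0 \<and> has_length (power_module R (b (Suc (Suc (n + 2 * i))))) (carrier R - p)
          (bound (Suc (Suc (n + 2 * i)))) (carrier (power_module R (b (Suc (Suc (n + 2 * i)))))) l1 \<and> l1 < l0"
      proof (rule supp_length_descent[OF _ _ q(1) qp])
        show "p \<in> supp (n + 2 * i)" unfolding e1 by (rule p)
        show "b (Suc (n + 2 * i)) = b (n + 2 * i)" using beq[OF n q(1) qn, of i] by simp
        show "r = p" if "r \<in> supp (n + 2 * i)" "r \<subseteq> p" for r
          using that(1) unfolding e1 by (rule min[rule_format, OF _ that(2)])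
        show "r = p" if "r \<in> supp (Suc (Suc (n + 2 * i)))" "r \<subseteq> p" for r
          using that(1) unfolding e2 by (rule min[rule_format, OF _ that(2)])
      qed
      then show ?thesis by simp
    qed
    \<comment> \<open>Infinite descent: a length at stage i is unique and strictly exceeds the one
      at the next stage.\<close>
    have "\<not> ?L i l" for i l
    proof (induction l arbitrary: i rule: less_induct)
      case (less l)
      show ?case
      proof
        assume l: "?L i l"
        obtain l0 l1 where l01: "?L i l0" "?L (Suc i) l1" "l1 < l0" using desc by blast
        have "l0 = l" by (rule has_length_unique[OF l01(1) l])
        then show False using less.IH[of l1 "Suc i"] l01(2,3) by simp
      qed
    qed
    then show False using desc by blast
  qed
  show ?thesis
  proof (intro exI[of _ N] allI impI conjI ballI)
    fix n assume n: "n \<ge> N"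
    show "supp n = supp (n + 2 * i)" for i by (rule eq[OF n, symmetric])
    show "q = p" if "p \<in> supp n" "\<forall>q\<in>supp n. q \<subseteq> p \<longrightarrow> q = p" "primeideal q R" "q \<subseteq> p" for p q
      by (rule minimal[OF n that])
    assume "supp n \<noteq> {p. primeideal p R}"
    moreover have "supp n \<subseteq> {p. primeideal p R}" unfolding supp_def by blast
    ultimately obtain q where q: "primeideal q R" "q \<notin> supp n" by blast
    show "b (n + 2 * i) = b (n + 2 * i + 1)" for i by (rule beq[OF n q, symmetric])
  qed
qed

end

section \<open>Minimal free resolutions\<close>

sublocale noetherian_local_ring \<subseteq> noetherian_cring
  by unfold_locales

context noetherian_local_ring
begin

abbreviation \<mm> :: "'a set" where "\<mm> \<equiv> max_ideal R"

lemma max_ideal_maximal: "maximalideal \<mm> R"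
  unfolding max_ideal_def by (rule theI'[OF unique_maximal])

lemma max_ideal_unique: "maximalideal I R \<Longrightarrow> I = \<mm>"
  using unique_maximal max_ideal_maximal by blast

lemma max_ideal_prime: "primeideal \<mm> R"
  by (rule maximalideal_prime[OF max_ideal_maximal])

lemma max_ideal_ideal: "ideal \<mm> R"
  by (rule primeideal.axioms(1)[OF max_ideal_prime])

text \<open>If the principal ideal of a were proper, it would lie in a maximal ideal, which can only
  be \<mm>.\<close>

lemma inverse_outside_max_ideal:
  assumes a: "a \<in> carrier R" "a \<notin> \<mm>"
  obtains c where "c \<in> carrier R" "c \<otimes> a = \<one>"
proof -
  have I: "ideal (PIdl a) R" by (rule cgenideal_ideal[OF a(1)])
  have aI: "a \<in> PIdl a" by (rule cgenideal_self[OF a(1)])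
  have "PIdl a = carrier R"
  proof (rule ccontr)
    assume ne: "PIdl a \<noteq> carrier R"
    let ?P = "\<lambda>J. ideal J R \<and> PIdl a \<subseteq> J \<and> J \<noteq> carrier R"
    have "\<exists>J. ?P J \<and> (\<forall>J'. ?P J' \<longrightarrow> J \<subseteq> J' \<longrightarrow> J' = J)"
      by (rule noetherian_module_maximal[OF noetherian_ring_module, of ?P "PIdl a"])
        (use I ne in \<open>auto simp: submodule_ring_module_iff\<close>)
    then obtain J where "?P J \<and> (\<forall>J'. ?P J' \<longrightarrow> J \<subseteq> J' \<longrightarrow> J' = J)" by (rule exE)
    note J = conjunct1[OF this] and max = conjunct2[OF this]
    have "maximalideal J R"
    proof (rule maximalidealI)
      show "ideal J R" "carrier R \<noteq> J" using J by auto
      fix K assume K: "ideal K R" "J \<subseteq> K" "K \<subseteq> carrier R"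
      show "K = J \<or> K = carrier R"
      proof (rule disjCI)
        assume "K \<noteq> carrier R"
        then have "?P K" using K J by auto
        then show "K = J" using max K(2) by auto
      qed
    qed
    then have "J = \<mm>" by (rule max_ideal_unique)
    then show False using J aI a(2) by auto
  qed
  then have "\<one> \<in> PIdl a" using one_closed by simp
  then obtain c where "c \<in> carrier R" "\<one> = c \<otimes> a" unfolding cgenideal_def by blast
  then show ?thesis using that[of c] by simp
qed

text \<open>Take the least possible number k of generators of N. A relation v with a coordinate
  outside \<mm> has a unit there, so the corresponding generator is a combination of the others and
  k was not minimal.\<close>

lemma pm_minimal_cover:
  assumes X: "module R X" and ex: "\<exists>k. \<exists>h\<in>module_hom R (power_module R k) X. h ` carrier (power_module R k) = N"
  shows "\<exists>k h. h \<in> module_hom R (power_module R k) X \<and> h ` carrier (power_module R k) = N \<and>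
    (\<forall>v\<in>carrier (power_module R k). h v = \<zero>\<^bsub>X\<^esub> \<longrightarrow> v \<in> ivec \<mm> k)"
proof -
  interpret X: module R X by fact
  let ?P = "\<lambda>k. \<exists>h\<in>module_hom R (power_module R k) X. h ` carrier (power_module R k) = N"
  define k where "k = (LEAST k. ?P k)"
  have "?P k" unfolding k_def by (rule LeastI_ex[OF ex])
  then obtain h where h: "h \<in> module_hom R (power_module R k) X" "h ` carrier (power_module R k) = N" ..
  interpret F: module R "power_module R k" by (rule pm_module)
  have "v \<in> ivec \<mm> k" if v: "v \<in> carrier (power_module R k)" "h v = \<zero>\<^bsub>X\<^esub>" for v
  proof (rule ccontr)
    assume "v \<notin> ivec \<mm> k"
    then obtain j where j: "j < k" "v j \<notin> \<mm>" using v(1) by (auto simp: ivec_def)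
    have vj: "v j \<in> carrier R" by (rule pm_closed[OF v(1) j(1)])
    obtain c where c: "c \<in> carrier R" "c \<otimes> v j = \<one>" by (rule inverse_outside_max_ideal[OF vj j(2)])
    obtain k' where k': "k = Suc k'" using j(1) by (cases k) auto
    have jk: "j \<le> k'" using j(1) k' by simp
    note ih = ins_hom[OF jk, folded k']
    have "(\<lambda>x. h (ins k' j x)) ` carrier (power_module R k') = N"
    proof (intro equalityI subsetI)
      fix y assume "y \<in> (\<lambda>x. h (ins k' j x)) ` carrier (power_module R k')"
      then obtain x where "y = h (ins k' j x)" "x \<in> carrier (power_module R k')" by (rule imageE)
      then show "y \<in> N" using module_homD(1)[OF ih, of x] h(2) by blast
    next
      fix y assume "y \<in> N"
      then have "y \<in> h ` carrier (power_module R k)" unfolding h(2) .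
      then obtain x where x: "y = h x" "x \<in> carrier (power_module R k)" by (rule imageE)
      have xj: "x j \<in> carrier R" by (rule pm_closed[OF x(2) j(1)])
      define t where "t = x j \<otimes> c"
      have t: "t \<in> carrier R" "t \<otimes> v j = x j" using xj c vj by (simp_all add: t_def m_assoc)
      \<comment> \<open>Subtracting a multiple of the relation v clears coordinate j of x without
        changing its image, so \<open>ins\<close> reaches the same element from rank k - 1.\<close>
      define w where "w = x \<ominus>\<^bsub>power_module R k\<^esub> t \<odot>\<^bsub>power_module R k\<^esub> v"
      have tv: "t \<odot>\<^bsub>power_module R k\<^esub> v \<in> carrier (power_module R k)" by (rule F.smult_closed[OF t(1) v(1)])
      have w: "w \<in> carrier (power_module R k)" unfolding w_def by (rule F.M.minus_closed[OF x(2) tv])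
      have "w j = x j \<ominus> t \<otimes> v j"
        unfolding w_def pm_minus(2)[OF x(2) tv j(1)] pm_simps(2)[OF j(1)] ..
      then have "w j = \<zero>" unfolding t(2) using xj by (simp add: minus_eq r_neg)
      then obtain z where z: "w = ins k' j z" "z \<in> carrier (power_module R k')"
        using ins_surj[OF jk w[unfolded k']] by blast
      have "h w = h x \<ominus>\<^bsub>X\<^esub> t \<odot>\<^bsub>X\<^esub> h v"
        unfolding w_def module_hom_zero_minus(3)[OF pm_module X h(1) x(2) tv] module_homD(3)[OF h(1) t(1) v(1)] ..
      also have "\<dots> = h x"
        unfolding v(2) X.smult_r_null[OF t(1)]
        using X.minus_add_cancel(3)[OF X.M.zero_closed module_homD(1)[OF h(1) x(2)]]
          X.M.r_zero[OF module_homD(1)[OF h(1) x(2)]] by simp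
      finally have "y = h (ins k' j z)" unfolding x(1) z(1) by (rule sym)
      then show "y \<in> (\<lambda>x. h (ins k' j x)) ` carrier (power_module R k')" using z(2) by (rule image_eqI)
    qed
    then have "?P k'" using module_hom_comp[OF ih h(1)] by blast
    then have "k \<le> k'" unfolding k_def by (rule Least_le)
    then show False using k' by simp
  qed
  then show ?thesis using h by (intro exI[of _ k] exI[of _ h] conjI ballI impI)
qed

lemma pm_cover_of_fg:
  assumes X: "module R X" and fg: "finitely_generated R X"
  shows "\<exists>k. \<exists>h\<in>module_hom R (power_module R k) X. h ` carrier (power_module R k) = carrier X"
proof -
  interpret X: module R X by fact
  obtain A where A: "finite A" "A \<subseteq> carrier X" "X.span A = carrier X"
    using fg unfolding finitely_generated_def by blast
  obtain u where u: "bij_betw u {..<card A} A"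
    using ex_bij_betw_nat_finite[OF A(1)] unfolding atLeast0LessThan by blast
  have uA: "u i \<in> A" if "i < card A" for i using bij_betwE[OF u] that by blast
  have uc: "u i \<in> carrier X" if "i < card A" for i using uA[OF that] A(2) by blast
  obtain h where h: "h \<in> module_hom R (power_module R (card A)) X" "\<And>i. i < card A \<Longrightarrow> h (uvec (card A) i) = u i"
    using pm_hom_exists[OF X, of "card A" u] uc by blast
  let ?I = "h ` carrier (power_module R (card A))"
  have I: "submodule R ?I X" by (rule submodule_image[OF module.submodule_carrier[OF pm_module] X h(1)])
  have "A \<subseteq> ?I"
  proof
    fix a assume "a \<in> A"
    then obtain i where "i < card A" "a = u i" using bij_betw_imp_surj_on[OF u] by blast
    then show "a \<in> ?I" using h(2)[of i] uvec_closed[of "card A" i] by (intro image_eqI) simp_all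
  qed
  then have "carrier X \<subseteq> ?I" using X.span_is_subset[OF _ I] A(3) by blast
  then have "?I = carrier X" using submoduleD(2)[OF I] by blast
  then show ?thesis using h(1) by blast
qed

text \<open>Each kernel is covered minimally in turn. The kernel of a minimal cover lies in \<mm>
  times the free module, so the next differential, which maps onto it, has its image there.\<close>

lemma minimal_free_resolution_exists:
  assumes X: "module R X" and fg: "finitely_generated R X"
  shows "\<exists>P. minimal_free_resolution R X P"
proof -
  interpret X: module R X by fact
  obtain r0 e where e0: "e \<in> module_hom R (power_module R r0) X \<and> e ` carrier (power_module R r0) = carrier X \<and>
    (\<forall>v\<in>carrier (power_module R r0). e v = \<zero>\<^bsub>X\<^esub> \<longrightarrow> v \<in> ivec \<mm> r0)"
    using pm_minimal_cover[OF X pm_cover_of_fg[OF X fg]] by (elim exE)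
  note e = conjunct1[OF e0] conjunct1[OF conjunct2[OF e0]] conjunct2[OF conjunct2[OF e0], rule_format]
  have next_step: "\<exists>k g. g \<in> module_hom R (power_module R k) (power_module R n) \<and>
      g ` carrier (power_module R k) = N \<and>
      (\<forall>v\<in>carrier (power_module R k). g v = \<zero>\<^bsub>power_module R n\<^esub> \<longrightarrow> v \<in> ivec \<mm> k)"
    if N: "submodule R N (power_module R n)" for N n
    by (rule pm_minimal_cover[OF pm_module submodule_fg[OF noetherian_power_module N]])
  \<comment> \<open>A state (a, b, g) is a map from rank b to rank a. The clause on the kernel of g
    is the invariant that makes the following map minimal; at stage 0 the image is tied to the
    augmentation e.\<close>
  define P where "P = (\<lambda>(n::nat) (a, b, g). g \<in> module_hom R (power_module R b) (power_module R a) \<and>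
      (\<forall>v\<in>carrier (power_module R b). g v = \<zero>\<^bsub>power_module R a\<^esub> \<longrightarrow> v \<in> ivec \<mm> b) \<and>
      g ` carrier (power_module R b) \<subseteq> ivec \<mm> a \<and>
      (n = 0 \<longrightarrow> a = r0 \<and> g ` carrier (power_module R b) = {v \<in> carrier (power_module R r0). e v = \<zero>\<^bsub>X\<^esub>}))"
  define Q where "Q = (\<lambda>(n::nat) (a::nat, b, g) (a', b', g'). a' = b \<and>
      g' ` carrier (power_module R b') = {v \<in> carrier (power_module R b). g v = \<zero>\<^bsub>power_module R a\<^esub>})"
  have "\<exists>f. \<forall>n. P n (f n) \<and> Q n (f n) (f (Suc n))"
  proof (rule dependent_nat_choice)
    have "submodule R {v \<in> carrier (power_module R r0). e v = \<zero>\<^bsub>X\<^esub>} (power_module R r0)"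
      using submodule_preimage[OF pm_module e(1) X.submodule_zero] by simp
    from next_step[OF this] obtain k g where g: "g \<in> module_hom R (power_module R k) (power_module R r0)"
      "g ` carrier (power_module R k) = {v \<in> carrier (power_module R r0). e v = \<zero>\<^bsub>X\<^esub>}"
      "\<forall>v\<in>carrier (power_module R k). g v = \<zero>\<^bsub>power_module R r0\<^esub> \<longrightarrow> v \<in> ivec \<mm> k" by blast
    have "g ` carrier (power_module R k) \<subseteq> ivec \<mm> r0" unfolding g(2) using e(3) by blast
    then have "P 0 (r0, k, g)" unfolding P_def using g by simp
    then show "\<exists>x. P 0 x" ..
  next
    fix x :: "nat \<times> nat \<times> ((nat \<Rightarrow> 'a) \<Rightarrow> nat \<Rightarrow> 'a)" and n
    assume Px: "P n x"
    obtain a b g where x: "x = (a, b, g)" by (cases x)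
    have g: "g \<in> module_hom R (power_module R b) (power_module R a)"
      "\<And>v. v \<in> carrier (power_module R b) \<Longrightarrow> g v = \<zero>\<^bsub>power_module R a\<^esub> \<Longrightarrow> v \<in> ivec \<mm> b"
      using Px unfolding P_def x by auto
    interpret A: module R "power_module R a" by (rule pm_module)
    have "submodule R {v \<in> carrier (power_module R b). g v = \<zero>\<^bsub>power_module R a\<^esub>} (power_module R b)"
      using submodule_preimage[OF pm_module g(1) A.submodule_zero] by simp
    from next_step[OF this] obtain k g' where g': "g' \<in> module_hom R (power_module R k) (power_module R b)"
      "g' ` carrier (power_module R k) = {v \<in> carrier (power_module R b). g v = \<zero>\<^bsub>power_module R a\<^esub>}"
      "\<forall>v\<in>carrier (power_module R k). g' v = \<zero>\<^bsub>power_module R b\<^esub> \<longrightarrow> v \<in> ivec \<mm> k" by blast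
    have "g' ` carrier (power_module R k) \<subseteq> ivec \<mm> b" unfolding g'(2) using g(2) by blast
    then have "P (Suc n) (b, k, g') \<and> Q n x (b, k, g')" unfolding P_def Q_def x using g' by simp
    then show "\<exists>y. P (Suc n) y \<and> Q n x y" ..
  qed
  then obtain f where f: "\<And>n. P n (f n)" "\<And>n. Q n (f n) (f (Suc n))" by blast
  define r where "r = (\<lambda>i. fst (f i))"
  \<comment> \<open>Stage n of the recursion is the differential \<open>d (Suc n)\<close>; the value
    \<open>d 0\<close> is a dummy.\<close>
  define d where "d = (\<lambda>i. snd (snd (f (i - 1))))"
  have r_Suc: "r (Suc n) = fst (snd (f n))" for n
    using f(2)[of n] unfolding Q_def r_def by (auto split: prod.splits)
  have fn: "f n = (r n, r (Suc n), d (Suc n))" for n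
    unfolding r_Suc unfolding r_def d_def by simp
  have r0: "r 0 = r0" using f(1)[of 0] unfolding fn P_def by simp
  have dh: "d (Suc n) \<in> module_hom R (power_module R (r (Suc n))) (power_module R (r n))" for n
    using f(1)[of n] unfolding fn P_def by simp
  have dm: "d (Suc n) ` carrier (power_module R (r (Suc n))) \<subseteq> ivec \<mm> (r n)" for n
    using f(1)[of n] unfolding fn P_def by simp
  have d0: "d (Suc 0) ` carrier (power_module R (r (Suc 0))) = {v \<in> carrier (power_module R (r 0)). e v = \<zero>\<^bsub>X\<^esub>}"
    using f(1)[of 0] unfolding fn P_def by simp
  have dx: "d (Suc (Suc n)) ` carrier (power_module R (r (Suc (Suc n)))) =
      {v \<in> carrier (power_module R (r (Suc n))). d (Suc n) v = \<zero>\<^bsub>power_module R (r n)\<^esub>}" for n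
    using f(2)[of n] unfolding fn Q_def by simp
  have "free_resolution R X (r, d, e)"
    unfolding free_resolution_def a_kernel_def' Let_def
    using dh e(1,2) d0 dx r0 by simp
  moreover have "\<forall>i. \<forall>v\<in>carrier (power_module R (r (Suc i))). \<forall>j<r i. d (Suc i) v j \<in> \<mm>"
    using dm unfolding ivec_def by blast
  ultimately have "minimal_free_resolution R X (r, d, e)" unfolding minimal_free_resolution_def by simp
  then show ?thesis ..
qed

lemma free_resolutionD:
  assumes "free_resolution R X (r, d, e)"
  shows "d (Suc i) \<in> module_hom R (power_module R (r (Suc i))) (power_module R (r i))"
    "e \<in> module_hom R (power_module R (r 0)) X"
    "e ` carrier (power_module R (r 0)) = carrier X"
    "{v \<in> carrier (power_module R (r 0)). e v = \<zero>\<^bsub>X\<^esub>} = d (Suc 0) ` carrier (power_module R (r (Suc 0)))"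
    "{v \<in> carrier (power_module R (r (Suc i))). d (Suc i) v = \<zero>\<^bsub>power_module R (r i)\<^esub>} =
      d (Suc (Suc i)) ` carrier (power_module R (r (Suc (Suc i))))"
  using assms unfolding free_resolution_def a_kernel_def' Let_def by simp_all

lemma resolution_complex:
  assumes "free_resolution R X (r, d, e)"
  shows "exact_free_complex R r d"
  by unfold_locales (rule free_resolutionD[OF assms])+

section \<open>Independence of the resolution\<close>

text \<open>Cycles and boundaries of \<open>k \<otimes> F\<close>, pulled back to \<open>F\<close> along \<open>F \<rightarrow> F / \<mm> F = k \<otimes> F\<close>.\<close>

definition cycles :: "(nat \<Rightarrow> nat) \<Rightarrow> (nat \<Rightarrow> (nat \<Rightarrow> 'a) \<Rightarrow> nat \<Rightarrow> 'a) \<Rightarrow> nat \<Rightarrow> (nat \<Rightarrow> 'a) set" where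
  "cycles r d i = {v \<in> carrier (power_module R (r i)). i \<noteq> 0 \<longrightarrow> d i v \<in> ivec \<mm> (r (i - 1))}"

definition boundaries :: "(nat \<Rightarrow> nat) \<Rightarrow> (nat \<Rightarrow> (nat \<Rightarrow> 'a) \<Rightarrow> nat \<Rightarrow> 'a) \<Rightarrow> nat \<Rightarrow> (nat \<Rightarrow> 'a) set" where
  "boundaries r d i =
     msum (power_module R (r i)) (d (Suc i) ` carrier (power_module R (r (Suc i)))) (ivec \<mm> (r i))"

text \<open>Z / B is generated by k elements, the images of the unit vectors under h. For a vector
  space the least such k is the dimension, and this form can be moved along chain maps without
  forming the quotient.\<close>

definition generated_by :: "('a, 'c, 'd) module_scheme \<Rightarrow> 'c set \<Rightarrow> 'c set \<Rightarrow> nat \<Rightarrow> bool" where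
  "generated_by X Z B k \<longleftrightarrow> (\<exists>h\<in>module_hom R (power_module R k) X.
     (\<forall>c\<in>carrier (power_module R k). h c \<in> Z) \<and>
     (\<forall>z\<in>Z. \<exists>c\<in>carrier (power_module R k). z \<ominus>\<^bsub>X\<^esub> h c \<in> B))"

lemma boundaries_submodule:
  assumes "free_resolution R X (r, d, e)"
  shows "submodule R (boundaries r d i) (power_module R (r i))"
    "d (Suc i) ` carrier (power_module R (r (Suc i))) \<subseteq> boundaries r d i"
    "ivec \<mm> (r i) \<subseteq> boundaries r d i"
  unfolding boundaries_def
  using submodule_msum[OF submodule_image[OF module.submodule_carrier[OF pm_module] pm_module
      free_resolutionD(1)[OF assms]] ivec_submodule[OF max_ideal_ideal]]
  by blast+

lemma differential_zero:
  assumes "free_resolution R X (r, d, e)" "v \<in> carrier (power_module R (r (Suc (Suc i))))"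
  shows "d (Suc i) (d (Suc (Suc i)) v) = \<zero>\<^bsub>power_module R (r i)\<^esub>"
  using free_resolutionD(5)[OF assms(1), of i] assms(2) by blast

lemma augmentation_zero:
  assumes "free_resolution R X (r, d, e)" "v \<in> carrier (power_module R (r (Suc 0)))"
  shows "e (d (Suc 0) v) = \<zero>\<^bsub>X\<^esub>"
  using free_resolutionD(4)[OF assms(1)] assms(2) by blast

text \<open>The lift of the identity of X to resolutions, by dependent choice. The invariant
  \<open>H\<close> records that f after d lands in the boundaries of the other resolution, which is
  what the next lift requires.\<close>

lemma chain_map_exists:
  assumes X: "module R X" and P: "free_resolution R X (r, d, e)" and P': "free_resolution R X (r', d', e')"
  shows "\<exists>f. (\<forall>i. f i \<in> module_hom R (power_module R (r i)) (power_module R (r' i))) \<and>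
    (\<forall>v\<in>carrier (power_module R (r 0)). e' (f 0 v) = e v) \<and>
    (\<forall>i. \<forall>v\<in>carrier (power_module R (r (Suc i))). d' (Suc i) (f (Suc i) v) = f i (d (Suc i) v))"
proof -
  note D = free_resolutionD[OF P] and D' = free_resolutionD[OF P']
  define H where "H = (\<lambda>n f. f \<in> module_hom R (power_module R (r n)) (power_module R (r' n)) \<and>
    (\<forall>v\<in>carrier (power_module R (r (Suc n))). f (d (Suc n) v) \<in> d' (Suc n) ` carrier (power_module R (r' (Suc n)))) \<and>
    (n = 0 \<longrightarrow> (\<forall>v\<in>carrier (power_module R (r 0)). e' (f v) = e v)))"
  define Q where "Q = (\<lambda>n f g. \<forall>v\<in>carrier (power_module R (r (Suc n))). d' (Suc n) (g v) = f (d (Suc n) v))"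
  have "\<exists>f. \<forall>n. H n (f n) \<and> Q n (f n) (f (Suc n))"
  proof (rule dependent_nat_choice)
    obtain f where f: "f \<in> module_hom R (power_module R (r 0)) (power_module R (r' 0))"
      "\<And>v. v \<in> carrier (power_module R (r 0)) \<Longrightarrow> e' (f v) = e v"
      using pm_lift[OF X pm_module D(2) D'(2)] module_homD(1)[OF D(2)] unfolding D'(3) by blast
    have "f (d (Suc 0) v) \<in> d' (Suc 0) ` carrier (power_module R (r' (Suc 0)))"
      if v: "v \<in> carrier (power_module R (r (Suc 0)))" for v
    proof -
      have dv: "d (Suc 0) v \<in> carrier (power_module R (r 0))" by (rule module_homD(1)[OF D(1) v])
      have "e' (f (d (Suc 0) v)) = \<zero>\<^bsub>X\<^esub>" unfolding f(2)[OF dv] by (rule augmentation_zero[OF P v])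
      then show ?thesis unfolding D'(4)[symmetric] using module_homD(1)[OF f(1) dv] by blast
    qed
    then have "H 0 f" unfolding H_def using f by blast
    then show "\<exists>f. H 0 f" by (rule exI[of _ f])
  next
    fix f n assume "H n f"
    then have f: "f \<in> module_hom R (power_module R (r n)) (power_module R (r' n))"
      "\<And>v. v \<in> carrier (power_module R (r (Suc n))) \<Longrightarrow> f (d (Suc n) v) \<in> d' (Suc n) ` carrier (power_module R (r' (Suc n)))"
      unfolding H_def by blast+
    obtain g where g: "g \<in> module_hom R (power_module R (r (Suc n))) (power_module R (r' (Suc n)))"
      "\<And>v. v \<in> carrier (power_module R (r (Suc n))) \<Longrightarrow> d' (Suc n) (g v) = f (d (Suc n) v)"
      using pm_lift[OF pm_module pm_module module_hom_comp[OF D(1) f(1)] D'(1)] f(2) by blast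
    have "g (d (Suc (Suc n)) v) \<in> d' (Suc (Suc n)) ` carrier (power_module R (r' (Suc (Suc n))))"
      if v: "v \<in> carrier (power_module R (r (Suc (Suc n))))" for v
    proof -
      have dv: "d (Suc (Suc n)) v \<in> carrier (power_module R (r (Suc n)))" by (rule module_homD(1)[OF D(1) v])
      have "d' (Suc n) (g (d (Suc (Suc n)) v)) = \<zero>\<^bsub>power_module R (r' n)\<^esub>"
        unfolding g(2)[OF dv] differential_zero[OF P v]
        by (rule module_hom_zero_minus(1)[OF pm_module pm_module f(1)])
      then show ?thesis unfolding D'(5)[symmetric] using module_homD(1)[OF g(1) dv] by blast
    qed
    then have "H (Suc n) g \<and> Q n f g" unfolding H_def Q_def using g by blast
    then show "\<exists>g. H (Suc n) g \<and> Q n f g" by (rule exI[of _ g])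
  qed
  then obtain f where f: "\<And>n. H n (f n)" "\<And>n. Q n (f n) (f (Suc n))" by blast
  show ?thesis
  proof (intro exI[of _ f] conjI allI)
    show "f i \<in> module_hom R (power_module R (r i)) (power_module R (r' i))" for i
      using f(1)[of i] unfolding H_def by blast
    show "\<forall>v\<in>carrier (power_module R (r 0)). e' (f 0 v) = e v" using f(1)[of 0] unfolding H_def by blast
    show "\<forall>v\<in>carrier (power_module R (r (Suc i))). d' (Suc i) (f (Suc i) v) = f i (d (Suc i) v)" for i
      using f(2)[of i] unfolding Q_def .
  qed
qed

text \<open>A chain endomorphism lifting zero is null-homotopic, hence zero on homology.\<close>

lemma null_homotopic_boundaries:
  assumes X: "module R X" and P: "free_resolution R X (r, d, e)"
    and u: "\<And>i. u i \<in> module_hom R (power_module R (r i)) (power_module R (r i))"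
    and u0: "\<And>v. v \<in> carrier (power_module R (r 0)) \<Longrightarrow> e (u 0 v) = \<zero>\<^bsub>X\<^esub>"
    and ud: "\<And>i v. v \<in> carrier (power_module R (r (Suc i))) \<Longrightarrow> d (Suc i) (u (Suc i) v) = u i (d (Suc i) v)"
    and v: "v \<in> cycles r d i"
  shows "u i v \<in> boundaries r d i"
proof -
  note D = free_resolutionD[OF P]
  let ?F = "\<lambda>i. power_module R (r i)"
  \<comment> \<open>Only one component of the homotopy is kept per step. On cycles, u - d h is the
    previous component applied to d v, which lies in \<mm> F; in degree 0 it is zero. The second
    conjunct allows the next component to be lifted.\<close>
  have "\<exists>h\<in>module_hom R (?F i) (?F (Suc i)).
      (\<forall>v\<in>cycles r d i. u i v \<ominus>\<^bsub>?F i\<^esub> d (Suc i) (h v) \<in> ivec \<mm> (r i)) \<and>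
      (\<forall>w\<in>carrier (?F (Suc i)). u (Suc i) w \<ominus>\<^bsub>?F (Suc i)\<^esub> h (d (Suc i) w) \<in> d (Suc (Suc i)) ` carrier (?F (Suc (Suc i))))"
  proof (induction i)
    case 0
    interpret F0: module R "?F 0" by (rule pm_module)
    interpret F1: module R "?F (Suc 0)" by (rule pm_module)
    have im: "u 0 v \<in> d (Suc 0) ` carrier (?F (Suc 0))" if "v \<in> carrier (?F 0)" for v
      unfolding D(4)[symmetric] using module_homD(1)[OF u that] u0[OF that] by blast
    obtain h where h: "h \<in> module_hom R (?F 0) (?F (Suc 0))"
      "\<And>v. v \<in> carrier (?F 0) \<Longrightarrow> d (Suc 0) (h v) = u 0 v"
      using pm_lift[OF pm_module pm_module u D(1)] im by blast
    show ?case
    proof (intro bexI[OF _ h(1)] conjI ballI)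
      fix v assume "v \<in> cycles r d 0"
      then have v: "v \<in> carrier (?F 0)" unfolding cycles_def by blast
      have "u 0 v \<ominus>\<^bsub>?F 0\<^esub> d (Suc 0) (h v) = \<zero>\<^bsub>?F 0\<^esub>"
        unfolding h(2)[OF v] F0.M.minus_eq by (rule F0.M.r_neg[OF module_homD(1)[OF u v]])
      then show "u 0 v \<ominus>\<^bsub>?F 0\<^esub> d (Suc 0) (h v) \<in> ivec \<mm> (r 0)"
        using submoduleD(3)[OF ivec_submodule[OF max_ideal_ideal]] by simp
    next
      fix w assume w: "w \<in> carrier (?F (Suc 0))"
      have dw: "d (Suc 0) w \<in> carrier (?F 0)" by (rule module_homD(1)[OF D(1) w])
      have uw: "u (Suc 0) w \<in> carrier (?F (Suc 0))" by (rule module_homD(1)[OF u w])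
      have hw: "h (d (Suc 0) w) \<in> carrier (?F (Suc 0))" by (rule module_homD(1)[OF h(1) dw])
      have "d (Suc 0) (u (Suc 0) w \<ominus>\<^bsub>?F (Suc 0)\<^esub> h (d (Suc 0) w)) = \<zero>\<^bsub>?F 0\<^esub>"
        unfolding module_hom_zero_minus(3)[OF pm_module pm_module D(1) uw hw] ud[OF w] h(2)[OF dw] F0.M.minus_eq
        by (rule F0.M.r_neg[OF module_homD(1)[OF u dw]])
      then show "u (Suc 0) w \<ominus>\<^bsub>?F (Suc 0)\<^esub> h (d (Suc 0) w) \<in> d (Suc (Suc 0)) ` carrier (?F (Suc (Suc 0)))"
        unfolding D(5)[symmetric] using F1.M.minus_closed[OF uw hw] by blast
    qed
  next
    case (Suc i)
    interpret F0: module R "?F i" by (rule pm_module)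
    interpret F1: module R "?F (Suc i)" by (rule pm_module)
    interpret F2: module R "?F (Suc (Suc i))" by (rule pm_module)
    obtain h where h: "h \<in> module_hom R (?F i) (?F (Suc i))"
      "\<And>w. w \<in> carrier (?F (Suc i)) \<Longrightarrow>
        u (Suc i) w \<ominus>\<^bsub>?F (Suc i)\<^esub> h (d (Suc i) w) \<in> d (Suc (Suc i)) ` carrier (?F (Suc (Suc i)))"
      using Suc.IH by blast
    have t: "(\<lambda>w. u (Suc i) w \<ominus>\<^bsub>?F (Suc i)\<^esub> h (d (Suc i) w)) \<in> module_hom R (?F (Suc i)) (?F (Suc i))"
      by (rule module_hom_minus[OF pm_module u module_hom_comp[OF D(1) h(1)]])
    obtain k where k: "k \<in> module_hom R (?F (Suc i)) (?F (Suc (Suc i)))"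
      "\<And>w. w \<in> carrier (?F (Suc i)) \<Longrightarrow> d (Suc (Suc i)) (k w) = u (Suc i) w \<ominus>\<^bsub>?F (Suc i)\<^esub> h (d (Suc i) w)"
      using pm_lift[OF pm_module pm_module t D(1)] h(2) by blast
    \<comment> \<open>As d k = u - h d, the difference u - d k is exactly h d.\<close>
    have cancel: "u (Suc i) w \<ominus>\<^bsub>?F (Suc i)\<^esub> d (Suc (Suc i)) (k w) = h (d (Suc i) w)"
      if w: "w \<in> carrier (?F (Suc i))" for w
    proof -
      have uw: "u (Suc i) w \<in> carrier (?F (Suc i))" by (rule module_homD(1)[OF u w])
      have hw: "h (d (Suc i) w) \<in> carrier (?F (Suc i))"
        by (rule module_homD(1)[OF h(1) module_homD(1)[OF D(1) w]])
      let ?m = "u (Suc i) w \<ominus>\<^bsub>?F (Suc i)\<^esub> h (d (Suc i) w)"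
      have m: "?m \<in> carrier (?F (Suc i))" by (rule F1.M.minus_closed[OF uw hw])
      have "u (Suc i) w = h (d (Suc i) w) \<oplus>\<^bsub>?F (Suc i)\<^esub> ?m" by (rule F1.minus_add_cancel(1)[OF hw uw, symmetric])
      then have "u (Suc i) w \<ominus>\<^bsub>?F (Suc i)\<^esub> ?m = (h (d (Suc i) w) \<oplus>\<^bsub>?F (Suc i)\<^esub> ?m) \<ominus>\<^bsub>?F (Suc i)\<^esub> ?m"
        by (rule arg_cong)
      also have "\<dots> = h (d (Suc i) w)" by (rule F1.minus_add_cancel(3)[OF m hw])
      finally show ?thesis unfolding k(2)[OF w] .
    qed
    show ?case
    proof (intro bexI[OF _ k(1)] conjI ballI)
      fix v assume "v \<in> cycles r d (Suc i)"
      then have v: "v \<in> carrier (?F (Suc i))" "d (Suc i) v \<in> ivec \<mm> (r i)" unfolding cycles_def by simp_all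
      show "u (Suc i) v \<ominus>\<^bsub>?F (Suc i)\<^esub> d (Suc (Suc i)) (k v) \<in> ivec \<mm> (r (Suc i))"
        unfolding cancel[OF v(1)] by (rule hom_ivec[OF max_ideal_ideal h(1) v(2)])
    next
      fix w assume w: "w \<in> carrier (?F (Suc (Suc i)))"
      have dw: "d (Suc (Suc i)) w \<in> carrier (?F (Suc i))" by (rule module_homD(1)[OF D(1) w])
      have uw: "u (Suc (Suc i)) w \<in> carrier (?F (Suc (Suc i)))" by (rule module_homD(1)[OF u w])
      have kw: "k (d (Suc (Suc i)) w) \<in> carrier (?F (Suc (Suc i)))" by (rule module_homD(1)[OF k(1) dw])
      have "d (Suc (Suc i)) (u (Suc (Suc i)) w \<ominus>\<^bsub>?F (Suc (Suc i))\<^esub> k (d (Suc (Suc i)) w)) = \<zero>\<^bsub>?F (Suc i)\<^esub>"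
        unfolding module_hom_zero_minus(3)[OF pm_module pm_module D(1) uw kw] ud[OF w] cancel[OF dw]
          differential_zero[OF P w]
        by (rule module_hom_zero_minus(1)[OF pm_module pm_module h(1)])
      then show "u (Suc (Suc i)) w \<ominus>\<^bsub>?F (Suc (Suc i))\<^esub> k (d (Suc (Suc i)) w)
          \<in> d (Suc (Suc (Suc i))) ` carrier (?F (Suc (Suc (Suc i))))"
        unfolding D(5)[symmetric] using F2.M.minus_closed[OF uw kw] by blast
    qed
  qed
  then obtain h where h: "h \<in> module_hom R (?F i) (?F (Suc i))"
    "u i v \<ominus>\<^bsub>?F i\<^esub> d (Suc i) (h v) \<in> ivec \<mm> (r i)" using v by blast
  interpret F: module R "?F i" by (rule pm_module)
  have vc: "v \<in> carrier (?F i)" using v unfolding cycles_def by blast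
  have hv: "h v \<in> carrier (?F (Suc i))" by (rule module_homD(1)[OF h(1) vc])
  have "d (Suc i) (h v) \<oplus>\<^bsub>?F i\<^esub> (u i v \<ominus>\<^bsub>?F i\<^esub> d (Suc i) (h v)) \<in> boundaries r d i"
    unfolding boundaries_def by (rule msumI[OF imageI[OF hv] h(2)])
  then show ?thesis
    unfolding F.minus_add_cancel(1)[OF module_homD(1)[OF D(1) hv] module_homD(1)[OF u vc]] .
qed

text \<open>With chain maps f and g in both directions, f g - 1 lifts zero and so maps cycles to
  boundaries. Hence the f-images of generators for one resolution generate the homology for the
  other, with the same k.\<close>

lemma generated_by_comparison:
  assumes X: "module R X" and P: "free_resolution R X (r, d, e)" and P': "free_resolution R X (r', d', e')"
    and gen: "generated_by (power_module R (r i)) (cycles r d i) (boundaries r d i) k"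
  shows "generated_by (power_module R (r' i)) (cycles r' d' i) (boundaries r' d' i) k"
proof -
  note D = free_resolutionD[OF P] and D' = free_resolutionD[OF P']
  let ?F = "\<lambda>i. power_module R (r i)" and ?G = "\<lambda>i. power_module R (r' i)"
  obtain f where f: "\<And>i. f i \<in> module_hom R (?F i) (?G i)"
    "\<And>v. v \<in> carrier (?F 0) \<Longrightarrow> e' (f 0 v) = e v"
    "\<And>i v. v \<in> carrier (?F (Suc i)) \<Longrightarrow> d' (Suc i) (f (Suc i) v) = f i (d (Suc i) v)"
    using chain_map_exists[OF X P P'] by blast
  obtain g where g: "\<And>i. g i \<in> module_hom R (?G i) (?F i)"
    "\<And>v. v \<in> carrier (?G 0) \<Longrightarrow> e (g 0 v) = e' v"
    "\<And>i v. v \<in> carrier (?G (Suc i)) \<Longrightarrow> d (Suc i) (g (Suc i) v) = g i (d' (Suc i) v)"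
    using chain_map_exists[OF X P' P] by blast
  interpret X: module R X by fact
  define u where "u = (\<lambda>i v. f i (g i v) \<ominus>\<^bsub>?G i\<^esub> v)"
  have u: "u i \<in> module_hom R (?G i) (?G i)" for i
    unfolding u_def by (rule module_hom_minus[OF pm_module module_hom_comp[OF g(1) f(1)] module_hom_id])
  have gc: "\<And>i v. v \<in> carrier (?G i) \<Longrightarrow> g i v \<in> carrier (?F i)" by (rule module_homD(1)[OF g(1)])
  have fc: "\<And>i v. v \<in> carrier (?F i) \<Longrightarrow> f i v \<in> carrier (?G i)" by (rule module_homD(1)[OF f(1)])
  have null: "u i v \<in> boundaries r' d' i" if "v \<in> cycles r' d' i" for v
  proof (rule null_homotopic_boundaries[OF X P' u _ _ that])
    fix v assume v: "v \<in> carrier (?G 0)"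
    show "e' (u 0 v) = \<zero>\<^bsub>X\<^esub>"
      unfolding u_def module_hom_zero_minus(3)[OF pm_module X D'(2) fc[OF gc[OF v]] v] f(2)[OF gc[OF v]] g(2)[OF v]
        X.M.minus_eq
      by (rule X.M.r_neg[OF module_homD(1)[OF D'(2) v]])
  next
    fix i v assume v: "v \<in> carrier (?G (Suc i))"
    show "d' (Suc i) (u (Suc i) v) = u i (d' (Suc i) v)"
      unfolding u_def module_hom_zero_minus(3)[OF pm_module pm_module D'(1) fc[OF gc[OF v]] v]
        f(3)[OF gc[OF v]] g(3)[OF v] ..
  qed
  have fZ: "f i v \<in> cycles r' d' i" if v: "v \<in> cycles r d i" for v
  proof -
    have vc: "v \<in> carrier (?F i)" using v unfolding cycles_def by blast
    have "d' i (f i v) \<in> ivec \<mm> (r' (i - 1))" if i: "i \<noteq> 0"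
    proof -
      obtain j where j: "i = Suc j" using i by (cases i) auto
      have "d (Suc j) v \<in> ivec \<mm> (r j)" using v unfolding cycles_def j by simp
      then have "f j (d (Suc j) v) \<in> ivec \<mm> (r' j)" by (rule hom_ivec[OF max_ideal_ideal f(1)])
      then show ?thesis unfolding j f(3)[OF vc[unfolded j]] by simp
    qed
    then show ?thesis unfolding cycles_def using fc[OF vc] by blast
  qed
  have gZ: "g i v \<in> cycles r d i" if v: "v \<in> cycles r' d' i" for v
  proof -
    have vc: "v \<in> carrier (?G i)" using v unfolding cycles_def by blast
    have "d i (g i v) \<in> ivec \<mm> (r (i - 1))" if i: "i \<noteq> 0"
    proof -
      obtain j where j: "i = Suc j" using i by (cases i) auto
      have "d' (Suc j) v \<in> ivec \<mm> (r' j)" using v unfolding cycles_def j by simp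
      then have "g j (d' (Suc j) v) \<in> ivec \<mm> (r j)" by (rule hom_ivec[OF max_ideal_ideal g(1)])
      then show ?thesis unfolding j g(3)[OF vc[unfolded j]] by simp
    qed
    then show ?thesis unfolding cycles_def using gc[OF vc] by blast
  qed
  note B' = boundaries_submodule[OF P', of i]
  have fB: "f i v \<in> boundaries r' d' i" if v: "v \<in> boundaries r d i" for v
  proof -
    have "boundaries r d i \<subseteq> {v \<in> carrier (?F i). f i v \<in> boundaries r' d' i}"
      unfolding boundaries_def[of r d]
    proof (rule msum_least[OF submodule_preimage[OF pm_module f(1) B'(1)]]; rule subsetI)
      fix y assume "y \<in> d (Suc i) ` carrier (?F (Suc i))"
      then obtain w where w: "y = d (Suc i) w" "w \<in> carrier (?F (Suc i))" by (rule imageE)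
      have "f i y \<in> d' (Suc i) ` carrier (?G (Suc i))"
        unfolding w(1) f(3)[OF w(2), symmetric] by (rule imageI[OF fc[OF w(2)]])
      then show "y \<in> {v \<in> carrier (?F i). f i v \<in> boundaries r' d' i}"
        using B'(2) module_homD(1)[OF D(1) w(2)] unfolding w(1) by blast
    next
      fix y assume y: "y \<in> ivec \<mm> (r i)"
      have "f i y \<in> ivec \<mm> (r' i)" by (rule hom_ivec[OF max_ideal_ideal f(1) y])
      then show "y \<in> {v \<in> carrier (?F i). f i v \<in> boundaries r' d' i}"
        using B'(3) y unfolding ivec_def by blast
    qed
    then show ?thesis using v by blast
  qed
  obtain h where h: "h \<in> module_hom R (power_module R k) (?F i)"
    "\<And>c. c \<in> carrier (power_module R k) \<Longrightarrow> h c \<in> cycles r d i"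
    "\<And>z. z \<in> cycles r d i \<Longrightarrow> \<exists>c\<in>carrier (power_module R k). z \<ominus>\<^bsub>?F i\<^esub> h c \<in> boundaries r d i"
    using gen unfolding generated_by_def by blast
  interpret G: module R "?G i" by (rule pm_module)
  show ?thesis unfolding generated_by_def
  proof (intro bexI[OF _ module_hom_comp[OF h(1) f(1)]] conjI ballI)
    show "f i (h c) \<in> cycles r' d' i" if "c \<in> carrier (power_module R k)" for c by (rule fZ[OF h(2)[OF that]])
    fix z assume z: "z \<in> cycles r' d' i"
    have zc: "z \<in> carrier (?G i)" using z unfolding cycles_def by blast
    obtain c where c: "g i z \<ominus>\<^bsub>?F i\<^esub> h c \<in> boundaries r d i" "c \<in> carrier (power_module R k)"
      using h(3)[OF gZ[OF z]] by (rule bexE)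
    have hc: "h c \<in> carrier (?F i)" by (rule module_homD(1)[OF h(1) c(2)])
    let ?a = "f i (g i z)" and ?b = "f i (h c)"
    have ab: "?a \<in> carrier (?G i)" "?b \<in> carrier (?G i)" using fc[OF gc[OF zc]] fc[OF hc] .
    have "?a \<ominus>\<^bsub>?G i\<^esub> ?b \<in> boundaries r' d' i"
      using fB[OF c(1)] unfolding module_hom_zero_minus(3)[OF pm_module pm_module f(1) gc[OF zc] hc] .
    from submodule_minus[OF B'(1) this null[OF z]]
    have "(?a \<ominus>\<^bsub>?G i\<^esub> ?b) \<ominus>\<^bsub>?G i\<^esub> (?a \<ominus>\<^bsub>?G i\<^esub> z) \<in> boundaries r' d' i" unfolding u_def .
    \<comment> \<open>With a = f (g z) and b = f (h c), both a - b and a - z are boundaries, and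
      their difference is z - b.\<close>
    moreover have "(?a \<ominus>\<^bsub>?G i\<^esub> ?b) \<ominus>\<^bsub>?G i\<^esub> (?a \<ominus>\<^bsub>?G i\<^esub> z) = z \<ominus>\<^bsub>?G i\<^esub> ?b"
    proof -
      let ?y = "?a \<ominus>\<^bsub>?G i\<^esub> z"
      have y: "?y \<in> carrier (?G i)" by (rule G.M.minus_closed[OF ab(1) zc])
      have e: "?a = ?y \<oplus>\<^bsub>?G i\<^esub> z" by (rule G.minus_add_cancel(2)[OF zc ab(1), symmetric])
      have zb: "z \<ominus>\<^bsub>?G i\<^esub> ?b \<in> carrier (?G i)" by (rule G.M.minus_closed[OF zc ab(2)])
      have "?a \<ominus>\<^bsub>?G i\<^esub> ?b = (?y \<oplus>\<^bsub>?G i\<^esub> z) \<ominus>\<^bsub>?G i\<^esub> ?b" by (rule arg_cong[OF e])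
      also have "\<dots> = ?y \<oplus>\<^bsub>?G i\<^esub> (z \<ominus>\<^bsub>?G i\<^esub> ?b)"
        unfolding G.M.minus_eq by (rule G.M.a_assoc[OF y[unfolded G.M.minus_eq] zc G.M.a_inv_closed[OF ab(2)]])
      finally have s: "?a \<ominus>\<^bsub>?G i\<^esub> ?b = ?y \<oplus>\<^bsub>?G i\<^esub> (z \<ominus>\<^bsub>?G i\<^esub> ?b)" .
      show ?thesis unfolding s by (rule G.minus_add_cancel(4)[OF y zb])
    qed
    ultimately have "z \<ominus>\<^bsub>?G i\<^esub> ?b \<in> boundaries r' d' i" by (rule subst[rotated])
    then show "\<exists>c\<in>carrier (power_module R k). z \<ominus>\<^bsub>?G i\<^esub> f i (h c) \<in> boundaries r' d' i"
      using c(2) by (rule bexI)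
  qed
qed

text \<open>For a minimal resolution every vector is a cycle and the boundaries are \<mm> F, so the
  homology is F / \<mm> F, for which the rank is the least number of generators.\<close>

lemma generated_by_minimal:
  assumes P: "minimal_free_resolution R X (r, d, e)"
  shows "generated_by (power_module R (r i)) (cycles r d i) (boundaries r d i) (r i)"
    "generated_by (power_module R (r i)) (cycles r d i) (boundaries r d i) k \<Longrightarrow> r i \<le> k"
proof -
  have fr: "free_resolution R X (r, d, e)" and mn: "\<And>i v j. v \<in> carrier (power_module R (r (Suc i))) \<Longrightarrow> j < r i \<Longrightarrow> d (Suc i) v j \<in> \<mm>"
    using P unfolding minimal_free_resolution_def by auto
  note D = free_resolutionD[OF fr]
  let ?F = "power_module R (r i)"
  interpret F: module R ?F by (rule pm_module)
  have iv: "submodule R (ivec \<mm> (r i)) ?F" by (rule ivec_submodule[OF max_ideal_ideal])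
  have dm: "d (Suc j) v \<in> ivec \<mm> (r j)" if "v \<in> carrier (power_module R (r (Suc j)))" for j v
    using module_homD(1)[OF D(1) that] mn[OF that] unfolding ivec_def by blast
  have Z: "cycles r d i = carrier ?F"
  proof (cases i)
    case 0
    then show ?thesis unfolding cycles_def by simp
  next
    case (Suc j)
    then show ?thesis unfolding cycles_def using dm by auto
  qed
  have B: "boundaries r d i = ivec \<mm> (r i)"
  proof
    show "boundaries r d i \<subseteq> ivec \<mm> (r i)"
      unfolding boundaries_def by (rule msum_least[OF iv _ subset_refl]) (use dm in blast)
  qed (rule boundaries_submodule(3)[OF fr])
  show "generated_by ?F (cycles r d i) (boundaries r d i) (r i)"
    unfolding generated_by_def Z B
    proof (intro bexI[OF _ module_hom_id] conjI ballI)
      fix z assume z: "z \<in> carrier ?F"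
      have "z \<ominus>\<^bsub>?F\<^esub> z = \<zero>\<^bsub>?F\<^esub>" unfolding F.M.minus_eq by (rule F.M.r_neg[OF z])
      then have "z \<ominus>\<^bsub>?F\<^esub> z \<in> ivec \<mm> (r i)" using submoduleD(3)[OF iv]
        by (rule ssubst[where P = "\<lambda>x. x \<in> ivec \<mm> (r i)"])
      then show "\<exists>c\<in>carrier ?F. z \<ominus>\<^bsub>?F\<^esub> c \<in> ivec \<mm> (r i)" using z by (rule bexI)
    qed
  show "r i \<le> k" if gk: "generated_by ?F (cycles r d i) (boundaries r d i) k"
  proof -
    obtain h where h: "h \<in> module_hom R (power_module R k) ?F"
      "\<And>z. z \<in> carrier ?F \<Longrightarrow> \<exists>c\<in>carrier (power_module R k). z \<ominus>\<^bsub>?F\<^esub> h c \<in> ivec \<mm> (r i)"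
      using gk unfolding generated_by_def Z B by blast
    have "\<forall>j. \<exists>c. c \<in> carrier (power_module R k) \<and> uvec (r i) j \<ominus>\<^bsub>?F\<^esub> h c \<in> ivec \<mm> (r i)"
      using h(2)[OF uvec_closed] by blast
    from choice[OF this] obtain c where
      "\<forall>j. c j \<in> carrier (power_module R k) \<and> uvec (r i) j \<ominus>\<^bsub>?F\<^esub> h (c j) \<in> ivec \<mm> (r i)" ..
    then have c: "c j \<in> carrier (power_module R k)" "uvec (r i) j \<ominus>\<^bsub>?F\<^esub> h (c j) \<in> ivec \<mm> (r i)" for j
      by simp_all
    \<comment> \<open>g sends each unit vector to coefficients that express it modulo \<mm> F, so h
      g is the identity modulo \<mm> F. Thus g is injective modulo \<mm> and the rank of its source
      is at most k.\<close>
    obtain g where g: "g \<in> module_hom R ?F (power_module R k)" "\<And>j. j < r i \<Longrightarrow> g (uvec (r i) j) = c j"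
      using pm_hom_exists[OF pm_module, of "r i" c k] c(1) by blast
    have t: "(\<lambda>v. v \<ominus>\<^bsub>?F\<^esub> h (g v)) \<in> module_hom R ?F ?F"
      by (rule module_hom_minus[OF pm_module module_hom_id module_hom_comp[OF g(1) h(1)]])
    have all: "{v \<in> carrier ?F. v \<ominus>\<^bsub>?F\<^esub> h (g v) \<in> ivec \<mm> (r i)} = carrier ?F"
    proof (rule pm_submodule_eq[OF submodule_preimage[OF pm_module t iv]])
      fix j assume j: "j < r i"
      have "uvec (r i) j \<ominus>\<^bsub>?F\<^esub> h (g (uvec (r i) j)) \<in> ivec \<mm> (r i)" unfolding g(2)[OF j] by (rule c(2))
      then show "uvec (r i) j \<in> {v \<in> carrier ?F. v \<ominus>\<^bsub>?F\<^esub> h (g v) \<in> ivec \<mm> (r i)}" using uvec_closed by blast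
    qed
    show "r i \<le> k"
    proof (rule injective_mod_rank_le[OF max_ideal_prime g(1)])
      fix v assume v: "v \<in> carrier ?F" "g v \<in> ivec \<mm> k"
      have gv: "g v \<in> carrier (power_module R k)" by (rule module_homD(1)[OF g(1) v(1)])
      have "v \<ominus>\<^bsub>?F\<^esub> h (g v) \<in> ivec \<mm> (r i)" using subsetD[OF equalityD2[OF all] v(1)] by blast
      from submoduleD(4)[OF iv hom_ivec[OF max_ideal_ideal h(1) v(2)] this]
      show "v \<in> ivec \<mm> (r i)" unfolding F.minus_add_cancel(1)[OF module_homD(1)[OF h(1) gv] v(1)] .
    qed
  qed
qed

end

section \<open>Free modules on a set\<close>

context cring
begin

lemma free_module_on_submodule:
  "submodule R (carrier (free_module_on R X)) (func_space X)"
proof -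
  interpret F: module R "func_space X" by (rule func_space_is_module)
  have c: "f \<in> carrier (free_module_on R X) \<longleftrightarrow> f \<in> carrier (func_space X) \<and> finite {x \<in> X. f x \<noteq> \<zero>}" for f
    by (simp add: free_module_on_def)
  show ?thesis
  proof (rule submodule.intro[OF F.module_axioms])
    show "carrier (free_module_on R X) \<subseteq> carrier (func_space X)" by (auto simp: c)
    show "\<zero>\<^bsub>func_space X\<^esub> \<in> carrier (free_module_on R X)"
      using F.M.zero_closed unfolding c by (simp add: func_space_def)
  next
    fix f g assume "f \<in> carrier (free_module_on R X)" "g \<in> carrier (free_module_on R X)"
    then have fg: "f \<in> carrier (func_space X)" "g \<in> carrier (func_space X)"
      and fin: "finite ({x \<in> X. f x \<noteq> \<zero>} \<union> {x \<in> X. g x \<noteq> \<zero>})" unfolding c by auto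
    have "{x \<in> X. (f \<oplus>\<^bsub>func_space X\<^esub> g) x \<noteq> \<zero>} \<subseteq> {x \<in> X. f x \<noteq> \<zero>} \<union> {x \<in> X. g x \<noteq> \<zero>}"
      by (auto simp: func_space_def)
    then show "f \<oplus>\<^bsub>func_space X\<^esub> g \<in> carrier (free_module_on R X)"
      unfolding c using F.M.a_closed[OF fg] finite_subset[OF _ fin] by blast
  next
    fix a f assume a: "a \<in> carrier R" and "f \<in> carrier (free_module_on R X)"
    then have f: "f \<in> carrier (func_space X)" and fin: "finite {x \<in> X. f x \<noteq> \<zero>}" unfolding c by auto
    have "{x \<in> X. (a \<odot>\<^bsub>func_space X\<^esub> f) x \<noteq> \<zero>} \<subseteq> {x \<in> X. f x \<noteq> \<zero>}"
      using a by (auto simp: func_space_def)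
    then show "a \<odot>\<^bsub>func_space X\<^esub> f \<in> carrier (free_module_on R X)"
      unfolding c using F.smult_closed[OF a f] finite_subset[OF _ fin] by blast
  qed
qed

lemma free_module_on_module: "module R (free_module_on R X)"
proof -
  have "free_module_on R X = func_space X\<lparr>carrier := carrier (free_module_on R X)\<rparr>"
    by (simp add: free_module_on_def)
  then show ?thesis
    using module.submodule_is_module[OF func_space_is_module free_module_on_submodule, of X] by simp
qed

lemma free_module_on_carrier:
  "f \<in> carrier (free_module_on R X) \<longleftrightarrow>
    (\<forall>x\<in>X. f x \<in> carrier R) \<and> (\<forall>x. x \<notin> X \<longrightarrow> f x = undefined) \<and> finite {x \<in> X. f x \<noteq> \<zero>}"
  by (auto simp: free_module_on_def func_space_def PiE_def Pi_def extensional_def)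

lemma free_module_on_simps:
  "x \<in> X \<Longrightarrow> (f \<oplus>\<^bsub>free_module_on R X\<^esub> g) x = f x \<oplus> g x"
  "x \<in> X \<Longrightarrow> (a \<odot>\<^bsub>free_module_on R X\<^esub> f) x = a \<otimes> f x"
  "x \<in> X \<Longrightarrow> \<zero>\<^bsub>free_module_on R X\<^esub> x = \<zero>"
  by (simp_all add: free_module_on_def func_space_def)

lemma free_module_on_eqI:
  assumes "f \<in> carrier (free_module_on R X)" "g \<in> carrier (free_module_on R X)" "\<And>x. x \<in> X \<Longrightarrow> f x = g x"
  shows "f = g"
proof
  fix x show "f x = g x" using assms by (cases "x \<in> X") (auto simp: free_module_on_carrier)
qed

lemma free_gen_closed: "free_gen R X x \<in> carrier (free_module_on R X)"
proof -
  have "{y \<in> X. free_gen R X x y \<noteq> \<zero>} \<subseteq> {x}" by (auto simp: free_gen_def)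
  then have "finite {y \<in> X. free_gen R X x y \<noteq> \<zero>}" by (rule finite_subset) simp
  then show ?thesis by (auto simp: free_module_on_carrier free_gen_def)
qed

lemma free_module_on_submodule_eq:
  assumes N: "submodule R N (free_module_on R X)" and gen: "\<And>x. x \<in> X \<Longrightarrow> free_gen R X x \<in> N"
  shows "N = carrier (free_module_on R X)"
proof
  note D = submoduleD[OF N]
  let ?F = "free_module_on R X"
  interpret F: module R ?F by (rule D)
  show "N \<subseteq> carrier ?F" by (rule D)
  have "f \<in> N" if "finite S" "f \<in> carrier ?F" "{x \<in> X. f x \<noteq> \<zero>} \<subseteq> S" for f S
    using that
  proof (induction S arbitrary: f rule: finite_induct)
    case empty
    have "f = \<zero>\<^bsub>?F\<^esub>"
      by (rule free_module_on_eqI[OF empty(1) F.M.zero_closed]) (use empty(2) in \<open>auto simp: free_module_on_simps\<close>)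
    then show ?case using D(3) by simp
  next
    case (insert y S)
    show ?case
    proof (cases "y \<in> X")
      case False
      then have "{x \<in> X. f x \<noteq> \<zero>} \<subseteq> S" using insert.prems(2) by blast
      then show ?thesis by (rule insert.IH[OF insert.prems(1)])
    next
      case True
      define g where "g = (\<lambda>x. if x = y then \<zero> else f x)"
      have gS: "{x \<in> X. g x \<noteq> \<zero>} \<subseteq> S" using insert.prems(2) by (auto simp: g_def)
      have g: "g \<in> carrier ?F"
        using insert.prems(1) finite_subset[OF gS insert.hyps(1)] True
        by (auto simp: free_module_on_carrier g_def)
      have fy: "f y \<in> carrier R" using insert.prems(1) True by (auto simp: free_module_on_carrier)
      have "f = g \<oplus>\<^bsub>?F\<^esub> f y \<odot>\<^bsub>?F\<^esub> free_gen R X y"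
      proof (rule free_module_on_eqI[OF insert.prems(1) F.M.a_closed[OF g F.smult_closed[OF fy free_gen_closed]]])
        fix x assume x: "x \<in> X"
        then have "f x \<in> carrier R" using insert.prems(1) by (auto simp: free_module_on_carrier)
        then show "f x = (g \<oplus>\<^bsub>?F\<^esub> f y \<odot>\<^bsub>?F\<^esub> free_gen R X y) x"
          unfolding free_module_on_simps(1)[OF x] free_module_on_simps(2)[OF x]
          using x fy by (simp add: g_def free_gen_def)
      qed
      moreover have "g \<oplus>\<^bsub>?F\<^esub> f y \<odot>\<^bsub>?F\<^esub> free_gen R X y \<in> N"
        by (rule D(4)[OF insert.IH[OF g gS] D(5)[OF fy gen[OF True]]])
      ultimately show ?thesis by (rule ssubst[where P = "\<lambda>h. h \<in> N"])
    qed
  qed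
  then show "carrier ?F \<subseteq> N" using free_module_on_carrier by blast
qed

lemma free_module_on_extend:
  assumes Y: "module R Y" and \<phi>: "\<And>x. x \<in> X \<Longrightarrow> \<phi> x \<in> carrier Y"
  shows "\<exists>L\<in>module_hom R (free_module_on R X) Y. \<forall>x\<in>X. L (free_gen R X x) = \<phi> x"
proof -
  interpret Y: module R Y by fact
  let ?F = "free_module_on R X"
  interpret F: module R ?F by (rule free_module_on_module)
  define s where "s = (\<lambda>f. {x \<in> X. f x \<noteq> \<zero>})"
  define L where "L = (\<lambda>f. finsum Y (\<lambda>x. f x \<odot>\<^bsub>Y\<^esub> \<phi> x) (s f))"
  have fx: "f x \<in> carrier R" if "f \<in> carrier ?F" "x \<in> X" for f x
    using that by (simp add: free_module_on_carrier)
  \<comment> \<open>The sum may be taken over any finite set containing the support; a common such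
    set makes additivity a statement about one index set.\<close>
  have L: "L f = finsum Y (\<lambda>x. f x \<odot>\<^bsub>Y\<^esub> \<phi> x) S" if f: "f \<in> carrier ?F" and S: "finite S" "s f \<subseteq> S" "S \<subseteq> X" for f S
    unfolding L_def
  proof (rule Y.M.add.finprod_mono_neutral_cong_left[OF S(1,2)])
    fix i assume "i \<in> S - s f"
    then have "f i = \<zero>" "i \<in> X" using S(3) unfolding s_def by blast+
    then show "f i \<odot>\<^bsub>Y\<^esub> \<phi> i = \<zero>\<^bsub>Y\<^esub>" using \<phi> by simp
  next
    show "(\<lambda>x. f x \<odot>\<^bsub>Y\<^esub> \<phi> x) \<in> S \<rightarrow> carrier Y" using fx[OF f] \<phi> S(3) by auto
  qed simp
  have fin: "finite (s f)" "s f \<subseteq> X" if "f \<in> carrier ?F" for f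
    using that unfolding s_def by (auto simp: free_module_on_carrier)
  have hom: "L \<in> module_hom R ?F Y"
  proof (rule module_homI)
    show "L f \<in> carrier Y" if f: "f \<in> carrier ?F" for f
      unfolding L_def by (rule Y.M.finsum_closed) (use fx[OF f] \<phi> fin(2)[OF f] in auto)
  next
    fix f g assume f: "f \<in> carrier ?F" and g: "g \<in> carrier ?F"
    let ?S = "s f \<union> s g"
    have S: "finite ?S" "?S \<subseteq> X" using fin[OF f] fin[OF g] by blast+
    have fg: "f \<oplus>\<^bsub>?F\<^esub> g \<in> carrier ?F" by (rule F.M.a_closed[OF f g])
    have sub: "s (f \<oplus>\<^bsub>?F\<^esub> g) \<subseteq> ?S" unfolding s_def by (auto simp: free_module_on_simps)
    have "L (f \<oplus>\<^bsub>?F\<^esub> g) = finsum Y (\<lambda>x. (f \<oplus>\<^bsub>?F\<^esub> g) x \<odot>\<^bsub>Y\<^esub> \<phi> x) ?S"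
      by (rule L[OF fg S(1) sub S(2)])
    also have "\<dots> = finsum Y (\<lambda>x. f x \<odot>\<^bsub>Y\<^esub> \<phi> x \<oplus>\<^bsub>Y\<^esub> g x \<odot>\<^bsub>Y\<^esub> \<phi> x) ?S"
    proof (rule Y.M.finsum_cong')
      fix x assume "x \<in> ?S"
      then have x: "x \<in> X" using S(2) by blast
      show "(f \<oplus>\<^bsub>?F\<^esub> g) x \<odot>\<^bsub>Y\<^esub> \<phi> x = f x \<odot>\<^bsub>Y\<^esub> \<phi> x \<oplus>\<^bsub>Y\<^esub> g x \<odot>\<^bsub>Y\<^esub> \<phi> x"
        unfolding free_module_on_simps(1)[OF x] by (rule Y.smult_l_distr[OF fx[OF f x] fx[OF g x] \<phi>[OF x]])
    qed (use fx[OF f] fx[OF g] \<phi> S(2) in auto)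
    also have "\<dots> = finsum Y (\<lambda>x. f x \<odot>\<^bsub>Y\<^esub> \<phi> x) ?S \<oplus>\<^bsub>Y\<^esub> finsum Y (\<lambda>x. g x \<odot>\<^bsub>Y\<^esub> \<phi> x) ?S"
      by (rule Y.M.finsum_addf) (use fx[OF f] fx[OF g] \<phi> S(2) in auto)
    also have "\<dots> = L f \<oplus>\<^bsub>Y\<^esub> L g"
      unfolding L[OF f S(1) Un_upper1 S(2)] L[OF g S(1) Un_upper2 S(2)] ..
    finally show "L (f \<oplus>\<^bsub>?F\<^esub> g) = L f \<oplus>\<^bsub>Y\<^esub> L g" .
  next
    fix a f assume a: "a \<in> carrier R" and f: "f \<in> carrier ?F"
    have af: "a \<odot>\<^bsub>?F\<^esub> f \<in> carrier ?F" by (rule F.smult_closed[OF a f])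
    have sub: "s (a \<odot>\<^bsub>?F\<^esub> f) \<subseteq> s f" unfolding s_def using a by (auto simp: free_module_on_simps)
    have "L (a \<odot>\<^bsub>?F\<^esub> f) = finsum Y (\<lambda>x. (a \<odot>\<^bsub>?F\<^esub> f) x \<odot>\<^bsub>Y\<^esub> \<phi> x) (s f)"
      by (rule L[OF af fin(1)[OF f] sub fin(2)[OF f]])
    also have "\<dots> = finsum Y (\<lambda>x. a \<odot>\<^bsub>Y\<^esub> (f x \<odot>\<^bsub>Y\<^esub> \<phi> x)) (s f)"
    proof (rule Y.M.finsum_cong')
      fix x assume "x \<in> s f"
      then have x: "x \<in> X" using fin(2)[OF f] by blast
      show "(a \<odot>\<^bsub>?F\<^esub> f) x \<odot>\<^bsub>Y\<^esub> \<phi> x = a \<odot>\<^bsub>Y\<^esub> (f x \<odot>\<^bsub>Y\<^esub> \<phi> x)"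
        unfolding free_module_on_simps(2)[OF x] by (rule Y.smult_assoc1[OF a fx[OF f x] \<phi>[OF x]])
    qed (use fx[OF f] \<phi> fin(2)[OF f] a in auto)
    also have "\<dots> = a \<odot>\<^bsub>Y\<^esub> L f"
      unfolding L_def by (rule Y.finsum_smult[symmetric, OF a]) (use fx[OF f] \<phi> fin(2)[OF f] in auto)
    finally show "L (a \<odot>\<^bsub>?F\<^esub> f) = a \<odot>\<^bsub>Y\<^esub> L f" .
  qed
  have "L (free_gen R X x) = \<phi> x" if x: "x \<in> X" for x
  proof -
    have sub: "s (free_gen R X x) \<subseteq> {x}" unfolding s_def by (auto simp: free_gen_def)
    have "L (free_gen R X x) = finsum Y (\<lambda>y. free_gen R X x y \<odot>\<^bsub>Y\<^esub> \<phi> y) {x}"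
      by (rule L[OF free_gen_closed _ sub]) (use x in auto)
    also have "\<dots> = free_gen R X x x \<odot>\<^bsub>Y\<^esub> \<phi> x"
      using x \<phi>[OF x] by (simp add: free_gen_def)
    also have "\<dots> = \<phi> x" using x \<phi>[OF x] by (simp add: free_gen_def)
    finally show ?thesis .
  qed
  then show ?thesis using hom by blast
qed

section \<open>Tensor products\<close>

lemma tensor_null_submodule:
  assumes A: "module R A" and B: "module R B"
  shows "tensor_relations R A B \<subseteq> carrier (free_module_on R (carrier A \<times> carrier B))"
    "submodule R (tensor_null R A B) (free_module_on R (carrier A \<times> carrier B))"
    "tensor_relations R A B \<subseteq> tensor_null R A B"
proof -
  interpret F: module R "free_module_on R (carrier A \<times> carrier B)" by (rule free_module_on_module)
  show r: "tensor_relations R A B \<subseteq> carrier (free_module_on R (carrier A \<times> carrier B))"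
    unfolding tensor_relations_def Let_def using free_gen_closed[of "carrier A \<times> carrier B"] by auto
  show "submodule R (tensor_null R A B) (free_module_on R (carrier A \<times> carrier B))"
    unfolding tensor_null_def by (rule F.span_is_submodule[OF r])
  show "tensor_relations R A B \<subseteq> tensor_null R A B"
    unfolding tensor_null_def by (rule F.in_own_span[OF r])
qed

lemma tensor_module_module:
  assumes A: "module R A" and B: "module R B"
  shows "module R (tensor_module R A B)"
  unfolding tensor_module_def
  by (rule module.quotient_module_is_module(1)[OF free_module_on_module tensor_null_submodule(2)[OF A B]])

lemma pure_tensor_closed:
  assumes A: "module R A" and B: "module R B"
  shows "pure_tensor R A B x y \<in> carrier (tensor_module R A B)"
  unfolding tensor_module_def pure_tensor_def
    module.quotient_module_ops(1)[OF free_module_on_module tensor_null_submodule(2)[OF A B]]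
  by (rule imageI[OF free_gen_closed])

lemma pure_tensor_bilinear:
  assumes A: "module R A" and B: "module R B"
  shows "\<lbrakk>x \<in> carrier A; y \<in> carrier B; y' \<in> carrier B\<rbrakk> \<Longrightarrow>
      pure_tensor R A B x (y \<oplus>\<^bsub>B\<^esub> y') = pure_tensor R A B x y \<oplus>\<^bsub>tensor_module R A B\<^esub> pure_tensor R A B x y'"
    "\<lbrakk>a \<in> carrier R; x \<in> carrier A; y \<in> carrier B\<rbrakk> \<Longrightarrow>
      pure_tensor R A B (a \<odot>\<^bsub>A\<^esub> x) y = a \<odot>\<^bsub>tensor_module R A B\<^esub> pure_tensor R A B x y"
    "\<lbrakk>a \<in> carrier R; x \<in> carrier A; y \<in> carrier B\<rbrakk> \<Longrightarrow>
      pure_tensor R A B x (a \<odot>\<^bsub>B\<^esub> y) = a \<odot>\<^bsub>tensor_module R A B\<^esub> pure_tensor R A B x y"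
proof -
  let ?X = "carrier A \<times> carrier B"
  let ?F = "free_module_on R ?X"
  interpret F: module R ?F by (rule free_module_on_module)
  note N = tensor_null_submodule[OF A B]
  note Q = F.quotient_module_ops[OF N(2)]
  let ?g = "\<lambda>x y. free_gen R ?X (x, y)"
  have g: "?g x y \<in> carrier ?F" for x y by (rule free_gen_closed)
  show "pure_tensor R A B x (y \<oplus>\<^bsub>B\<^esub> y') = pure_tensor R A B x y \<oplus>\<^bsub>tensor_module R A B\<^esub> pure_tensor R A B x y'"
    if xy: "x \<in> carrier A" "y \<in> carrier B" "y' \<in> carrier B"
  proof -
    have "?g x (y \<oplus>\<^bsub>B\<^esub> y') \<ominus>\<^bsub>?F\<^esub> (?g x y \<oplus>\<^bsub>?F\<^esub> ?g x y') \<in> tensor_relations R A B"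
      unfolding tensor_relations_def Let_def using xy by blast
    from subsetD[OF N(3) this]
    have "tensor_null R A B +>\<^bsub>?F\<^esub> ?g x (y \<oplus>\<^bsub>B\<^esub> y') = tensor_null R A B +>\<^bsub>?F\<^esub> (?g x y \<oplus>\<^bsub>?F\<^esub> ?g x y')"
      using F.coset_eq_iff[OF N(2) g F.M.a_closed[OF g g]] by blast
    then show ?thesis unfolding pure_tensor_def tensor_module_def Q(2)[OF g g] .
  qed
  show "pure_tensor R A B (a \<odot>\<^bsub>A\<^esub> x) y = a \<odot>\<^bsub>tensor_module R A B\<^esub> pure_tensor R A B x y"
    if xy: "a \<in> carrier R" "x \<in> carrier A" "y \<in> carrier B"
  proof -
    have "?g (a \<odot>\<^bsub>A\<^esub> x) y \<ominus>\<^bsub>?F\<^esub> (a \<odot>\<^bsub>?F\<^esub> ?g x y) \<in> tensor_relations R A B"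
      unfolding tensor_relations_def Let_def using xy by blast
    from subsetD[OF N(3) this]
    have "tensor_null R A B +>\<^bsub>?F\<^esub> ?g (a \<odot>\<^bsub>A\<^esub> x) y = tensor_null R A B +>\<^bsub>?F\<^esub> (a \<odot>\<^bsub>?F\<^esub> ?g x y)"
      using F.coset_eq_iff[OF N(2) g F.smult_closed[OF xy(1) g]] by blast
    then show ?thesis unfolding pure_tensor_def tensor_module_def Q(3)[OF xy(1) g] .
  qed
  show "pure_tensor R A B x (a \<odot>\<^bsub>B\<^esub> y) = a \<odot>\<^bsub>tensor_module R A B\<^esub> pure_tensor R A B x y"
    if xy: "a \<in> carrier R" "x \<in> carrier A" "y \<in> carrier B"
  proof -
    have "?g x (a \<odot>\<^bsub>B\<^esub> y) \<ominus>\<^bsub>?F\<^esub> (a \<odot>\<^bsub>?F\<^esub> ?g x y) \<in> tensor_relations R A B"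
      unfolding tensor_relations_def Let_def using xy by blast
    from subsetD[OF N(3) this]
    have "tensor_null R A B +>\<^bsub>?F\<^esub> ?g x (a \<odot>\<^bsub>B\<^esub> y) = tensor_null R A B +>\<^bsub>?F\<^esub> (a \<odot>\<^bsub>?F\<^esub> ?g x y)"
      using F.coset_eq_iff[OF N(2) g F.smult_closed[OF xy(1) g]] by blast
    then show ?thesis unfolding pure_tensor_def tensor_module_def Q(3)[OF xy(1) g] .
  qed
qed

text \<open>Pure tensors generate: pull N back to the free module on pairs, where it contains all
  free generators.\<close>

lemma tensor_submodule_eq:
  assumes A: "module R A" and B: "module R B" and N: "submodule R N (tensor_module R A B)"
    and pure: "\<And>x y. x \<in> carrier A \<Longrightarrow> y \<in> carrier B \<Longrightarrow> pure_tensor R A B x y \<in> N"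
  shows "N = carrier (tensor_module R A B)"
proof
  let ?F = "free_module_on R (carrier A \<times> carrier B)"
  let ?q = "\<lambda>f. tensor_null R A B +>\<^bsub>?F\<^esub> f"
  interpret F: module R ?F by (rule free_module_on_module)
  note T = tensor_null_submodule(2)[OF A B]
  have q: "?q \<in> module_hom R ?F (tensor_module R A B)"
    unfolding tensor_module_def by (rule F.quotient_module_is_module(2)[OF T])
  have all: "{f \<in> carrier ?F. ?q f \<in> N} = carrier ?F"
  proof (rule free_module_on_submodule_eq[OF submodule_preimage[OF free_module_on_module q N]])
    fix z assume z: "z \<in> carrier A \<times> carrier B"
    obtain x y where xy: "z = (x, y)" by (cases z)
    then have "pure_tensor R A B x y \<in> N" using z pure by blast
    then have m: "?q (free_gen R (carrier A \<times> carrier B) (x, y)) \<in> N" unfolding pure_tensor_def .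
    show "free_gen R (carrier A \<times> carrier B) z \<in> {f \<in> carrier ?F. ?q f \<in> N}"
      unfolding xy by (rule CollectI, rule conjI[OF free_gen_closed m])
  qed
  show "N \<subseteq> carrier (tensor_module R A B)" by (rule submoduleD(2)[OF N])
  show "carrier (tensor_module R A B) \<subseteq> N"
  proof
    fix t assume "t \<in> carrier (tensor_module R A B)"
    then obtain f where f: "t = ?q f" "f \<in> carrier ?F"
      unfolding tensor_module_def F.quotient_module_ops(1)[OF T] by (rule imageE)
    show "t \<in> N" unfolding f(1) using subsetD[OF equalityD2[OF all] f(2)] by blast
  qed
qed

end

section \<open>Tensoring with the residue field\<close>

context noetherian_local_ring
begin

abbreviation res_mod :: "('a, 'a set) module" where
  "res_mod \<equiv> quotient_module (ring_module R) \<mm>"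

abbreviation res_tensor :: "nat \<Rightarrow> ('a, ('a set \<times> (nat \<Rightarrow> 'a) \<Rightarrow> 'a) set) module" where
  "res_tensor n \<equiv> tensor_module R res_mod (power_module R n)"

definition coset1 :: "'a set" where "coset1 = \<mm> +>\<^bsub>ring_module R\<^esub> \<one>"

text \<open>The map v to 1 \<otimes> v from F to k \<otimes> F, with \<open>coset1\<close> as the
  unit of k. It turns out to be onto with kernel \<mm> F.\<close>

definition \<pi> :: "nat \<Rightarrow> (nat \<Rightarrow> 'a) \<Rightarrow> ('a set \<times> (nat \<Rightarrow> 'a) \<Rightarrow> 'a) set" where
  "\<pi> n v = pure_tensor R res_mod (power_module R n) coset1 v"

lemma max_ideal_submodule: "submodule R \<mm> (ring_module R)"
  unfolding submodule_ring_module_iff by (rule max_ideal_ideal)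

lemma res_mod_module: "module R res_mod"
  by (rule module.quotient_module_is_module(1)[OF ring_module_module max_ideal_submodule])

lemma res_mod_ops:
  "carrier res_mod = (\<lambda>a. \<mm> +>\<^bsub>ring_module R\<^esub> a) ` carrier R"
  "\<And>a b. a \<in> carrier R \<Longrightarrow> b \<in> carrier R \<Longrightarrow>
    (\<mm> +>\<^bsub>ring_module R\<^esub> a) \<oplus>\<^bsub>res_mod\<^esub> (\<mm> +>\<^bsub>ring_module R\<^esub> b) = \<mm> +>\<^bsub>ring_module R\<^esub> (a \<oplus> b)"
  "\<And>a b. a \<in> carrier R \<Longrightarrow> b \<in> carrier R \<Longrightarrow>
    a \<odot>\<^bsub>res_mod\<^esub> (\<mm> +>\<^bsub>ring_module R\<^esub> b) = \<mm> +>\<^bsub>ring_module R\<^esub> (a \<otimes> b)"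
  by (rule module.quotient_module_ops[OF ring_module_module max_ideal_submodule, unfolded ring_module_simps],
      assumption?, assumption?)+

lemma coset1_closed: "coset1 \<in> carrier res_mod"
  unfolding coset1_def res_mod_ops(1) by (rule imageI[OF one_closed])

lemma res_mod_coset1:
  assumes "x \<in> carrier res_mod"
  obtains a where "a \<in> carrier R" "x = a \<odot>\<^bsub>res_mod\<^esub> coset1"
proof -
  obtain a where a: "x = \<mm> +>\<^bsub>ring_module R\<^esub> a" "a \<in> carrier R"
    using assms unfolding res_mod_ops(1) by (rule imageE)
  have "a \<odot>\<^bsub>res_mod\<^esub> coset1 = x"
    unfolding coset1_def res_mod_ops(3)[OF a(2) one_closed] r_one[OF a(2)] a(1) ..
  then show ?thesis using that[OF a(2)] by simp
qed

lemma res_mod_coset_elem: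
  assumes "a \<in> carrier R" "b \<in> \<mm> +>\<^bsub>ring_module R\<^esub> a"
  obtains h where "h \<in> \<mm>" "b = h \<oplus> a"
  using assms unfolding a_r_coset_def r_coset_def by (auto simp: ring_module_simps)

lemma res_tensor_module: "module R (res_tensor n)"
  by (rule tensor_module_module[OF res_mod_module pm_module])

lemma \<pi>_hom: "\<pi> n \<in> module_hom R (power_module R n) (res_tensor n)"
proof (rule module_homI)
  note b = pure_tensor_bilinear[OF res_mod_module pm_module]
  show "\<pi> n x \<in> carrier (res_tensor n)" for x
    unfolding \<pi>_def by (rule pure_tensor_closed[OF res_mod_module pm_module])
  show "\<pi> n (x \<oplus>\<^bsub>power_module R n\<^esub> y) = \<pi> n x \<oplus>\<^bsub>res_tensor n\<^esub> \<pi> n y"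
    if "x \<in> carrier (power_module R n)" "y \<in> carrier (power_module R n)" for x y
    unfolding \<pi>_def by (rule b(1)[OF coset1_closed that])
  show "\<pi> n (a \<odot>\<^bsub>power_module R n\<^esub> x) = a \<odot>\<^bsub>res_tensor n\<^esub> \<pi> n x"
    if "a \<in> carrier R" "x \<in> carrier (power_module R n)" for a x
    unfolding \<pi>_def by (rule b(3)[OF that(1) coset1_closed that(2)])
qed

lemma pure_tensor_\<pi>:
  assumes a: "a \<in> carrier R" and y: "y \<in> carrier (power_module R n)"
  shows "pure_tensor R res_mod (power_module R n) (a \<odot>\<^bsub>res_mod\<^esub> coset1) y = \<pi> n (a \<odot>\<^bsub>power_module R n\<^esub> y)"
  unfolding \<pi>_def pure_tensor_bilinear(2)[OF res_mod_module pm_module a coset1_closed y]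
    pure_tensor_bilinear(3)[OF res_mod_module pm_module a coset1_closed y] ..

text \<open>The class of 1 generates k over R, and (a 1) \<otimes> y = 1 \<otimes> (a y).\<close>

lemma \<pi>_surj: "\<pi> n ` carrier (power_module R n) = carrier (res_tensor n)"
proof (rule tensor_submodule_eq[OF res_mod_module pm_module
      submodule_image[OF module.submodule_carrier[OF pm_module] res_tensor_module \<pi>_hom]])
  fix x y assume x: "x \<in> carrier res_mod" and y: "y \<in> carrier (power_module R n)"
  obtain a where a: "a \<in> carrier R" "x = a \<odot>\<^bsub>res_mod\<^esub> coset1" by (rule res_mod_coset1[OF x])
  interpret F: module R "power_module R n" by (rule pm_module)
  show "pure_tensor R res_mod (power_module R n) x y \<in> \<pi> n ` carrier (power_module R n)"
    unfolding a(2) pure_tensor_\<pi>[OF a(1) y] by (rule imageI[OF F.smult_closed[OF a(1) y]])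
qed

lemma \<pi>_zero_ivec:
  assumes v: "v \<in> ivec \<mm> n"
  shows "\<pi> n v = \<zero>\<^bsub>res_tensor n\<^esub>"
proof -
  interpret T: module R "res_tensor n" by (rule res_tensor_module)
  interpret K: module R res_mod by (rule res_mod_module)
  interpret F: module R "power_module R n" by (rule pm_module)
  interpret m: ideal \<mm> R by (rule max_ideal_ideal)
  have "ivec \<mm> n \<subseteq> {x \<in> carrier (power_module R n). \<pi> n x \<in> {\<zero>\<^bsub>res_tensor n\<^esub>}}"
  proof (rule ivec_least[OF max_ideal_ideal submodule_preimage[OF pm_module \<pi>_hom T.submodule_zero]])
    fix a i assume a: "a \<in> \<mm>"
    have ac: "a \<in> carrier R" by (rule m.a_Hcarr[OF a])
    have "a \<odot>\<^bsub>res_mod\<^esub> coset1 = \<mm> +>\<^bsub>ring_module R\<^esub> a"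
      unfolding coset1_def res_mod_ops(3)[OF ac one_closed] r_one[OF ac] ..
    also have "\<dots> = \<zero>\<^bsub>res_mod\<^esub>"
      using module.coset_zero_iff[OF ring_module_module max_ideal_submodule, unfolded ring_module_simps, OF ac] a by blast
    also have "\<dots> = \<zero> \<odot>\<^bsub>res_mod\<^esub> coset1" by (rule K.smult_l_null[OF coset1_closed, symmetric])
    finally have e: "a \<odot>\<^bsub>res_mod\<^esub> coset1 = \<zero> \<odot>\<^bsub>res_mod\<^esub> coset1" .
    have "\<pi> n (a \<odot>\<^bsub>power_module R n\<^esub> uvec n i) = pure_tensor R res_mod (power_module R n) (\<zero> \<odot>\<^bsub>res_mod\<^esub> coset1) (uvec n i)"
      unfolding pure_tensor_\<pi>[OF ac uvec_closed, symmetric] e ..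
    also have "\<dots> = \<zero> \<odot>\<^bsub>res_tensor n\<^esub> pure_tensor R res_mod (power_module R n) coset1 (uvec n i)"
      by (rule pure_tensor_bilinear(2)[OF res_mod_module pm_module zero_closed coset1_closed uvec_closed])
    also have "\<dots> = \<zero>\<^bsub>res_tensor n\<^esub>"
      by (rule T.smult_l_null[OF pure_tensor_closed[OF res_mod_module pm_module]])
    finally show "a \<odot>\<^bsub>power_module R n\<^esub> uvec n i \<in> {x \<in> carrier (power_module R n). \<pi> n x \<in> {\<zero>\<^bsub>res_tensor n\<^esub>}}"
      using F.smult_closed[OF ac uvec_closed] by blast
  qed
  then show ?thesis using v by blast
qed

text \<open>Injectivity of \<open>F / \<mm> F \<rightarrow> k \<otimes> F\<close>: on the free module, send \<open>(x, y)\<close> to \<open>a y\<close> for a chosen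
  representative \<open>a\<close> of the coset \<open>x\<close>; the tensor relations land in \<open>\<mm> F\<close>.\<close>

lemma \<pi>_zero_imp_ivec:
  assumes v: "v \<in> carrier (power_module R n)" and 0: "\<pi> n v = \<zero>\<^bsub>res_tensor n\<^esub>"
  shows "v \<in> ivec \<mm> n"
proof -
  let ?P = "power_module R n" and ?X = "carrier res_mod \<times> carrier (power_module R n)"
  let ?F = "free_module_on R ?X"
  interpret K: module R res_mod by (rule res_mod_module)
  interpret P: module R ?P by (rule pm_module)
  interpret F: module R ?F by (rule free_module_on_module)
  interpret m: ideal \<mm> R by (rule max_ideal_ideal)
  define rep where "rep = (\<lambda>x::'a set. SOME a. a \<in> carrier R \<and> x = \<mm> +>\<^bsub>ring_module R\<^esub> a)"
  have rep: "rep x \<in> carrier R" "x = \<mm> +>\<^bsub>ring_module R\<^esub> rep x" if "x \<in> carrier res_mod" for x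
  proof -
    have "\<exists>a. a \<in> carrier R \<and> x = \<mm> +>\<^bsub>ring_module R\<^esub> a" using that unfolding res_mod_ops(1) by blast
    from someI_ex[OF this] show "rep x \<in> carrier R" "x = \<mm> +>\<^bsub>ring_module R\<^esub> rep x" unfolding rep_def by blast+
  qed
  \<comment> \<open>Chosen representatives are neither additive nor linear; they are so up to an
    element of \<mm>, which suffices modulo \<mm> F.\<close>
  have rep_coset: "\<exists>h\<in>\<mm>. rep (\<mm> +>\<^bsub>ring_module R\<^esub> a) = h \<oplus> a" if a: "a \<in> carrier R" for a
  proof -
    let ?x = "\<mm> +>\<^bsub>ring_module R\<^esub> a"
    have x: "?x \<in> carrier res_mod" unfolding res_mod_ops(1) by (rule imageI[OF a])
    have "rep ?x \<in> \<mm> +>\<^bsub>ring_module R\<^esub> rep ?x"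
      by (rule module.coset_self[OF ring_module_module max_ideal_submodule, unfolded ring_module_simps, OF rep(1)[OF x]])
    then have "rep ?x \<in> ?x" unfolding rep(2)[OF x, symmetric] .
    then show ?thesis using res_mod_coset_elem[OF a] by metis
  qed
  have "\<exists>L\<in>module_hom R ?F ?P. \<forall>z\<in>?X. L (free_gen R ?X z) = rep (fst z) \<odot>\<^bsub>?P\<^esub> snd z"
  proof (rule free_module_on_extend[OF pm_module])
    fix z assume "z \<in> ?X"
    then have "fst z \<in> carrier res_mod" "snd z \<in> carrier ?P" by (rule mem_Times_iff[THEN iffD1, THEN conjunct1],
        rule mem_Times_iff[THEN iffD1, THEN conjunct2])
    then show "rep (fst z) \<odot>\<^bsub>?P\<^esub> snd z \<in> carrier ?P" using P.smult_closed[OF rep(1)] by blast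
  qed
  then obtain L where L0: "\<forall>z\<in>?X. L (free_gen R ?X z) = rep (fst z) \<odot>\<^bsub>?P\<^esub> snd z"
    and Lh: "L \<in> module_hom R ?F ?P" by (rule bexE)
  have L2: "L (free_gen R ?X (x, y)) = rep x \<odot>\<^bsub>?P\<^esub> y" if "x \<in> carrier res_mod" "y \<in> carrier ?P" for x y
    using bspec[OF L0 SigmaI[OF that]] unfolding fst_conv snd_conv .
  let ?g = "\<lambda>x y. free_gen R ?X (x, y)"
  have g: "?g x y \<in> carrier ?F" for x y by (rule free_gen_closed)
  have Lm: "L (u \<ominus>\<^bsub>?F\<^esub> w) = L u \<ominus>\<^bsub>?P\<^esub> L w" if "u \<in> carrier ?F" "w \<in> carrier ?F" for u w
    by (rule module_hom_zero_minus(3)[OF free_module_on_module pm_module Lh that])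
  have iv: "submodule R (ivec \<mm> n) ?P" by (rule ivec_submodule[OF max_ideal_ideal])
  have diff: "b \<odot>\<^bsub>?P\<^esub> y \<ominus>\<^bsub>?P\<^esub> c \<odot>\<^bsub>?P\<^esub> y \<in> ivec \<mm> n"
    if h: "\<exists>h\<in>\<mm>. b = h \<oplus> c" and c: "c \<in> carrier R" and y: "y \<in> carrier ?P" for b c y
  proof -
    obtain h where h: "b = h \<oplus> c" "h \<in> \<mm>" using h by (rule bexE)
    have hc: "h \<in> carrier R" by (rule m.a_Hcarr[OF h(2)])
    have "b \<odot>\<^bsub>?P\<^esub> y \<ominus>\<^bsub>?P\<^esub> c \<odot>\<^bsub>?P\<^esub> y = h \<odot>\<^bsub>?P\<^esub> y"
      unfolding h(1) P.smult_l_distr[OF hc c y]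
      by (rule P.minus_add_cancel(3)[OF P.smult_closed[OF c y] P.smult_closed[OF hc y]])
    then show ?thesis using smult_in_ivec[OF max_ideal_ideal h(2) y] by simp
  qed
  have self: "w \<ominus>\<^bsub>?P\<^esub> w \<in> ivec \<mm> n" if "w \<in> carrier ?P" for w
  proof -
    have "w \<ominus>\<^bsub>?P\<^esub> w = \<zero>\<^bsub>?P\<^esub>" unfolding P.M.minus_eq by (rule P.M.r_neg[OF that])
    then show ?thesis using submoduleD(3)[OF iv] by (rule ssubst[where P = "\<lambda>w. w \<in> ivec \<mm> n"])
  qed
  let ?K = "{f \<in> carrier ?F. L f \<in> ivec \<mm> n}"
  have Ks: "submodule R ?K ?F" by (rule submodule_preimage[OF free_module_on_module Lh iv])
  have "tensor_relations R res_mod ?P \<subseteq> ?K"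
  proof
    fix z assume z: "z \<in> tensor_relations R res_mod ?P"
    have zc: "z \<in> carrier ?F" using tensor_null_submodule(1)[OF res_mod_module pm_module] z by blast
    have "L z \<in> ivec \<mm> n" using z unfolding tensor_relations_def Let_def
    proof (elim UnE CollectE exE conjE)
      fix x x' y assume e: "z = ?g (x \<oplus>\<^bsub>res_mod\<^esub> x') y \<ominus>\<^bsub>?F\<^esub> (?g x y \<oplus>\<^bsub>?F\<^esub> ?g x' y)"
        and x: "x \<in> carrier res_mod" and x': "x' \<in> carrier res_mod" and y: "y \<in> carrier ?P"
      have xx: "x \<oplus>\<^bsub>res_mod\<^esub> x' \<in> carrier res_mod" by (rule K.M.a_closed[OF x x'])
      have "x \<oplus>\<^bsub>res_mod\<^esub> x' = \<mm> +>\<^bsub>ring_module R\<^esub> (rep x \<oplus> rep x')"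
        using res_mod_ops(2)[OF rep(1)[OF x] rep(1)[OF x']] unfolding rep(2)[OF x, symmetric] rep(2)[OF x', symmetric] .
      then have r: "\<exists>h\<in>\<mm>. rep (x \<oplus>\<^bsub>res_mod\<^esub> x') = h \<oplus> (rep x \<oplus> rep x')"
        using rep_coset[OF a_closed[OF rep(1)[OF x] rep(1)[OF x']]] by simp
      have "L z = rep (x \<oplus>\<^bsub>res_mod\<^esub> x') \<odot>\<^bsub>?P\<^esub> y \<ominus>\<^bsub>?P\<^esub> (rep x \<oplus> rep x') \<odot>\<^bsub>?P\<^esub> y"
        unfolding e Lm[OF g F.M.a_closed[OF g g]] module_homD(2)[OF Lh g g] L2[OF xx y] L2[OF x y] L2[OF x' y]
          P.smult_l_distr[OF rep(1)[OF x] rep(1)[OF x'] y] ..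
      then show "L z \<in> ivec \<mm> n" using diff[OF r a_closed[OF rep(1)[OF x] rep(1)[OF x']] y] by simp
    next
      fix x y y' assume e: "z = ?g x (y \<oplus>\<^bsub>?P\<^esub> y') \<ominus>\<^bsub>?F\<^esub> (?g x y \<oplus>\<^bsub>?F\<^esub> ?g x y')"
        and x: "x \<in> carrier res_mod" and y: "y \<in> carrier ?P" and y': "y' \<in> carrier ?P"
      have "L z = rep x \<odot>\<^bsub>?P\<^esub> (y \<oplus>\<^bsub>?P\<^esub> y') \<ominus>\<^bsub>?P\<^esub> rep x \<odot>\<^bsub>?P\<^esub> (y \<oplus>\<^bsub>?P\<^esub> y')"
        unfolding e Lm[OF g F.M.a_closed[OF g g]] module_homD(2)[OF Lh g g] L2[OF x P.M.a_closed[OF y y']]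
          L2[OF x y] L2[OF x y'] P.smult_r_distr[OF rep(1)[OF x] y y'] ..
      then show "L z \<in> ivec \<mm> n" using self[OF P.smult_closed[OF rep(1)[OF x] P.M.a_closed[OF y y']]]
        by (rule ssubst[where P = "\<lambda>w. w \<in> ivec \<mm> n"])
    next
      fix a x y assume e: "z = ?g (a \<odot>\<^bsub>res_mod\<^esub> x) y \<ominus>\<^bsub>?F\<^esub> (a \<odot>\<^bsub>?F\<^esub> ?g x y)"
        and a: "a \<in> carrier R" and x: "x \<in> carrier res_mod" and y: "y \<in> carrier ?P"
      have ax: "a \<odot>\<^bsub>res_mod\<^esub> x \<in> carrier res_mod" by (rule K.smult_closed[OF a x])
      have arc: "a \<otimes> rep x \<in> carrier R" by (rule m_closed[OF a rep(1)[OF x]])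
      have "a \<odot>\<^bsub>res_mod\<^esub> x = \<mm> +>\<^bsub>ring_module R\<^esub> (a \<otimes> rep x)"
        using res_mod_ops(3)[OF a rep(1)[OF x]] unfolding rep(2)[OF x, symmetric] .
      then have r: "\<exists>h\<in>\<mm>. rep (a \<odot>\<^bsub>res_mod\<^esub> x) = h \<oplus> (a \<otimes> rep x)"
        using rep_coset[OF arc] by simp
      have "L z = rep (a \<odot>\<^bsub>res_mod\<^esub> x) \<odot>\<^bsub>?P\<^esub> y \<ominus>\<^bsub>?P\<^esub> (a \<otimes> rep x) \<odot>\<^bsub>?P\<^esub> y"
        unfolding e Lm[OF g F.smult_closed[OF a g]] module_homD(3)[OF Lh a g] L2[OF ax y] L2[OF x y]
          P.smult_assoc1[OF a rep(1)[OF x] y] ..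
      then show "L z \<in> ivec \<mm> n" using diff[OF r arc y] by simp
    next
      fix a x y assume e: "z = ?g x (a \<odot>\<^bsub>?P\<^esub> y) \<ominus>\<^bsub>?F\<^esub> (a \<odot>\<^bsub>?F\<^esub> ?g x y)"
        and a: "a \<in> carrier R" and x: "x \<in> carrier res_mod" and y: "y \<in> carrier ?P"
      have ay: "a \<odot>\<^bsub>?P\<^esub> y \<in> carrier ?P" by (rule P.smult_closed[OF a y])
      have c: "a \<odot>\<^bsub>?P\<^esub> (rep x \<odot>\<^bsub>?P\<^esub> y) = rep x \<odot>\<^bsub>?P\<^esub> (a \<odot>\<^bsub>?P\<^esub> y)"
        unfolding P.smult_assoc1[OF a rep(1)[OF x] y, symmetric] P.smult_assoc1[OF rep(1)[OF x] a y, symmetric]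
          m_comm[OF a rep(1)[OF x]] ..
      have "L z = rep x \<odot>\<^bsub>?P\<^esub> (a \<odot>\<^bsub>?P\<^esub> y) \<ominus>\<^bsub>?P\<^esub> rep x \<odot>\<^bsub>?P\<^esub> (a \<odot>\<^bsub>?P\<^esub> y)"
        unfolding e Lm[OF g F.smult_closed[OF a g]] module_homD(3)[OF Lh a g] L2[OF x ay] L2[OF x y] c ..
      then show "L z \<in> ivec \<mm> n" using self[OF P.smult_closed[OF rep(1)[OF x] ay]]
        by (rule ssubst[where P = "\<lambda>w. w \<in> ivec \<mm> n"])
    qed
    then show "z \<in> ?K" using zc by blast
  qed
  then have null: "tensor_null R res_mod ?P \<subseteq> ?K"
    unfolding tensor_null_def by (rule F.span_is_subset[OF _ Ks])
  have "?g coset1 v \<in> tensor_null R res_mod ?P"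
    using 0 F.coset_zero_iff[OF tensor_null_submodule(2)[OF res_mod_module pm_module] g]
    unfolding \<pi>_def pure_tensor_def tensor_module_def by blast
  \<comment> \<open>The representative of the class of 1 need not be 1. It differs from 1 by an
    element of \<mm>, so v itself follows to be in \<mm> F.\<close>
  then have rv: "rep coset1 \<odot>\<^bsub>?P\<^esub> v \<in> ivec \<mm> n" using null L2[OF coset1_closed v] by auto
  have "\<exists>h\<in>\<mm>. rep coset1 = h \<oplus> \<one>" unfolding coset1_def by (rule rep_coset[OF one_closed])
  from diff[OF this one_closed v]
  have "rep coset1 \<odot>\<^bsub>?P\<^esub> v \<ominus>\<^bsub>?P\<^esub> v \<in> ivec \<mm> n" unfolding P.smult_one[OF v] .
  from submodule_minus[OF iv rv this]
  have w: "rep coset1 \<odot>\<^bsub>?P\<^esub> v \<ominus>\<^bsub>?P\<^esub> (rep coset1 \<odot>\<^bsub>?P\<^esub> v \<ominus>\<^bsub>?P\<^esub> v) \<in> ivec \<mm> n" .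
  let ?r = "rep coset1 \<odot>\<^bsub>?P\<^esub> v"
  have rc: "?r \<in> carrier ?P" by (rule P.smult_closed[OF rep(1)[OF coset1_closed] v])
  have d: "?r \<ominus>\<^bsub>?P\<^esub> v \<in> carrier ?P" by (rule P.M.minus_closed[OF rc v])
  have "?r = (?r \<ominus>\<^bsub>?P\<^esub> v) \<oplus>\<^bsub>?P\<^esub> v" by (rule P.minus_add_cancel(2)[OF v rc, symmetric])
  then have "?r \<ominus>\<^bsub>?P\<^esub> (?r \<ominus>\<^bsub>?P\<^esub> v) = ((?r \<ominus>\<^bsub>?P\<^esub> v) \<oplus>\<^bsub>?P\<^esub> v) \<ominus>\<^bsub>?P\<^esub> (?r \<ominus>\<^bsub>?P\<^esub> v)" by (rule arg_cong)
  also have "\<dots> = v" by (rule P.minus_add_cancel(4)[OF d v])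
  finally show ?thesis using w by (rule subst[where P = "\<lambda>w. w \<in> ivec \<mm> n"])
qed

lemma \<pi>_eq_iff:
  assumes v: "v \<in> carrier (power_module R n)" and w: "w \<in> carrier (power_module R n)"
  shows "\<pi> n v = \<pi> n w \<longleftrightarrow> v \<ominus>\<^bsub>power_module R n\<^esub> w \<in> ivec \<mm> n"
proof -
  interpret T: module R "res_tensor n" by (rule res_tensor_module)
  interpret P: module R "power_module R n" by (rule pm_module)
  have "\<pi> n (v \<ominus>\<^bsub>power_module R n\<^esub> w) = \<pi> n v \<ominus>\<^bsub>res_tensor n\<^esub> \<pi> n w"
    by (rule module_hom_zero_minus(3)[OF pm_module res_tensor_module \<pi>_hom v w])
  moreover have "\<pi> n v \<ominus>\<^bsub>res_tensor n\<^esub> \<pi> n w = \<zero>\<^bsub>res_tensor n\<^esub> \<longleftrightarrow> \<pi> n v = \<pi> n w"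
    by (rule T.M.minus_other_side[OF module_homD(1)[OF \<pi>_hom v] module_homD(1)[OF \<pi>_hom w]])
  moreover have "\<pi> n (v \<ominus>\<^bsub>power_module R n\<^esub> w) = \<zero>\<^bsub>res_tensor n\<^esub> \<longleftrightarrow> v \<ominus>\<^bsub>power_module R n\<^esub> w \<in> ivec \<mm> n"
    using \<pi>_zero_ivec \<pi>_zero_imp_ivec[OF P.M.minus_closed[OF v w]] by blast
  ultimately show ?thesis by simp
qed

text \<open>The choice in \<open>tensor_map\<close> has a witness: lift along \<pi>, apply d, and
  return by \<pi>. This is independent of the lift since d maps \<mm> F into \<mm> F. The chosen map
  may be another one, but its values on the 1 \<otimes> v are prescribed.\<close>

lemma tensor_map_\<pi>:
  assumes d: "d \<in> module_hom R (power_module R a) (power_module R b)"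
  defines "D \<equiv> tensor_map R res_mod (power_module R a) (power_module R b) d"
  shows "D \<in> module_hom R (res_tensor a) (res_tensor b)"
    "\<And>v. v \<in> carrier (power_module R a) \<Longrightarrow> D (\<pi> a v) = \<pi> b (d v)"
proof -
  let ?A = "power_module R a" and ?B = "power_module R b"
  interpret A: module R ?A by (rule pm_module)
  interpret B: module R ?B by (rule pm_module)
  interpret TA: module R "res_tensor a" by (rule res_tensor_module)
  define lift where "lift = (\<lambda>t. SOME v. v \<in> carrier ?A \<and> \<pi> a v = t)"
  define h where "h = (\<lambda>t. \<pi> b (d (lift t)))"
  have lift: "lift (\<pi> a v) \<in> carrier ?A \<and> \<pi> a (lift (\<pi> a v)) = \<pi> a v" if "v \<in> carrier ?A" for v
    unfolding lift_def by (rule someI[of _ v]) (simp add: that)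
  have h: "h (\<pi> a v) = \<pi> b (d v)" if v: "v \<in> carrier ?A" for v
  proof -
    let ?w = "lift (\<pi> a v)"
    have w: "?w \<in> carrier ?A" "\<pi> a ?w = \<pi> a v" using lift[OF v] by blast+
    have "?w \<ominus>\<^bsub>?A\<^esub> v \<in> ivec \<mm> a" using \<pi>_eq_iff[OF w(1) v] w(2) by blast
    then have "d (?w \<ominus>\<^bsub>?A\<^esub> v) \<in> ivec \<mm> b" by (rule hom_ivec[OF max_ideal_ideal d])
    then have "d ?w \<ominus>\<^bsub>?B\<^esub> d v \<in> ivec \<mm> b" unfolding module_hom_zero_minus(3)[OF pm_module pm_module d w(1) v] .
    then show ?thesis unfolding h_def
      using \<pi>_eq_iff[OF module_homD(1)[OF d w(1)] module_homD(1)[OF d v]] by blast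
  qed
  have ex: "\<exists>v. t = \<pi> a v \<and> v \<in> carrier ?A" if "t \<in> carrier (res_tensor a)" for t
    using that unfolding \<pi>_surj[symmetric] by blast
  have dc: "\<And>v. v \<in> carrier ?A \<Longrightarrow> d v \<in> carrier ?B" by (rule module_homD(1)[OF d])
  have hh: "h \<in> module_hom R (res_tensor a) (res_tensor b)"
  proof (rule module_homI)
    fix t assume "t \<in> carrier (res_tensor a)"
    then obtain v where v: "t = \<pi> a v" "v \<in> carrier ?A" using ex by blast
    show "h t \<in> carrier (res_tensor b)" unfolding v(1) h[OF v(2)] by (rule module_homD(1)[OF \<pi>_hom dc[OF v(2)]])
  next
    fix t s assume "t \<in> carrier (res_tensor a)" "s \<in> carrier (res_tensor a)"
    then obtain v w where v: "t = \<pi> a v" "v \<in> carrier ?A" and w: "s = \<pi> a w" "w \<in> carrier ?A" using ex by blast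
    show "h (t \<oplus>\<^bsub>res_tensor a\<^esub> s) = h t \<oplus>\<^bsub>res_tensor b\<^esub> h s"
      unfolding v(1) w(1) module_homD(2)[OF \<pi>_hom v(2) w(2), symmetric] h[OF v(2)] h[OF w(2)]
        h[OF A.M.a_closed[OF v(2) w(2)]] module_homD(2)[OF d v(2) w(2)]
      by (rule module_homD(2)[OF \<pi>_hom dc[OF v(2)] dc[OF w(2)]])
  next
    fix c t assume c: "c \<in> carrier R" and "t \<in> carrier (res_tensor a)"
    then obtain v where v: "t = \<pi> a v" "v \<in> carrier ?A" using ex by blast
    show "h (c \<odot>\<^bsub>res_tensor a\<^esub> t) = c \<odot>\<^bsub>res_tensor b\<^esub> h t"
      unfolding v(1) module_homD(3)[OF \<pi>_hom c v(2), symmetric] h[OF v(2)]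
        h[OF A.smult_closed[OF c v(2)]] module_homD(3)[OF d c v(2)]
      by (rule module_homD(3)[OF \<pi>_hom c dc[OF v(2)]])
  qed
  have hp: "\<forall>x\<in>carrier res_mod. \<forall>y\<in>carrier ?A. h (pure_tensor R res_mod ?A x y) = pure_tensor R res_mod ?B x (d y)"
  proof (intro ballI)
    fix x y assume x: "x \<in> carrier res_mod" and y: "y \<in> carrier ?A"
    obtain c where c: "c \<in> carrier R" "x = c \<odot>\<^bsub>res_mod\<^esub> coset1" by (rule res_mod_coset1[OF x])
    show "h (pure_tensor R res_mod ?A x y) = pure_tensor R res_mod ?B x (d y)"
      unfolding c(2) pure_tensor_\<pi>[OF c(1) y] pure_tensor_\<pi>[OF c(1) dc[OF y]]
        h[OF A.smult_closed[OF c(1) y]] module_homD(3)[OF d c(1) y] ..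
  qed
  have "D \<in> module_hom R (res_tensor a) (res_tensor b) \<and>
    (\<forall>x\<in>carrier res_mod. \<forall>y\<in>carrier ?A. D (pure_tensor R res_mod ?A x y) = pure_tensor R res_mod ?B x (d y))"
    unfolding D_def tensor_map_def by (rule someI[of _ h]) (use hh hp in blast)
  then show "D \<in> module_hom R (res_tensor a) (res_tensor b)"
    "\<And>v. v \<in> carrier (power_module R a) \<Longrightarrow> D (\<pi> a v) = \<pi> b (d v)"
    unfolding \<pi>_def using coset1_closed by blast+
qed

end

section \<open>Betti numbers\<close>

text \<open>Reconciles the dimension, the least size of a spanning set, with the least length of a
  generating family: a family of length k may repeat elements, so its set has size at most
  k.\<close>

lemma Least_cofinal_eq:
  fixes P Q :: "nat \<Rightarrow> bool"
  assumes "\<And>n. P n \<Longrightarrow> Q n" "\<And>k. Q k \<Longrightarrow> \<exists>n\<le>k. P n" "Q k"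
  shows "(LEAST n. P n) = (LEAST n. Q n)"
proof (rule antisym)
  have "Q (LEAST n. Q n)" by (rule LeastI[of Q, OF assms(3)])
  then obtain n where n: "n \<le> (LEAST n. Q n)" "P n" using assms(2) by blast
  show "(LEAST n. P n) \<le> (LEAST n. Q n)" by (rule le_trans[OF Least_le[of P, OF n(2)] n(1)])
  show "(LEAST n. Q n) \<le> (LEAST n. P n)" by (rule Least_le[of Q, OF assms(1)[OF LeastI[of P, OF n(2)]]])
qed

context noetherian_local_ring
begin

text \<open>T is a copy of Z / B through \<rho>, and \<mm> kills it, so it is a vector space over
  the residue field. R-linear and residue-field-linear combinations in it are the same, which
  matches spanning sets with generating families.\<close>

lemma dim_over_quotient:
  fixes X :: "('a, 'c, 'd) module_scheme" and T :: "('a, 't, 'u) module_scheme"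
  assumes X: "module R X" and Z: "submodule R Z X" and B: "submodule R B X"
    and mZ: "\<And>a z. a \<in> \<mm> \<Longrightarrow> z \<in> Z \<Longrightarrow> a \<odot>\<^bsub>X\<^esub> z \<in> B"
    and onto: "\<rho> ` Z = carrier T"
    and add: "\<And>x y. x \<in> Z \<Longrightarrow> y \<in> Z \<Longrightarrow> \<rho> (x \<oplus>\<^bsub>X\<^esub> y) = \<rho> x \<oplus>\<^bsub>T\<^esub> \<rho> y"
    and smult: "\<And>a x. a \<in> carrier R \<Longrightarrow> x \<in> Z \<Longrightarrow> \<rho> (a \<odot>\<^bsub>X\<^esub> x) = a \<odot>\<^bsub>T\<^esub> \<rho> x"
    and ker: "\<And>x. x \<in> Z \<Longrightarrow> \<rho> x = \<zero>\<^bsub>T\<^esub> \<longleftrightarrow> x \<in> B"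
    and gen: "generated_by X Z B k0"
  shows "vectorspace.dim (residue_field R) (over_quotient T) = (LEAST k. generated_by X Z B k)"
proof -
  interpret X: module R X by fact
  interpret m: maximalideal \<mm> R by (rule max_ideal_maximal)
  note ZD = submoduleD[OF Z] and BD = submoduleD[OF B]
  have \<rho>0: "\<rho> \<zero>\<^bsub>X\<^esub> = \<zero>\<^bsub>T\<^esub>" using ker[OF ZD(3)] BD(3) by blast
  have T: "module R T"
    by (rule module_surj_image[OF X.submodule_is_module[OF Z], of \<rho>]) (simp_all add: onto add smult \<rho>0)
  interpret T: module R T by (rule T)
  let ?K = "residue_field R" and ?V = "over_quotient T"
  have cT: "\<rho> z \<in> carrier T" if "z \<in> Z" for z using onto that by blast
  have exZ: "\<exists>z. t = \<rho> z \<and> z \<in> Z" if "t \<in> carrier T" for t using that unfolding onto[symmetric] by blast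
  have V: "carrier ?V = carrier T" "\<zero>\<^bsub>?V\<^esub> = \<zero>\<^bsub>T\<^esub>" "\<And>x y. x \<oplus>\<^bsub>?V\<^esub> y = x \<oplus>\<^bsub>T\<^esub> y"
    by (simp_all add: over_quotient_def)
  have mT: "h \<odot>\<^bsub>T\<^esub> t = \<zero>\<^bsub>T\<^esub>" if h: "h \<in> \<mm>" and t: "t \<in> carrier T" for h t
  proof -
    obtain z where z: "t = \<rho> z" "z \<in> Z" using exZ[OF t] by blast
    have hc: "h \<in> carrier R" by (rule m.a_Hcarr[OF h])
    show ?thesis unfolding z(1) smult[OF hc z(2), symmetric]
      using ker[OF ZD(5)[OF hc z(2)]] mZ[OF h z(2)] by blast
  qed
  \<comment> \<open>The representative picked by \<open>over_quotient\<close> is a plus some h in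
    \<mm>, and h acts as zero.\<close>
  have key: "(\<mm> +> a) \<odot>\<^bsub>?V\<^esub> t = a \<odot>\<^bsub>T\<^esub> t" if a: "a \<in> carrier R" and t: "t \<in> carrier T" for a t
  proof -
    define b where "b = (SOME b. b \<in> \<mm> +> a)"
    have "b \<in> \<mm> +> a" unfolding b_def by (rule someI[of _ a]) (rule m.a_rcos_self[OF a])
    then obtain h where h: "h \<in> \<mm>" "b = h \<oplus> a" unfolding a_r_coset_def r_coset_def by auto
    have hc: "h \<in> carrier R" by (rule m.a_Hcarr[OF h(1)])
    have "(\<mm> +> a) \<odot>\<^bsub>?V\<^esub> t = b \<odot>\<^bsub>T\<^esub> t" by (simp add: over_quotient_def b_def)
    also have "\<dots> = h \<odot>\<^bsub>T\<^esub> t \<oplus>\<^bsub>T\<^esub> a \<odot>\<^bsub>T\<^esub> t" unfolding h(2) by (rule T.smult_l_distr[OF hc a t])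
    also have "\<dots> = a \<odot>\<^bsub>T\<^esub> t" unfolding mT[OF h(1) t] by (rule T.M.l_zero[OF T.smult_closed[OF a t]])
    finally show ?thesis .
  qed
  have Kel: "\<exists>a. c = \<mm> +> a \<and> a \<in> carrier R" if "c \<in> carrier ?K" for c
    using that unfolding FactRing_def A_RCOSETS_def' by auto
  have Kadd: "(\<mm> +> a) \<oplus>\<^bsub>?K\<^esub> (\<mm> +> b) = \<mm> +> (a \<oplus> b)" if "a \<in> carrier R" "b \<in> carrier R" for a b
    using m.a_rcos_sum[OF that] by (simp add: FactRing_def)
  have Kmult: "(\<mm> +> a) \<otimes>\<^bsub>?K\<^esub> (\<mm> +> b) = \<mm> +> (a \<otimes> b)" if "a \<in> carrier R" "b \<in> carrier R" for a b
    using m.rcoset_mult_add[OF that] by (simp add: FactRing_def)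
  have Kone: "\<one>\<^bsub>?K\<^esub> = \<mm> +> \<one>" by (simp add: FactRing_def)
  have fK: "field ?K" by (rule m.quotient_is_field[OF is_cring])
  have VM: "module ?K ?V"
  proof (rule module_criteria)
    show "cring ?K" by (rule m.quotient_is_cring[OF is_cring])
    show "\<zero>\<^bsub>?V\<^esub> \<in> carrier ?V" unfolding V by (rule T.M.zero_closed)
    show "\<forall>v w. v \<in> carrier ?V \<and> w \<in> carrier ?V \<longrightarrow> v \<oplus>\<^bsub>?V\<^esub> w \<in> carrier ?V"
      unfolding V using T.M.a_closed by blast
    show "\<forall>v\<in>carrier ?V. \<exists>neg_v\<in>carrier ?V. v \<oplus>\<^bsub>?V\<^esub> neg_v = \<zero>\<^bsub>?V\<^esub>"
      unfolding V using T.M.r_neg T.M.a_inv_closed by blast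
    show "\<forall>c v. c \<in> carrier ?K \<and> v \<in> carrier ?V \<longrightarrow> c \<odot>\<^bsub>?V\<^esub> v \<in> carrier ?V"
    proof (intro allI impI, elim conjE)
      fix c v assume "c \<in> carrier ?K" "v \<in> carrier ?V"
      then obtain a where a: "c = \<mm> +> a" "a \<in> carrier R" and v: "v \<in> carrier T" using Kel V(1) by blast
      show "c \<odot>\<^bsub>?V\<^esub> v \<in> carrier ?V" unfolding a(1) key[OF a(2) v] V(1) by (rule T.smult_closed[OF a(2) v])
    qed
    show "\<forall>v w. v \<in> carrier ?V \<and> w \<in> carrier ?V \<longrightarrow> v \<oplus>\<^bsub>?V\<^esub> w = w \<oplus>\<^bsub>?V\<^esub> v"
      unfolding V using T.M.a_comm by blast
    show "\<forall>v w x. v \<in> carrier ?V \<and> w \<in> carrier ?V \<and> x \<in> carrier ?V \<longrightarrow>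
        v \<oplus>\<^bsub>?V\<^esub> w \<oplus>\<^bsub>?V\<^esub> x = v \<oplus>\<^bsub>?V\<^esub> (w \<oplus>\<^bsub>?V\<^esub> x)"
      unfolding V using T.M.a_assoc by blast
    show "\<forall>v\<in>carrier ?V. v \<oplus>\<^bsub>?V\<^esub> \<zero>\<^bsub>?V\<^esub> = v" unfolding V using T.M.r_zero by blast
    show "\<forall>a b v. a \<in> carrier ?K \<and> b \<in> carrier ?K \<and> v \<in> carrier ?V \<longrightarrow>
        (a \<otimes>\<^bsub>?K\<^esub> b) \<odot>\<^bsub>?V\<^esub> v = a \<odot>\<^bsub>?V\<^esub> (b \<odot>\<^bsub>?V\<^esub> v)"
    proof (intro allI impI, elim conjE)
      fix c c' v assume "c \<in> carrier ?K" "c' \<in> carrier ?K" "v \<in> carrier ?V"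
      then obtain a b where a: "c = \<mm> +> a" "a \<in> carrier R" and b: "c' = \<mm> +> b" "b \<in> carrier R"
        and v: "v \<in> carrier T" using Kel V(1) by blast
      show "(c \<otimes>\<^bsub>?K\<^esub> c') \<odot>\<^bsub>?V\<^esub> v = c \<odot>\<^bsub>?V\<^esub> (c' \<odot>\<^bsub>?V\<^esub> v)"
        unfolding a(1) b(1) Kmult[OF a(2) b(2)] key[OF m_closed[OF a(2) b(2)] v] key[OF b(2) v]
          key[OF a(2) T.smult_closed[OF b(2) v]]
        by (rule T.smult_assoc1[OF a(2) b(2) v])
    qed
    show "\<forall>v\<in>carrier ?V. \<one>\<^bsub>?K\<^esub> \<odot>\<^bsub>?V\<^esub> v = v"
    proof
      fix v assume "v \<in> carrier ?V"
      then have v: "v \<in> carrier T" unfolding V .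
      show "\<one>\<^bsub>?K\<^esub> \<odot>\<^bsub>?V\<^esub> v = v" unfolding Kone key[OF one_closed v] by (rule T.smult_one[OF v])
    qed
    show "\<forall>a b v. a \<in> carrier ?K \<and> b \<in> carrier ?K \<and> v \<in> carrier ?V \<longrightarrow>
        (a \<oplus>\<^bsub>?K\<^esub> b) \<odot>\<^bsub>?V\<^esub> v = a \<odot>\<^bsub>?V\<^esub> v \<oplus>\<^bsub>?V\<^esub> b \<odot>\<^bsub>?V\<^esub> v"
    proof (intro allI impI, elim conjE)
      fix c c' v assume "c \<in> carrier ?K" "c' \<in> carrier ?K" "v \<in> carrier ?V"
      then obtain a b where a: "c = \<mm> +> a" "a \<in> carrier R" and b: "c' = \<mm> +> b" "b \<in> carrier R"
        and v: "v \<in> carrier T" using Kel V(1) by blast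
      show "(c \<oplus>\<^bsub>?K\<^esub> c') \<odot>\<^bsub>?V\<^esub> v = c \<odot>\<^bsub>?V\<^esub> v \<oplus>\<^bsub>?V\<^esub> c' \<odot>\<^bsub>?V\<^esub> v"
        unfolding a(1) b(1) Kadd[OF a(2) b(2)] key[OF a_closed[OF a(2) b(2)] v] key[OF b(2) v] key[OF a(2) v] V(3)
        by (rule T.smult_l_distr[OF a(2) b(2) v])
    qed
    show "\<forall>a v w. a \<in> carrier ?K \<and> v \<in> carrier ?V \<and> w \<in> carrier ?V \<longrightarrow>
        a \<odot>\<^bsub>?V\<^esub> (v \<oplus>\<^bsub>?V\<^esub> w) = a \<odot>\<^bsub>?V\<^esub> v \<oplus>\<^bsub>?V\<^esub> a \<odot>\<^bsub>?V\<^esub> w"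
    proof (intro allI impI, elim conjE)
      fix c v w assume "c \<in> carrier ?K" "v \<in> carrier ?V" "w \<in> carrier ?V"
      then obtain a where a: "c = \<mm> +> a" "a \<in> carrier R" and v: "v \<in> carrier T" and w: "w \<in> carrier T"
        using Kel V(1) by blast
      show "c \<odot>\<^bsub>?V\<^esub> (v \<oplus>\<^bsub>?V\<^esub> w) = c \<odot>\<^bsub>?V\<^esub> v \<oplus>\<^bsub>?V\<^esub> c \<odot>\<^bsub>?V\<^esub> w"
        unfolding a(1) V(3) key[OF a(2) v] key[OF a(2) w] key[OF a(2) T.M.a_closed[OF v w]]
        by (rule T.smult_r_distr[OF a(2) v w])
    qed
  qed
  interpret V: module ?K ?V by (rule VM)
  have vs: "vectorspace ?K ?V" by (rule vectorspace.intro[OF VM fK])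
  have sub\<rho>: "\<rho> z = \<rho> w" if z: "z \<in> Z" and w: "w \<in> Z" and d: "z \<ominus>\<^bsub>X\<^esub> w \<in> B" for z w
  proof -
    have zc: "z \<in> carrier X" and wc: "w \<in> carrier X" using ZD(6) z w by blast+
    have dz: "z \<ominus>\<^bsub>X\<^esub> w \<in> Z" by (rule submodule_minus[OF Z z w])
    have "\<rho> z = \<rho> ((z \<ominus>\<^bsub>X\<^esub> w) \<oplus>\<^bsub>X\<^esub> w)" unfolding X.minus_add_cancel(2)[OF wc zc] ..
    also have "\<dots> = \<rho> (z \<ominus>\<^bsub>X\<^esub> w) \<oplus>\<^bsub>T\<^esub> \<rho> w" by (rule add[OF dz w])
    also have "\<rho> (z \<ominus>\<^bsub>X\<^esub> w) = \<zero>\<^bsub>T\<^esub>" using ker[OF dz] d by blast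
    finally show ?thesis unfolding T.M.l_zero[OF cT[OF w]] .
  qed
  have \<rho>sub: "z \<ominus>\<^bsub>X\<^esub> w \<in> B" if z: "z \<in> Z" and w: "w \<in> Z" and e: "\<rho> z = \<rho> w" for z w
  proof -
    have zc: "z \<in> carrier X" and wc: "w \<in> carrier X" using ZD(6) z w by blast+
    have dz: "z \<ominus>\<^bsub>X\<^esub> w \<in> Z" by (rule submodule_minus[OF Z z w])
    have "\<rho> (z \<ominus>\<^bsub>X\<^esub> w) \<oplus>\<^bsub>T\<^esub> \<rho> w = \<rho> w"
      unfolding add[OF dz w, symmetric] X.minus_add_cancel(2)[OF wc zc] by (rule e)
    then have "\<rho> (z \<ominus>\<^bsub>X\<^esub> w) = \<zero>\<^bsub>T\<^esub>" using T.M.add.r_cancel_one[OF cT[OF w] cT[OF dz]] by blast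
    then show ?thesis using ker[OF dz] by blast
  qed
  \<comment> \<open>Lift a spanning set to Z and extend linearly. The values form a subspace
    containing the spanning set, so every class of Z / B is reached.\<close>
  have 1: "generated_by X Z B n" if exA: "\<exists>A. finite A \<and> card A = n \<and> A \<subseteq> carrier ?V \<and> V.span A = carrier ?V" for n
  proof -
    obtain A where A: "finite A" "card A = n" "A \<subseteq> carrier ?V" "V.span A = carrier ?V"
      using exA by (elim exE conjE)
    obtain u where u: "bij_betw u {..<n} A"
      using ex_bij_betw_nat_finite[OF A(1)] unfolding atLeast0LessThan A(2) by blast
    have uT: "u i \<in> carrier T" if "i < n" for i using bij_betwE[OF u] that A(3) unfolding V(1) by blast
    have "\<exists>z. z \<in> Z \<and> (i < n \<longrightarrow> u i = \<rho> z)" for i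
    proof (cases "i < n")
      case True
      then show ?thesis using exZ[OF uT[OF True]] by blast
    next
      case False
      then show ?thesis using ZD(3) by blast
    qed
    from choice[OF allI[OF this]] obtain z where "\<forall>i. z i \<in> Z \<and> (i < n \<longrightarrow> u i = \<rho> (z i))" ..
    then have z: "z i \<in> Z" "i < n \<Longrightarrow> u i = \<rho> (z i)" for i by simp_all
    obtain h where h: "h \<in> module_hom R (power_module R n) X" "\<And>i. i < n \<Longrightarrow> h (uvec n i) = z i"
      using pm_hom_exists[OF X, of n z] ZD(6)[OF z(1)] by blast
    have hZ: "h c \<in> Z" if c: "c \<in> carrier (power_module R n)" for c
    proof -
      have "{c \<in> carrier (power_module R n). h c \<in> Z} = carrier (power_module R n)"
        by (rule pm_submodule_eq[OF submodule_preimage[OF pm_module h(1) Z]]) (simp add: h(2) z(1) uvec_closed)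
      from subsetD[OF equalityD2[OF this] c] show ?thesis by blast
    qed
    interpret P: module R "power_module R n" by (rule pm_module)
    let ?W = "(\<lambda>c. \<rho> (h c)) ` carrier (power_module R n)"
    have W: "submodule ?K ?W ?V"
    proof (rule submodule.intro[OF VM])
      show "?W \<subseteq> carrier ?V" unfolding V(1) using cT hZ by blast
      have "\<rho> (h \<zero>\<^bsub>power_module R n\<^esub>) = \<zero>\<^bsub>?V\<^esub>" unfolding module_hom_zero_minus(1)[OF pm_module X h(1)] \<rho>0 V ..
      then show "\<zero>\<^bsub>?V\<^esub> \<in> ?W" using P.M.zero_closed by (rule image_eqI[OF sym])
    next
      fix v w assume "v \<in> ?W" "w \<in> ?W"
      then obtain c c' where c: "v = \<rho> (h c)" "c \<in> carrier (power_module R n)"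
        and c': "w = \<rho> (h c')" "c' \<in> carrier (power_module R n)" by blast
      have "v \<oplus>\<^bsub>?V\<^esub> w = \<rho> (h (c \<oplus>\<^bsub>power_module R n\<^esub> c'))"
        unfolding V(3) c(1) c'(1) module_homD(2)[OF h(1) c(2) c'(2)] add[OF hZ[OF c(2)] hZ[OF c'(2)]] ..
      then show "v \<oplus>\<^bsub>?V\<^esub> w \<in> ?W" using P.M.a_closed[OF c(2) c'(2)] by (rule image_eqI)
    next
      fix x v assume "x \<in> carrier ?K" "v \<in> ?W"
      then obtain a c where a: "x = \<mm> +> a" "a \<in> carrier R"
        and c: "v = \<rho> (h c)" "c \<in> carrier (power_module R n)" using Kel by blast
      have "x \<odot>\<^bsub>?V\<^esub> v = \<rho> (h (a \<odot>\<^bsub>power_module R n\<^esub> c))"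
        unfolding a(1) c(1) key[OF a(2) cT[OF hZ[OF c(2)]]] module_homD(3)[OF h(1) a(2) c(2)]
          smult[OF a(2) hZ[OF c(2)]] ..
      then show "x \<odot>\<^bsub>?V\<^esub> v \<in> ?W" using P.smult_closed[OF a(2) c(2)] by (rule image_eqI)
    qed
    have "A \<subseteq> ?W"
    proof
      fix t assume "t \<in> A"
      then obtain i where i: "i < n" "t = u i" using bij_betw_imp_surj_on[OF u] by blast
      have "t = \<rho> (h (uvec n i))" unfolding i(2) h(2)[OF i(1)] by (rule z(2)[OF i(1)])
      then show "t \<in> ?W" using uvec_closed by (rule image_eqI)
    qed
    from V.span_is_subset[OF this W] have VW: "carrier T \<subseteq> ?W" unfolding A(4) V(1) .
    show ?thesis unfolding generated_by_def
    proof (intro bexI[OF _ h(1)] conjI ballI)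
      show "h c \<in> Z" if "c \<in> carrier (power_module R n)" for c by (rule hZ[OF that])
      fix w assume w: "w \<in> Z"
      obtain c where c: "\<rho> w = \<rho> (h c)" "c \<in> carrier (power_module R n)"
        using subsetD[OF VW cT[OF w]] by (rule imageE)
      show "\<exists>c\<in>carrier (power_module R n). w \<ominus>\<^bsub>X\<^esub> h c \<in> B"
        by (rule bexI[OF _ c(2)]) (rule \<rho>sub[OF w hZ[OF c(2)] c(1)])
    qed
  qed
  \<comment> \<open>Conversely, the classes of the images of the unit vectors span, because their
    span pulls back to a submodule of the free module containing all unit vectors.\<close>
  have 2: "\<exists>n\<le>k. \<exists>A. finite A \<and> card A = n \<and> A \<subseteq> carrier ?V \<and> V.span A = carrier ?V"
    if "generated_by X Z B k" for k
  proof -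
    obtain h where h: "h \<in> module_hom R (power_module R k) X"
      "\<And>c. c \<in> carrier (power_module R k) \<Longrightarrow> h c \<in> Z"
      "\<And>z. z \<in> Z \<Longrightarrow> \<exists>c\<in>carrier (power_module R k). z \<ominus>\<^bsub>X\<^esub> h c \<in> B"
      using \<open>generated_by X Z B k\<close> unfolding generated_by_def by blast
    let ?A = "(\<lambda>i. \<rho> (h (uvec k i))) ` {..<k}"
    have A: "?A \<subseteq> carrier ?V" unfolding V(1) using cT[OF h(2)[OF uvec_closed]] by blast
    have sp: "submodule ?K (V.span ?A) ?V" by (rule V.span_is_submodule[OF A])
    note SD = submoduleD[OF sp]
    interpret P: module R "power_module R k" by (rule pm_module)
    let ?N = "{c \<in> carrier (power_module R k). \<rho> (h c) \<in> V.span ?A}"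
    have N: "submodule R ?N (power_module R k)"
    proof (rule submodule.intro[OF pm_module])
      show "?N \<subseteq> carrier (power_module R k)" by blast
      have "\<rho> (h \<zero>\<^bsub>power_module R k\<^esub>) = \<zero>\<^bsub>?V\<^esub>" unfolding module_hom_zero_minus(1)[OF pm_module X h(1)] \<rho>0 V ..
      then have "\<rho> (h \<zero>\<^bsub>power_module R k\<^esub>) \<in> V.span ?A" using SD(3) by (rule ssubst[where P = "\<lambda>w. w \<in> V.span ?A"])
      then show "\<zero>\<^bsub>power_module R k\<^esub> \<in> ?N" using P.M.zero_closed by blast
    next
      fix v w assume "v \<in> ?N" "w \<in> ?N"
      then have v: "v \<in> carrier (power_module R k)" "\<rho> (h v) \<in> V.span ?A"
        and w: "w \<in> carrier (power_module R k)" "\<rho> (h w) \<in> V.span ?A" by blast+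
      have "\<rho> (h (v \<oplus>\<^bsub>power_module R k\<^esub> w)) \<in> V.span ?A"
        unfolding module_homD(2)[OF h(1) v(1) w(1)] add[OF h(2)[OF v(1)] h(2)[OF w(1)]] V(3)[symmetric]
        by (rule SD(4)[OF v(2) w(2)])
      then show "v \<oplus>\<^bsub>power_module R k\<^esub> w \<in> ?N" using P.M.a_closed[OF v(1) w(1)] by blast
    next
      fix a v assume a: "a \<in> carrier R" and "v \<in> ?N"
      then have v: "v \<in> carrier (power_module R k)" "\<rho> (h v) \<in> V.span ?A" by blast+
      have aK: "\<mm> +> a \<in> carrier ?K" using a unfolding FactRing_def A_RCOSETS_def' by auto
      have "\<rho> (h (a \<odot>\<^bsub>power_module R k\<^esub> v)) \<in> V.span ?A"
        unfolding module_homD(3)[OF h(1) a v(1)] smult[OF a h(2)[OF v(1)]] key[OF a cT[OF h(2)[OF v(1)]], symmetric]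
        by (rule SD(5)[OF aK v(2)])
      then show "a \<odot>\<^bsub>power_module R k\<^esub> v \<in> ?N" using P.smult_closed[OF a v(1)] by blast
    qed
    have Nall: "?N = carrier (power_module R k)"
    proof (rule pm_submodule_eq[OF N])
      fix i assume "i < k"
      then have "\<rho> (h (uvec k i)) \<in> V.span ?A" using V.in_own_span[OF A] by blast
      then show "uvec k i \<in> ?N" using uvec_closed by blast
    qed
    have "carrier ?V \<subseteq> V.span ?A"
    proof
      fix t assume "t \<in> carrier ?V"
      then have "t \<in> carrier T" unfolding V(1) .
      from exZ[OF this] obtain z where z: "t = \<rho> z" "z \<in> Z" by (elim exE conjE)
      obtain c where c: "z \<ominus>\<^bsub>X\<^esub> h c \<in> B" "c \<in> carrier (power_module R k)" using h(3)[OF z(2)] by (rule bexE)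
      show "t \<in> V.span ?A"
        unfolding z(1) sub\<rho>[OF z(2) h(2)[OF c(2)] c(1)] using subsetD[OF equalityD2[OF Nall] c(2)] by blast
    qed
    then have "V.span ?A = carrier ?V" using SD(2) by blast
    moreover have "card ?A \<le> k" using card_image_le[of "{..<k}" "\<lambda>i. \<rho> (h (uvec k i))"] by simp
    ultimately show ?thesis using A by (intro exI[of _ "card ?A"] exI[of _ ?A] conjI) simp_all
  qed
  show ?thesis unfolding vectorspace.dim_def[OF vs]
    by (rule Least_cofinal_eq[where Q = "generated_by X Z B", OF _ _ gen]) (rule 1, assumption, rule 2, assumption)
qed

lemma cycles_submodule:
  assumes "free_resolution R X (r, d, e)"
  shows "submodule R (cycles r d i) (power_module R (r i))"
proof (cases i)
  case 0
  then show ?thesis unfolding cycles_def using module.submodule_carrier[OF pm_module] by simp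
next
  case (Suc j)
  show ?thesis unfolding cycles_def Suc
    using submodule_preimage[OF pm_module free_resolutionD(1)[OF assms] ivec_submodule[OF max_ideal_ideal], of j]
    by simp
qed

text \<open>Along \<pi> the cycles of k \<otimes> F are the images of the vectors v with d v in
  \<mm> F, and a vector maps to a boundary exactly if it is a boundary of F up to \<mm> F. So the
  homology is computed by submodules of F.\<close>

lemma dim_tensor_homology:
  assumes P: "free_resolution R X (r, d, e)"
    and gen: "generated_by (power_module R (r i)) (cycles r d i) (boundaries r d i) k0"
  shows "vectorspace.dim (residue_field R) (over_quotient (tensor_homology R res_mod (r, d, e) i)) =
    (LEAST k. generated_by (power_module R (r i)) (cycles r d i) (boundaries r d i) k)"
proof -
  note D = free_resolutionD[OF P]
  let ?F = "\<lambda>j. power_module R (r j)" and ?T = "\<lambda>j. res_tensor (r j)"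
  let ?D = "\<lambda>j. tensor_map R res_mod (?F j) (?F (j - 1)) (d j)"
  let ?p = "\<pi> (r i)"
  interpret T: module R "?T i" by (rule res_tensor_module)
  interpret F: module R "?F i" by (rule pm_module)
  have Z: "submodule R (cycles r d i) (?F i)" by (rule cycles_submodule[OF P])
  note B = boundaries_submodule[OF P, of i]
  have Dh: "?D (Suc j) \<in> module_hom R (?T (Suc j)) (?T j)" for j
    using tensor_map_\<pi>(1)[OF D(1)[of j]] by simp
  have D\<pi>: "?D (Suc j) (\<pi> (r (Suc j)) v) = \<pi> (r j) (d (Suc j) v)" if "v \<in> carrier (?F (Suc j))" for j v
    using tensor_map_\<pi>(2)[OF D(1)[of j] that] by simp
  define Cy where "Cy = (if i = 0 then carrier (?T 0) else a_kernel (?T i) (?T (i - 1)) (?D i))"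
  define Bo where "Bo = ?D (Suc i) ` carrier (?T (Suc i))"
  have Cy: "Cy = ?p ` cycles r d i"
  proof (cases i)
    case 0
    then show ?thesis unfolding Cy_def cycles_def using \<pi>_surj by simp
  next
    case (Suc j)
    show ?thesis
    proof (intro equalityI subsetI)
      fix t assume "t \<in> Cy"
      then have t: "t \<in> carrier (?T i)" "?D i t = \<zero>\<^bsub>?T j\<^esub>" unfolding Cy_def a_kernel_def' Suc by simp_all
      obtain v where v: "t = ?p v" "v \<in> carrier (?F i)" using t(1) unfolding \<pi>_surj[symmetric] by (rule imageE)
      have "\<pi> (r j) (d i v) = \<zero>\<^bsub>?T j\<^esub>" using t(2) unfolding v(1) Suc D\<pi>[OF v(2)[unfolded Suc]] .
      then have "d i v \<in> ivec \<mm> (r j)"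
        using \<pi>_zero_imp_ivec[OF module_homD(1)[OF D(1) v(2)[unfolded Suc]]] unfolding Suc by simp
      then have "v \<in> cycles r d i" unfolding cycles_def using v(2) Suc by simp
      with v(1) show "t \<in> ?p ` cycles r d i" by (rule image_eqI)
    next
      fix t assume "t \<in> ?p ` cycles r d i"
      then obtain v where v: "t = ?p v" "v \<in> cycles r d i" by (rule imageE)
      have vc: "v \<in> carrier (?F (Suc j))" and dv: "d (Suc j) v \<in> ivec \<mm> (r j)"
        using v(2) unfolding cycles_def Suc by simp_all
      have "?D i t = \<zero>\<^bsub>?T j\<^esub>" unfolding v(1) Suc D\<pi>[OF vc] by (rule \<pi>_zero_ivec[OF dv])
      moreover have "t \<in> carrier (?T i)" unfolding v(1) using module_homD(1)[OF \<pi>_hom vc] unfolding Suc .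
      ultimately show "t \<in> Cy" unfolding Cy_def a_kernel_def' by (simp add: Suc)
    qed
  qed
  have Bo: "Bo = ?p ` d (Suc i) ` carrier (?F (Suc i))"
    unfolding Bo_def \<pi>_surj[symmetric] image_image by (rule image_cong[OF refl]) (rule D\<pi>)
  have CyS: "submodule R Cy (?T i)" unfolding Cy by (rule submodule_image[OF Z res_tensor_module \<pi>_hom])
  let ?M = "(?T i)\<lparr>carrier := Cy\<rparr>"
  have M: "module R ?M" by (rule T.submodule_is_module[OF CyS])
  interpret M: module R ?M by (rule M)
  have dZ: "d (Suc i) w \<in> cycles r d i" if w: "w \<in> carrier (?F (Suc i))" for w
  proof -
    have "d i (d (Suc i) w) \<in> ivec \<mm> (r (i - 1))" if "i \<noteq> 0"
    proof -
      obtain j where j: "i = Suc j" using \<open>i \<noteq> 0\<close> by (cases i) auto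
      show ?thesis unfolding j differential_zero[OF P w[unfolded j]]
        using submoduleD(3)[OF ivec_submodule[OF max_ideal_ideal]] by simp
    qed
    then show ?thesis unfolding cycles_def using module_homD(1)[OF D(1) w] by blast
  qed
  have BoS: "submodule R Bo ?M"
  proof -
    have "submodule R Bo (?T i)"
      unfolding Bo_def by (rule submodule_image[OF module.submodule_carrier[OF res_tensor_module] res_tensor_module Dh])
    moreover have "Bo \<subseteq> Cy" unfolding Bo Cy using dZ by blast
    ultimately show ?thesis using M unfolding submodule_def by simp
  qed
  note Q = M.quotient_module_ops[OF BoS]
  define \<rho> where "\<rho> = (\<lambda>z. Bo +>\<^bsub>?M\<^esub> ?p z)"
  have pM: "?p z \<in> carrier ?M" if "z \<in> cycles r d i" for z
    using that unfolding Cy by simp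
  have ZF: "z \<in> carrier (?F i)" if "z \<in> cycles r d i" for z by (rule submoduleD(6)[OF Z that])
  have th: "tensor_homology R res_mod (r, d, e) i = quotient_module ?M Bo"
    unfolding tensor_homology_def Let_def Cy_def Bo_def by (simp cong: if_cong)
  show ?thesis unfolding th
  proof (rule dim_over_quotient[OF pm_module Z B(1), of \<rho> "quotient_module ?M Bo", OF _ _ _ _ _ gen])
    show "a \<odot>\<^bsub>?F i\<^esub> z \<in> boundaries r d i" if "a \<in> \<mm>" "z \<in> cycles r d i" for a z
      by (rule subsetD[OF B(3) smult_in_ivec[OF max_ideal_ideal that(1) ZF[OF that(2)]]])
    show "\<rho> ` cycles r d i = carrier (quotient_module ?M Bo)"
      unfolding Q(1) \<rho>_def by (simp add: Cy image_image)
    show "\<rho> (x \<oplus>\<^bsub>?F i\<^esub> y) = \<rho> x \<oplus>\<^bsub>quotient_module ?M Bo\<^esub> \<rho> y"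
      if x: "x \<in> cycles r d i" and y: "y \<in> cycles r d i" for x y
      unfolding \<rho>_def Q(2)[OF pM[OF x] pM[OF y]] module_homD(2)[OF \<pi>_hom ZF[OF x] ZF[OF y]] by simp
    show "\<rho> (a \<odot>\<^bsub>?F i\<^esub> x) = a \<odot>\<^bsub>quotient_module ?M Bo\<^esub> \<rho> x"
      if a: "a \<in> carrier R" and x: "x \<in> cycles r d i" for a x
      unfolding \<rho>_def Q(3)[OF a pM[OF x]] module_homD(3)[OF \<pi>_hom a ZF[OF x]] by simp
    fix z assume z: "z \<in> cycles r d i"
    have "\<rho> z = \<zero>\<^bsub>quotient_module ?M Bo\<^esub> \<longleftrightarrow> ?p z \<in> Bo"
      unfolding \<rho>_def by (rule M.coset_zero_iff[OF BoS pM[OF z]])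
    also have "\<dots> \<longleftrightarrow> z \<in> boundaries r d i"
    proof
      assume "?p z \<in> Bo"
      then obtain w where w: "?p z = ?p (d (Suc i) w)" "w \<in> carrier (?F (Suc i))" unfolding Bo by blast
      have dw: "d (Suc i) w \<in> carrier (?F i)" by (rule module_homD(1)[OF D(1) w(2)])
      have "z \<ominus>\<^bsub>?F i\<^esub> d (Suc i) w \<in> ivec \<mm> (r i)" using \<pi>_eq_iff[OF ZF[OF z] dw] w(1) by blast
      from msumI[OF imageI[OF w(2), of "d (Suc i)"] this, of "?F i"]
      show "z \<in> boundaries r d i" unfolding F.minus_add_cancel(1)[OF dw ZF[OF z]] boundaries_def .
    next
      assume "z \<in> boundaries r d i"
      then obtain y u where yu: "y \<in> d (Suc i) ` carrier (?F (Suc i))" "u \<in> ivec \<mm> (r i)" "z = y \<oplus>\<^bsub>?F i\<^esub> u"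
        unfolding boundaries_def by (rule msumE)
      have yc: "y \<in> carrier (?F i)" using yu(1) module_homD(1)[OF D(1)] by blast
      have uc: "u \<in> carrier (?F i)" using yu(2) unfolding ivec_def by blast
      have "?p z = ?p y"
        unfolding yu(3) module_homD(2)[OF \<pi>_hom yc uc] \<pi>_zero_ivec[OF yu(2)]
        by (rule T.M.r_zero[OF module_homD(1)[OF \<pi>_hom yc]])
      then show "?p z \<in> Bo" unfolding Bo using yu(1) by simp
    qed
    finally show "\<rho> z = \<zero>\<^bsub>quotient_module ?M Bo\<^esub> \<longleftrightarrow> z \<in> boundaries r d i" .
  qed
qed

text \<open>\<open>Tor\<close> uses whatever free resolution was chosen. The number of generators of
  its homology is compared with that for the minimal resolution, where it is the rank.\<close>

lemma betti_eq_rank: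
  assumes X: "module R X" and P: "minimal_free_resolution R X (r, d, e)"
  shows "betti R X i = r i"
proof -
  have fr: "free_resolution R X (r, d, e)" using P unfolding minimal_free_resolution_def by simp
  obtain r' d' e' where P': "(SOME P. free_resolution R X P) = (r', d', e')" by (rule prod_cases3)
  have fr': "free_resolution R X (r', d', e')"
    using someI[of "free_resolution R X", OF fr] unfolding P' .
  let ?G = "\<lambda>k. generated_by (power_module R (r i)) (cycles r d i) (boundaries r d i) k"
  let ?G' = "\<lambda>k. generated_by (power_module R (r' i)) (cycles r' d' i) (boundaries r' d' i) k"
  have eq: "?G' k \<longleftrightarrow> ?G k" for k
    using generated_by_comparison[OF X fr fr'] generated_by_comparison[OF X fr' fr] by blast
  have "betti R X i = (LEAST k. ?G' k)"
    unfolding betti_def Tor_def P'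
    by (rule dim_tensor_homology[OF fr' iffD2[OF eq generated_by_minimal(1)[OF P]]])
  also have "\<dots> = r i"
    unfolding eq by (rule Least_equality) (rule generated_by_minimal(1)[OF P], rule generated_by_minimal(2)[OF P])
  finally show ?thesis .
qed

section \<open>Supports\<close>

lemma Supp_iff:
  assumes X: "module R X"
  shows "p \<in> Supp R X \<longleftrightarrow> primeideal p R \<and> (\<exists>x\<in>carrier X. \<forall>s\<in>carrier R - p. s \<odot>\<^bsub>X\<^esub> x \<noteq> \<zero>\<^bsub>X\<^esub>)"
proof (cases "primeideal p R")
  case False
  then show ?thesis unfolding Supp_def Spec_def by simp
next
  case True
  interpret X: module R X by fact
  let ?S = "carrier R - p"
  note S = mult_setD[OF mult_set_prime[OF True]]
  let ?L = "localization R X ?S"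
  have carr: "carrier ?L = (carrier X \<times> ?S) // frac_rel X ?S" and zero: "\<zero>\<^bsub>?L\<^esub> = frac_rel X ?S `` {(\<zero>\<^bsub>X\<^esub>, \<one>)}"
    by (simp_all add: localization_def frac_def)
  have z1: "(\<zero>\<^bsub>X\<^esub>, \<one>) \<in> carrier X \<times> ?S" using S(2) by simp
  have "carrier ?L \<noteq> {\<zero>\<^bsub>?L\<^esub>} \<longleftrightarrow> (\<exists>x\<in>carrier X. \<forall>s\<in>?S. s \<odot>\<^bsub>X\<^esub> x \<noteq> \<zero>\<^bsub>X\<^esub>)"
  proof
    assume ne: "carrier ?L \<noteq> {\<zero>\<^bsub>?L\<^esub>}"
    show "\<exists>x\<in>carrier X. \<forall>s\<in>?S. s \<odot>\<^bsub>X\<^esub> x \<noteq> \<zero>\<^bsub>X\<^esub>"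
    proof (rule ccontr)
      assume "\<not> (\<exists>x\<in>carrier X. \<forall>s\<in>?S. s \<odot>\<^bsub>X\<^esub> x \<noteq> \<zero>\<^bsub>X\<^esub>)"
      then have k: "\<exists>s\<in>?S. s \<odot>\<^bsub>X\<^esub> x = \<zero>\<^bsub>X\<^esub>" if "x \<in> carrier X" for x using that by blast
      \<comment> \<open>If every element is killed by some denominator, any two fractions are
        equivalent, so the localization has a single class.\<close>
      have rel: "((x, s), (y, t)) \<in> frac_rel X ?S"
        if x: "x \<in> carrier X" and y: "y \<in> carrier X" and s: "s \<in> ?S" and t: "t \<in> ?S" for x y s t
      proof -
        have sc: "s \<in> carrier R" and tc: "t \<in> carrier R" using s t by blast+
        have tx: "t \<odot>\<^bsub>X\<^esub> x \<in> carrier X" and sy: "s \<odot>\<^bsub>X\<^esub> y \<in> carrier X"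
          by (rule X.smult_closed[OF tc x], rule X.smult_closed[OF sc y])
        obtain u where u: "u \<odot>\<^bsub>X\<^esub> (t \<odot>\<^bsub>X\<^esub> x) = \<zero>\<^bsub>X\<^esub>" "u \<in> ?S" using k[OF tx] by (rule bexE)
        obtain w where w: "w \<odot>\<^bsub>X\<^esub> (s \<odot>\<^bsub>X\<^esub> y) = \<zero>\<^bsub>X\<^esub>" "w \<in> ?S" using k[OF sy] by (rule bexE)
        have uc: "u \<in> carrier R" and wc: "w \<in> carrier R" using u(2) w(2) by blast+
        have "(u \<otimes> w) \<odot>\<^bsub>X\<^esub> (t \<odot>\<^bsub>X\<^esub> x) = \<zero>\<^bsub>X\<^esub>"
          unfolding m_comm[OF uc wc] X.smult_assoc1[OF wc uc tx] u(1) by (rule X.smult_r_null[OF wc])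
        moreover have "(u \<otimes> w) \<odot>\<^bsub>X\<^esub> (s \<odot>\<^bsub>X\<^esub> y) = \<zero>\<^bsub>X\<^esub>"
          unfolding X.smult_assoc1[OF uc wc sy] w(1) by (rule X.smult_r_null[OF uc])
        ultimately have "(u \<otimes> w) \<odot>\<^bsub>X\<^esub> (t \<odot>\<^bsub>X\<^esub> x) = (u \<otimes> w) \<odot>\<^bsub>X\<^esub> (s \<odot>\<^bsub>X\<^esub> y)" by (rule trans[OF _ sym])
        then show ?thesis unfolding frac_rel_def using S(3)[OF u(2) w(2)] x y s t by blast
      qed
      have cl: "frac_rel X ?S `` {z} = carrier X \<times> ?S" if "z \<in> carrier X \<times> ?S" for z
      proof (intro equalityI subsetI)
        fix y assume "y \<in> frac_rel X ?S `` {z}"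
        then show "y \<in> carrier X \<times> ?S" unfolding frac_rel_def by blast
      next
        fix y assume y: "y \<in> carrier X \<times> ?S"
        obtain a s b t where "z = (a, s)" "y = (b, t)" by (cases z, cases y)
        then show "y \<in> frac_rel X ?S `` {z}" using rel[of a b s t] that y by blast
      qed
      have "carrier ?L = {carrier X \<times> ?S}"
        unfolding carr quotient_def using cl z1 by blast
      then show False using ne unfolding zero cl[OF z1] by blast
    qed
  next
    assume "\<exists>x\<in>carrier X. \<forall>s\<in>?S. s \<odot>\<^bsub>X\<^esub> x \<noteq> \<zero>\<^bsub>X\<^esub>"
    then obtain x where x: "x \<in> carrier X" "\<And>s. s \<in> ?S \<Longrightarrow> s \<odot>\<^bsub>X\<^esub> x \<noteq> \<zero>\<^bsub>X\<^esub>" by blast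
    show "carrier ?L \<noteq> {\<zero>\<^bsub>?L\<^esub>}"
    proof
      assume eq: "carrier ?L = {\<zero>\<^bsub>?L\<^esub>}"
      have "frac_rel X ?S `` {(x, \<one>)} \<in> carrier ?L"
        unfolding carr by (rule quotientI) (use x(1) S(2) in blast)
      then have c: "frac_rel X ?S `` {(x, \<one>)} = frac_rel X ?S `` {(\<zero>\<^bsub>X\<^esub>, \<one>)}" unfolding eq zero by blast
      have "(x, \<one>) \<in> frac_rel X ?S `` {(x, \<one>)}" unfolding frac_rel_def using x(1) S(2) by blast
      then have "(x, \<one>) \<in> frac_rel X ?S `` {(\<zero>\<^bsub>X\<^esub>, \<one>)}" unfolding c .
      then obtain u where u: "u \<in> ?S" "u \<odot>\<^bsub>X\<^esub> (\<one> \<odot>\<^bsub>X\<^esub> \<zero>\<^bsub>X\<^esub>) = u \<odot>\<^bsub>X\<^esub> (\<one> \<odot>\<^bsub>X\<^esub> x)"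
        unfolding frac_rel_def by blast
      have "u \<in> carrier R" using u(1) by blast
      then have "u \<odot>\<^bsub>X\<^esub> x = \<zero>\<^bsub>X\<^esub>" using u(2) x(1) by simp
      then show False using x(2)[OF u(1)] by blast
    qed
  qed
  then show ?thesis using True unfolding Supp_def Spec_def by simp
qed

text \<open>Translates the support by localized modules into saturation: a class survives at p
  exactly if no multiple of its representative outside p is in B.\<close>

lemma Supp_quotient:
  assumes B: "submodule R B F"
  shows "Supp R (quotient_module F B) = {p. primeideal p R \<and> \<not> carrier F \<subseteq> sat F (carrier R - p) B}"
proof -
  interpret F: module R F by (rule submoduleD[OF B])
  note Q = F.quotient_module_ops[OF B]
  have zero: "s \<odot>\<^bsub>quotient_module F B\<^esub> (B +>\<^bsub>F\<^esub> x) = \<zero>\<^bsub>quotient_module F B\<^esub> \<longleftrightarrow> s \<odot>\<^bsub>F\<^esub> x \<in> B"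
    if "s \<in> carrier R" "x \<in> carrier F" for s x
    unfolding Q(3)[OF that] by (rule F.coset_zero_iff[OF B F.smult_closed[OF that]])
  show ?thesis
  proof (rule Set.set_eqI)
    fix p
    have "(\<exists>y\<in>carrier (quotient_module F B). \<forall>s\<in>carrier R - p. s \<odot>\<^bsub>quotient_module F B\<^esub> y \<noteq> \<zero>\<^bsub>quotient_module F B\<^esub>)
        \<longleftrightarrow> (\<exists>x\<in>carrier F. \<forall>s\<in>carrier R - p. s \<odot>\<^bsub>F\<^esub> x \<notin> B)"
      unfolding Q(1) bex_simps by (intro bex_cong ball_cong refl) (simp only: zero DiffD1)
    also have "\<dots> \<longleftrightarrow> \<not> carrier F \<subseteq> sat F (carrier R - p) B"
      unfolding sat_def by blast
    finally show "p \<in> Supp R (quotient_module F B) \<longleftrightarrow> p \<in> {p. primeideal p R \<and> \<not> carrier F \<subseteq> sat F (carrier R - p) B}"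
      unfolding Supp_iff[OF F.quotient_module_is_module(1)[OF B]] mem_Collect_eq by (rule conj_cong[OF refl])
  qed
qed

text \<open>The element 1 survives at every prime. Consequently the minimal support of
  \<open>R\<close> consists of all its minimal primes.\<close>

lemma Supp_ring_module: "Supp R (ring_module R) = Spec R"
proof (intro equalityI subsetI)
  fix p assume "p \<in> Spec R"
  then have p: "primeideal p R" unfolding Spec_def by blast
  interpret p: primeideal p R by (rule p)
  have "s \<odot>\<^bsub>ring_module R\<^esub> \<one> \<noteq> \<zero>\<^bsub>ring_module R\<^esub>" if s: "s \<in> carrier R - p" for s
  proof
    have sc: "s \<in> carrier R" using s by blast
    assume "s \<odot>\<^bsub>ring_module R\<^esub> \<one> = \<zero>\<^bsub>ring_module R\<^esub>"
    then have "s = \<zero>" unfolding ring_module_simps r_one[OF sc] .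
    then show False using s p.zero_closed by blast
  qed
  then show "p \<in> Supp R (ring_module R)"
    unfolding Supp_iff[OF ring_module_module] using p one_closed unfolding ring_module_simps(1) by blast
qed (simp add: Supp_def)

end

theorem theorem8:
  fixes R :: "('a, 'r) ring_scheme" and M :: "('a, 'b, 'm) module_scheme"
  assumes "noetherian_local_ring R"
    and "module R M"
    and "finitely_generated R M"
    and "\<exists>N\<^sub>0. \<forall>i\<ge>N\<^sub>0. betti R M i \<le> betti R M (i + 1)"
  shows "\<exists>N. \<forall>n\<ge>N.
           Min_Supp R (syzygy R M n) \<subseteq> Min_Supp R (ring_module R) \<and>
           (\<forall>i. Supp R (syzygy R M n) = Supp R (syzygy R M (n + 2 * i))) \<and>
           (Supp R (syzygy R M n) \<noteq> Spec R \<longrightarrow>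
              (\<forall>i. betti R M (n + 2 * i) = betti R M (n + 2 * i + 1)))"
proof -
  interpret noetherian_local_ring R by fact
  \<comment> \<open>The minimal resolution on which \<open>syzygy\<close> is based, fixed for all n
    at once; the Betti numbers are its ranks.\<close>
  obtain r d e where P: "(SOME P. minimal_free_resolution R M P) = (r, d, e)" by (rule prod_cases3)
  have mr: "minimal_free_resolution R M (r, d, e)"
    using someI_ex[OF minimal_free_resolution_exists[OF assms(2,3)]] unfolding P .
  have fr: "free_resolution R M (r, d, e)" using mr unfolding minimal_free_resolution_def by simp
  have betti: "betti R M i = r i" for i by (rule betti_eq_rank[OF assms(2) mr])
  interpret C: exact_free_complex R r d by (rule resolution_complex[OF fr])
  have Supp: "Supp R (syzygy R M n) = C.supp n" for n
    unfolding syzygy_def P prod.case C.supp_def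
    using Supp_quotient[OF C.bound_submodule, of n] unfolding C.bound_def by simp
  obtain N\<^sub>0 where N0: "\<And>i. i \<ge> N\<^sub>0 \<Longrightarrow> r i \<le> r (Suc i)" using assms(4) unfolding betti Suc_eq_plus1 by blast
  from C.supp_stable[OF N0] obtain N where N: "\<forall>n\<ge>N.
    (\<forall>p\<in>C.supp n. (\<forall>q\<in>C.supp n. q \<subseteq> p \<longrightarrow> q = p) \<longrightarrow> (\<forall>q. primeideal q R \<longrightarrow> q \<subseteq> p \<longrightarrow> q = p)) \<and>
    (\<forall>i. C.supp n = C.supp (n + 2 * i)) \<and>
    (C.supp n \<noteq> {p. primeideal p R} \<longrightarrow> (\<forall>i. r (n + 2 * i) = r (n + 2 * i + 1)))" ..
  show ?thesis
  proof (intro exI[of _ N] allI impI)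
    fix n assume n: "n \<ge> N"
    note Nn = mp[OF spec[OF N, of n] n]
    have "Min_Supp R (syzygy R M n) \<subseteq> Min_Supp R (ring_module R)"
    proof
      fix p assume "p \<in> Min_Supp R (syzygy R M n)"
      then have p: "p \<in> C.supp n" "\<forall>q\<in>C.supp n. q \<subseteq> p \<longrightarrow> q = p" unfolding Min_Supp_def Supp by blast+
      have "primeideal p R" using p(1) unfolding C.supp_def by blast
      moreover have "\<forall>q. primeideal q R \<longrightarrow> q \<subseteq> p \<longrightarrow> q = p" using conjunct1[OF Nn] p by blast
      ultimately show "p \<in> Min_Supp R (ring_module R)"
        unfolding Min_Supp_def Supp_ring_module Spec_def by blast
    qed
    then show "Min_Supp R (syzygy R M n) \<subseteq> Min_Supp R (ring_module R) \<and>
        (\<forall>i. Supp R (syzygy R M n) = Supp R (syzygy R M (n + 2 * i))) \<and>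
        (Supp R (syzygy R M n) \<noteq> Spec R \<longrightarrow> (\<forall>i. betti R M (n + 2 * i) = betti R M (n + 2 * i + 1)))"
      using conjunct2[OF Nn] unfolding Supp Spec_def betti by blast
  qed
qed

end
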